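(* Let $(L,V)$ be a lattice pair of rank $r=[\mathfrak K:\mathbb F_q(T)]$ and dimension $n$ with complete multiplication by $\mathbf A_{\mathfrak K}$ of CM-type $\Phi$, and suppose its dual pair $(L',V')$ exists, so that $\mathbf A_{\mathfrak K}$ acts on $(L',V')$ by the dual (adjoint) action, with CM-type the complement $\Phi'$. Then $$\mathrm{Cl}(L',\Phi')=\mathrm{Cl}(\mathfrak d)^{-1}\,\mathrm{Cl}(L,\Phi)^{-1}$$ in $\mathrm{Cl}(\mathbf A_{\mathfrak K})$, where $\mathfrak d$ is the different ideal of $\mathbf A_{\mathfrak K}$ over $\mathbb F_q[\theta]$.
   Context: $\mathbb C_\infty$ is the completion of an algebraic closure of $\mathbb F_q((1/\theta))$; $\mathbb F_q(T)$ is identified with $\mathbb F_q(\theta)$ via $T\mapsto\theta$. $\mathfrak K$ is a finite separable extension of $\mathbb F_q(T)$ with $\mathfrak K\otimes_{\mathbb F_q}\mathbb C_\infty$ a field and exactly one place over $\infty$; $\mathbf A_{\mathfrak K}$ is the ring of elements regular outside that place; $\alpha_1,\dots,\alpha_r$ are the embeddings $\mathfrak K\to\mathbb C_\infty$ over $T\mapsto\theta$. A lattice of rank $r$ in $V=\mathbb C_\infty^n$ is a free $\mathbb F_q[\theta]$-submodule of rank $r$ spanning $V$ with $\mathbb F_q((1/\theta))$-span of dimension $r$. Complete multiplication by $\mathbf A_{\mathfrak K}$ of CM-type $\Phi\subset\{\alpha_1,\dots,\alpha_r\}$: an injective ring homomorphism from $\mathbf A_{\mathfrak K}$ to the $\mathbb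 C_\infty$-linear endomorphisms of $V$ preserving $L$, extending $T\mapsto\theta$, such that $V\cong\bigoplus_{\alpha\in\Phi}\alpha$ as a $\mathfrak K$-representation. Then $L$ is isomorphic as an $\mathbf A_{\mathfrak K}$-module to an ideal of $\mathbf A_{\mathfrak K}$, whose class is denoted $\mathrm{Cl}(L,\Phi)$. A dual pair $(L',V')$: $L'$ a lattice of rank $r$ in $V'$ with a perfect $\mathbb F_q[\theta]$-bilinear pairing $\langle\,,\rangle:L\times L'\to\mathbb F_q[\theta]$ such that $\dim V'=r-n$ and $V^*\to(L\otimes\mathbb C_\infty)^*\cong L'\otimes\mathbb C_\infty\to V'$ vanishes; the dual action of $a\in\mathbf A_{\mathfrak K}$ on $L'$ is defined by $\langle al,l'\rangle=\langle l,al'\rangle$, and $\mathrm{Cl}(L',\Phi')$ is the class of $L'$ as an $\mathbf A_{\mathfrak K}$-module under this action. *)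

theory Defs
  imports
    "HOL-Analysis.Analysis"
    "HOL-Computational_Algebra.Computational_Algebra"
    "HOL-Library.Multiset"
    "HOL-Algebra.Coset"
begin

text \<open>
  Conventions. The finite field \<open>F\<^sub>q\<close> is a type \<open>'k :: {field, finite}\<close>, so \<open>q = CARD('k)\<close>.
  \<open>F\<^sub>q[T]\<close> is \<open>'k poly\<close> and \<open>F\<^sub>q(T)\<close> is \<open>'k poly fract\<close>. \<open>F\<^sub>q((1/\<theta>))\<close> is \<open>'k fls\<close>, the
  formal variable being \<open>1/\<theta>\<close>, so that \<open>\<theta>\<close> is \<open>fls_X_inv\<close>. As \<open>F\<^sub>q[T]\<close> and \<open>F\<^sub>q[\<theta>]\<close> are
  identified, \<open>'k poly\<close> also serves as \<open>F\<^sub>q[\<theta>]\<close>.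
\<close>

definition unital_ring_hom :: "('a::ring_1 \<Rightarrow> 'b::ring_1) \<Rightarrow> bool" where
  "unital_ring_hom f \<longleftrightarrow>
     f 1 = 1 \<and> (\<forall>x y. f (x + y) = f x + f y) \<and> (\<forall>x y. f (x * y) = f x * f y)"


section \<open>The field \<open>C\<^sub>\<infinity>\<close>\<close>

definition algebraic_over :: "('a::field \<Rightarrow> 'b::field) \<Rightarrow> 'b \<Rightarrow> bool" where
  "algebraic_over f z \<longleftrightarrow> (\<exists>p. p \<noteq> 0 \<and> poly (map_poly f p) z = 0)"

text \<open>
  A completion of an algebraic closure of \<open>F\<^sub>q((1/\<theta>))\<close>: a complete non-archimedean valued field
  extending \<open>F\<^sub>q((1/\<theta>))\<close> with its absolute value (normalised by \<open>|\<theta>| = q\<close>), in which the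
  elements algebraic over \<open>F\<^sub>q((1/\<theta>))\<close> form an algebraically closed and dense subfield.
  These properties determine \<open>C\<^sub>\<infinity>\<close> up to isometric isomorphism.
\<close>

locale C_infinity =
  fixes emb :: "'k::{field,finite} fls \<Rightarrow> 'c::field"
    and cabs :: "'c \<Rightarrow> real"
  assumes emb_hom: "unital_ring_hom emb"
    and cabs_nonneg: "cabs x \<ge> 0"
    and cabs_eq_0_iff: "cabs x = 0 \<longleftrightarrow> x = 0"
    and cabs_mult: "cabs (x * y) = cabs x * cabs y"
    and cabs_add: "cabs (x + y) \<le> max (cabs x) (cabs y)"
    and cabs_emb: "f \<noteq> 0 \<Longrightarrow> cabs (emb f) = real CARD('k) powi (- fls_subdegree f)"
    and alg_closed:
      "degree p > 0 \<Longrightarrow> (\<forall>i. algebraic_over emb (coeff p i)) \<Longrightarrow>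
         \<exists>z. algebraic_over emb z \<and> poly p z = 0"
    and dense: "e > 0 \<Longrightarrow> \<exists>w. algebraic_over emb w \<and> cabs (z - w) < e"
    and complete:
      "(\<forall>e>0. \<exists>N. \<forall>i\<ge>N. \<forall>j\<ge>N. cabs (X i - X j) < e) \<Longrightarrow>
         \<exists>z. (\<lambda>i. cabs (X i - z)) \<longlonglongrightarrow> 0"

definition theta :: "('k::field fls \<Rightarrow> 'c::field) \<Rightarrow> 'c" where
  "theta emb = emb fls_X_inv"

definition const_C :: "('k::field fls \<Rightarrow> 'c::field) \<Rightarrow> 'k \<Rightarrow> 'c" where
  "const_C emb c = emb (fls_const c)"

definition eval_theta :: "('k::field fls \<Rightarrow> 'c::field) \<Rightarrow> 'k poly \<Rightarrow> 'c" where
  "eval_theta emb p = poly (map_poly (const_C emb) p) (theta emb)"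


section \<open>The field \<open>\<KK>\<close> and the ring \<open>A\<^sub>\<KK>\<close>\<close>

text \<open>Here \<open>\<iota>\<close> is the structure map from \<open>F\<^sub>q(T)\<close> to its extension field.\<close>

definition poly_K :: "('k::field poly fract \<Rightarrow> 'K::field) \<Rightarrow> 'k poly \<Rightarrow> 'K" where
  "poly_K \<iota> p = \<iota> (Fract p 1)"

definition const_K :: "('k::field poly fract \<Rightarrow> 'K::field) \<Rightarrow> 'k \<Rightarrow> 'K" where
  "const_K \<iota> c = poly_K \<iota> [:c:]"

definition T_K :: "('k::field poly fract \<Rightarrow> 'K::field) \<Rightarrow> 'K" where
  "T_K \<iota> = poly_K \<iota> [:0, 1:]"

definition scale_K :: "('k::field poly fract \<Rightarrow> 'K::field) \<Rightarrow> 'k poly fract \<Rightarrow> 'K \<Rightarrow> 'K" where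
  "scale_K \<iota> c x = \<iota> c * x"

definition degree_K :: "('k::field poly fract \<Rightarrow> 'K::field) \<Rightarrow> nat" where
  "degree_K \<iota> = vector_space.dim (scale_K \<iota>) UNIV"

definition finite_separable :: "('k::field poly fract \<Rightarrow> 'K::field) \<Rightarrow> bool" where
  "finite_separable \<iota> \<longleftrightarrow>
     unital_ring_hom \<iota> \<and>
     (\<exists>B. finite B \<and> module.span (scale_K \<iota>) B = UNIV) \<and>
     (\<forall>x. \<exists>p. irreducible p \<and> poly (map_poly \<iota> p) x = 0 \<and> coprime p (pderiv p))"

text \<open>A place is represented by its valuation ring; an element is regular there iff it lies in it.\<close>

definition places :: "('k::field poly fract \<Rightarrow> 'K::field) \<Rightarrow> 'K set set" where
  "places \<iota> =
     {R. range (const_K \<iota>) \<subseteq> R \<and> R \<noteq> UNIV \<and>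
         (\<forall>x\<in>R. \<forall>y\<in>R. x - y \<in> R \<and> x * y \<in> R) \<and>
         (\<forall>x. x \<noteq> 0 \<longrightarrow> x \<in> R \<or> inverse x \<in> R)}"

definition over_infinity :: "('k::field poly fract \<Rightarrow> 'K::field) \<Rightarrow> 'K set \<Rightarrow> bool" where
  "over_infinity \<iota> R \<longleftrightarrow> \<iota> -` R = {Fract f g | f g. g \<noteq> 0 \<and> degree f \<le> degree g}"

definition ring_A :: "('k::field poly fract \<Rightarrow> 'K::field) \<Rightarrow> 'K set" where
  "ring_A \<iota> = {x. \<forall>R\<in>places \<iota>. \<not> over_infinity \<iota> R \<longrightarrow> x \<in> R}"

definition embeddings ::
  "('k::field fls \<Rightarrow> 'c::field) \<Rightarrow> ('k poly fract \<Rightarrow> 'K::field) \<Rightarrow> ('K \<Rightarrow> 'c) set" where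
  "embeddings emb \<iota> =
     {\<alpha>. unital_ring_hom \<alpha> \<and> (\<forall>c. \<alpha> (const_K \<iota> c) = const_C emb c) \<and> \<alpha> (T_K \<iota>) = theta emb}"

text \<open>
  The tensor product of two commutative algebras over \<open>'k\<close> (structure maps \<open>s\<close> and \<open>t\<close>): a finite
  formal sum of pure tensors is a multiset of pairs, and \<open>tensor_eq\<close> is the congruence
  generated by the bilinearity relations.
\<close>

inductive tensor_eq ::
  "('k \<Rightarrow> 'a::comm_ring_1) \<Rightarrow> ('k \<Rightarrow> 'b::comm_ring_1) \<Rightarrow>
     ('a \<times> 'b) multiset \<Rightarrow> ('a \<times> 'b) multiset \<Rightarrow> bool"
  for s :: "'k \<Rightarrow> 'a" and t :: "'k \<Rightarrow> 'b"
where
  refl: "tensor_eq s t M M"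
| sym: "tensor_eq s t M N \<Longrightarrow> tensor_eq s t N M"
| trans: "tensor_eq s t M N \<Longrightarrow> tensor_eq s t N P \<Longrightarrow> tensor_eq s t M P"
| add: "tensor_eq s t M N \<Longrightarrow> tensor_eq s t (M + P) (N + P)"
| zero_left: "tensor_eq s t {#(0, b)#} {#}"
| zero_right: "tensor_eq s t {#(a, 0)#} {#}"
| add_left: "tensor_eq s t {#(a + a', b)#} {#(a, b), (a', b)#}"
| add_right: "tensor_eq s t {#(a, b + b')#} {#(a, b), (a, b')#}"
| scalar: "tensor_eq s t {#(s c * a, b)#} {#(a, t c * b)#}"

definition tensor_mult ::
  "('a::comm_ring_1 \<times> 'b::comm_ring_1) multiset \<Rightarrow> ('a \<times> 'b) multiset \<Rightarrow> ('a \<times> 'b) multiset" where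
  "tensor_mult M N = (\<Sum>(a, b)\<in>#M. {#(a * a', b * b'). (a', b') \<in># N#})"

text \<open>
  The requirement on \<open>\<KK> \<otimes> C\<^sub>\<infinity>\<close> (over \<open>F\<^sub>q\<close>) is that its total ring of fractions, which is
  \<open>\<KK> \<otimes> C\<^sub>\<infinity>(T)\<close> over \<open>F\<^sub>q(T)\<close>, is a field; equivalently the ring itself is an integral domain.
  The ring \<open>\<KK> \<otimes> C\<^sub>\<infinity>\<close> itself is never a field: \<open>T \<otimes> 1 - 1 \<otimes> \<theta>\<close> is nonzero but is
  killed by the unital homomorphisms \<open>x \<otimes> z \<mapsto> \<alpha>(x) z\<close>.
\<close>

definition tensor_domain :: "('k \<Rightarrow> 'a::comm_ring_1) \<Rightarrow> ('k \<Rightarrow> 'b::comm_ring_1) \<Rightarrow> bool" where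
  "tensor_domain s t \<longleftrightarrow>
     \<not> tensor_eq s t {#(1, 1)#} {#} \<and>
     (\<forall>M N. tensor_eq s t (tensor_mult M N) {#} \<longrightarrow> tensor_eq s t M {#} \<or> tensor_eq s t N {#})"


section \<open>Ideal classes and the different\<close>

definition ideal_of :: "'K::field set \<Rightarrow> 'K set \<Rightarrow> bool" where
  "ideal_of A I \<longleftrightarrow>
     I \<subseteq> A \<and> 0 \<in> I \<and> (\<forall>x\<in>I. \<forall>y\<in>I. x + y \<in> I) \<and> (\<forall>a\<in>A. \<forall>x\<in>I. a * x \<in> I)"

definition fractional_ideal :: "'K::field set \<Rightarrow> 'K set \<Rightarrow> bool" where
  "fractional_ideal A I \<longleftrightarrow> I \<noteq> {0} \<and> (\<exists>d\<in>A. d \<noteq> 0 \<and> ideal_of A ((*) d ` I))"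

definition ideal_mult :: "'K::field set \<Rightarrow> 'K set \<Rightarrow> 'K set" where
  "ideal_mult I J =
     {\<Sum>i<n. x i * y i | (n::nat) x y. \<forall>i<n. x i \<in> I \<and> y i \<in> J}"

definition ideal_group :: "'K::field set \<Rightarrow> 'K set monoid" where
  "ideal_group A = \<lparr>carrier = {I. fractional_ideal A I}, monoid.mult = ideal_mult, one = A\<rparr>"

definition principal_ideals :: "'K::field set \<Rightarrow> 'K set set" where
  "principal_ideals A = {(*) x ` A | x. x \<noteq> 0}"

definition class_group :: "'K::field set \<Rightarrow> 'K set set monoid" where
  "class_group A = ideal_group A Mod principal_ideals A"

definition ideal_class :: "'K::field set \<Rightarrow> 'K set \<Rightarrow> 'K set set" where
  "ideal_class A I = principal_ideals A #>\<^bsub>ideal_group A\<^esub> I"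

text \<open>\<open>act\<close> is the action of \<open>A\<close> on the additive group \<open>L\<close>.\<close>

definition module_iso ::
  "'K::field set \<Rightarrow> ('K \<Rightarrow> 'v \<Rightarrow> 'v) \<Rightarrow> 'v::ab_group_add set \<Rightarrow> 'K set \<Rightarrow> ('v \<Rightarrow> 'K) \<Rightarrow> bool" where
  "module_iso A act L I f \<longleftrightarrow>
     bij_betw f L I \<and> (\<forall>x\<in>L. \<forall>y\<in>L. f (x + y) = f x + f y) \<and>
     (\<forall>a\<in>A. \<forall>x\<in>L. f (act a x) = a * f x)"

definition module_class ::
  "'K::field set \<Rightarrow> ('K \<Rightarrow> 'v \<Rightarrow> 'v) \<Rightarrow> 'v::ab_group_add set \<Rightarrow> 'K set set" where
  "module_class A act L =
     (THE C. \<exists>I f. ideal_of A I \<and> I \<noteq> {0} \<and> module_iso A act L I f \<and> C = ideal_class A I)"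

definition trace_K :: "('k::field poly fract \<Rightarrow> 'K::field) \<Rightarrow> 'K \<Rightarrow> 'k poly fract" where
  "trace_K \<iota> x =
     (let B = (SOME B. \<not> module.dependent (scale_K \<iota>) B \<and> module.span (scale_K \<iota>) B = UNIV)
      in \<Sum>b\<in>B. module.representation (scale_K \<iota>) B (x * b) b)"

definition codifferent :: "('k::field poly fract \<Rightarrow> 'K::field) \<Rightarrow> 'K set" where
  "codifferent \<iota> = {x. \<forall>a\<in>ring_A \<iota>. trace_K \<iota> (x * a) \<in> range (\<lambda>p. Fract p 1)}"

definition different :: "('k::field poly fract \<Rightarrow> 'K::field) \<Rightarrow> 'K set" where
  "different \<iota> = {y. \<forall>x\<in>codifferent \<iota>. y * x \<in> ring_A \<iota>}"


section \<open>Lattices, complete multiplication, duality\<close>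

definition poly_scale ::
  "('k::field fls \<Rightarrow> 'c::field) \<Rightarrow> 'k poly \<Rightarrow> 'c ^ 'n \<Rightarrow> 'c ^ 'n" where
  "poly_scale emb p v = eval_theta emb p *s v"

definition fls_scale ::
  "('k::field fls \<Rightarrow> 'c::field) \<Rightarrow> 'k fls \<Rightarrow> 'c ^ 'n \<Rightarrow> 'c ^ 'n" where
  "fls_scale emb f v = emb f *s v"

definition lattice_of_rank ::
  "('k::field fls \<Rightarrow> 'c::field) \<Rightarrow> nat \<Rightarrow> ('c ^ 'n) set \<Rightarrow> bool" where
  "lattice_of_rank emb r L \<longleftrightarrow>
     (\<exists>B. finite B \<and> card B = r \<and> \<not> module.dependent (poly_scale emb) B \<and>
          L = module.span (poly_scale emb) B) \<and>
     vec.span L = UNIV \<and>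
     vector_space.dim (fls_scale emb) (module.span (fls_scale emb) L) = r"

text \<open>
  \<open>M\<close> is the extension of the action \<open>m\<close> from \<open>A\<^sub>\<KK>\<close> to its fraction field, and \<open>g\<close> is the
  isomorphism of \<open>\<KK>\<close>-representations from \<open>V\<close> to the direct sum of the \<open>\<alpha>\<close> in \<open>\<Phi>\<close>, whose
  elements are the families of elements of \<open>C\<^sub>\<infinity>\<close> supported on \<open>\<Phi>\<close>.
\<close>

definition has_CM_type ::
  "'K::field set \<Rightarrow> ('K \<Rightarrow> 'c::field ^ 'n \<Rightarrow> 'c ^ 'n) \<Rightarrow> ('K \<Rightarrow> 'c) set \<Rightarrow> bool" where
  "has_CM_type A m \<Phi> \<longleftrightarrow>
     (\<exists>M. (\<forall>a\<in>A. M a = m a) \<and>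
          (\<forall>x. Vector_Spaces.linear (*s) (*s) (M x)) \<and>
          M 1 = id \<and>
          (\<forall>x y v. M (x + y) v = M x v + M y v) \<and>
          (\<forall>x y. M (x * y) = M x \<circ> M y) \<and>
          (\<exists>g :: 'c ^ 'n \<Rightarrow> ('K \<Rightarrow> 'c) \<Rightarrow> 'c.
             bij_betw g UNIV {f. \<forall>\<alpha>. \<alpha> \<notin> \<Phi> \<longrightarrow> f \<alpha> = 0} \<and>
             (\<forall>v w \<alpha>. g (v + w) \<alpha> = g v \<alpha> + g w \<alpha>) \<and>
             (\<forall>c v \<alpha>. g (c *s v) \<alpha> = c * g v \<alpha>) \<and>
             (\<forall>x v. \<forall>\<alpha>\<in>\<Phi>. g (M x v) \<alpha> = \<alpha> x * g v \<alpha>)))"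

definition complete_multiplication ::
  "('k::field fls \<Rightarrow> 'c::field) \<Rightarrow> ('k poly fract \<Rightarrow> 'K::field) \<Rightarrow> ('c ^ 'n) set \<Rightarrow>
     ('K \<Rightarrow> 'c ^ 'n \<Rightarrow> 'c ^ 'n) \<Rightarrow> ('K \<Rightarrow> 'c) set \<Rightarrow> bool" where
  "complete_multiplication emb \<iota> L m \<Phi> \<longleftrightarrow>
     \<Phi> \<subseteq> embeddings emb \<iota> \<and>
     inj_on m (ring_A \<iota>) \<and>
     (\<forall>a\<in>ring_A \<iota>. Vector_Spaces.linear (*s) (*s) (m a) \<and> m a ` L \<subseteq> L) \<and>
     (\<forall>a\<in>ring_A \<iota>. \<forall>b\<in>ring_A \<iota>. \<forall>v. m (a + b) v = m a v + m b v) \<and>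
     (\<forall>a\<in>ring_A \<iota>. \<forall>b\<in>ring_A \<iota>. m (a * b) = m a \<circ> m b) \<and>
     (\<forall>p v. m (poly_K \<iota> p) v = poly_scale emb p v) \<and>
     has_CM_type (ring_A \<iota>) m \<Phi>"

definition poly_linear_on ::
  "('k::field fls \<Rightarrow> 'c::field) \<Rightarrow> ('c ^ 'n) set \<Rightarrow> ('c ^ 'n \<Rightarrow> 'k poly) \<Rightarrow> bool" where
  "poly_linear_on emb L f \<longleftrightarrow>
     (\<forall>x\<in>L. \<forall>y\<in>L. f (x + y) = f x + f y) \<and>
     (\<forall>p. \<forall>x\<in>L. f (poly_scale emb p x) = p * f x)"

definition perfect_pairing ::
  "('k::field fls \<Rightarrow> 'c::field) \<Rightarrow> ('c ^ 'n) set \<Rightarrow> ('c ^ 'm) set \<Rightarrow>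
     ('c ^ 'n \<Rightarrow> 'c ^ 'm \<Rightarrow> 'k poly) \<Rightarrow> bool" where
  "perfect_pairing emb L L' \<beta> \<longleftrightarrow>
     (\<forall>l'\<in>L'. poly_linear_on emb L (\<lambda>l. \<beta> l l')) \<and>
     (\<forall>l\<in>L. poly_linear_on emb L' (\<lambda>l'. \<beta> l l')) \<and>
     (\<forall>f. poly_linear_on emb L f \<longrightarrow> (\<exists>!l'. l' \<in> L' \<and> (\<forall>l\<in>L. f l = \<beta> l l'))) \<and>
     (\<forall>f. poly_linear_on emb L' f \<longrightarrow> (\<exists>!l. l \<in> L \<and> (\<forall>l'\<in>L'. f l' = \<beta> l l')))"

text \<open>
  The last clause says that the composite \<open>V\<^sup>* \<rightarrow> (L \<otimes> C\<^sub>\<infinity>)\<^sup>* \<cong> L' \<otimes> C\<^sub>\<infinity> \<rightarrow> V'\<close> vanishes. The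
  multiset \<open>M\<close> is a formal sum of pure tensors \<open>l' \<otimes> c\<close>; it represents the image in
  \<open>L' \<otimes> C\<^sub>\<infinity>\<close> of the linear form \<open>\<phi>\<close> iff \<open>\<phi> l = \<Sum> c \<langle>l, l'\<rangle>\<close> for all \<open>l\<close> in \<open>L\<close>, and its
  image in \<open>V'\<close> is \<open>\<Sum> c l'\<close>.
\<close>

definition dual_pair ::
  "('k::field fls \<Rightarrow> 'c::field) \<Rightarrow> nat \<Rightarrow> ('c ^ 'n) set \<Rightarrow> ('c ^ 'm) set \<Rightarrow>
     ('c ^ 'n \<Rightarrow> 'c ^ 'm \<Rightarrow> 'k poly) \<Rightarrow> bool" where
  "dual_pair emb r L L' \<beta> \<longleftrightarrow>
     lattice_of_rank emb r L' \<and>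
     CARD('n) + CARD('m) = r \<and>
     perfect_pairing emb L L' \<beta> \<and>
     (\<forall>\<phi> :: 'c ^ 'n \<Rightarrow> 'c. \<forall>M :: (('c ^ 'm) \<times> 'c) multiset.
        Vector_Spaces.linear (*s) (*) \<phi> \<longrightarrow>
        (\<forall>(l', c)\<in>#M. l' \<in> L') \<longrightarrow>
        (\<forall>l\<in>L. \<phi> l = (\<Sum>(l', c)\<in>#M. c * eval_theta emb (\<beta> l l'))) \<longrightarrow>
        (\<Sum>(l', c)\<in>#M. c *s l') = 0)"

definition dual_action ::
  "('v \<Rightarrow> 'w \<Rightarrow> 'p) \<Rightarrow> 'v set \<Rightarrow> 'w set \<Rightarrow> ('K \<Rightarrow> 'v \<Rightarrow> 'v) \<Rightarrow> 'K \<Rightarrow> 'w \<Rightarrow> 'w" where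
  "dual_action \<beta> L L' m a l' = (THE y. y \<in> L' \<and> (\<forall>l\<in>L. \<beta> (m a l) l' = \<beta> l y))"

end

theory Submission
  imports Defs "HOL-Library.Function_Algebras"
begin

text \<open>
  Fixing a nonzero \<open>l0\<close> in \<open>L\<close>, the map \<open>x \<mapsto> x l0\<close> from \<open>\<KK>\<close> is an isomorphism onto the \<open>F\<^sub>q(T)\<close>-span of \<open>L\<close>,
  both having dimension \<open>r\<close>; so \<open>L\<close> becomes a fractional ideal \<open>J\<close>. The trace form is nondegenerate by
  separability, so the pairing turns \<open>L'\<close> into \<open>J' = {y. Tr (y J) \<subseteq> F\<^sub>q[T]} = {y. y J \<subseteq> D}\<close> with \<open>D\<close> the
  codifferent. Finitely generated nonzero \<open>A\<close>-modules in \<open>\<KK>\<close> are invertible, hence \<open>J' J = D\<close>, and \<open>D\<close> is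
  inverse to the different.

  For the CM type, let \<open>l'\<^sub>b\<close> be the basis of \<open>L'\<close> dual to a basis \<open>b\<close> of \<open>L\<close>, and put
  \<open>w\<^sub>\<alpha> = \<Sum>\<^sub>b \<alpha>(b) l'\<^sub>b\<close> in \<open>V'\<close>, where \<open>b\<close> is read in \<open>\<KK>\<close>. As the trace is the sum of the embeddings,
  \<open>l' = \<Sum>\<^sub>\<alpha> \<alpha>(l') w\<^sub>\<alpha>\<close> for \<open>l'\<close> in \<open>L'\<close>, while \<open>w\<^sub>\<alpha> = 0\<close> for \<open>\<alpha>\<close> in \<open>\<Phi>\<close> by the vanishing condition; counting
  dimensions, the \<open>w\<^sub>\<alpha>\<close> with \<open>\<alpha>\<close> in \<open>\<Phi>'\<close> form a basis of eigenvectors of \<open>V'\<close>.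
\<close>

section \<open>Field homomorphisms\<close>

text \<open>Besides the inclusion of F_q[T], what is needed about A comes from one fact: if g(y) = 0
  with g over F_q[T] and g = (X - y) h, then every h_i and every y h_i lies in A, because this holds
  in each valuation ring. It gives denominators and, once g is divided by its content, an inverse of
  the module (1, y); an induction reaches finitely many generators. Invertibility of D is not proved
  from generators: it is read off J' J = D. The obstacle on the analytic side is that
  \<open>alg_closed\<close> supplies roots only of polynomials whose coefficients are algebraic over
  F_q((1/\<theta>)). Diagonalising the multiplications on F_q(T)-linear forms K -> C therefore has
  to keep all coefficients algebraic while linear factors are split off. The outcome is that the
  embeddings span these forms; with Dedekind independence, this identifies the trace, defined
  through a chosen basis, with the sum of the embeddings. Class group inverses and
  \<open>module_class\<close> are definite descriptions, so each is evaluated by proving existence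
  and uniqueness.\<close>

context
  fixes f :: "'a::ring_1 \<Rightarrow> 'b::ring_1"
  assumes f: "unital_ring_hom f"
begin

lemma unital_ring_hom_one: "f 1 = 1"
  and unital_ring_hom_add: "f (x + y) = f x + f y"
  and unital_ring_hom_mult: "f (x * y) = f x * f y"
  using f by (auto simp: unital_ring_hom_def)

lemma unital_ring_hom_zero: "f 0 = 0"
  using unital_ring_hom_add[of 0 0] by simp

lemma unital_ring_hom_minus: "f (- x) = - f x"
  using unital_ring_hom_add[of x "- x"] unital_ring_hom_zero by (simp add: eq_neg_iff_add_eq_0 add.commute)

lemma unital_ring_hom_diff: "f (x - y) = f x - f y"
  using unital_ring_hom_add[of x "- y"] unital_ring_hom_minus by simp

lemma unital_ring_hom_sum: "f (sum g S) = (\<Sum>s\<in>S. f (g s))"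
  by (induction S rule: infinite_finite_induct) (simp_all add: unital_ring_hom_zero unital_ring_hom_add)

lemma unital_ring_hom_power: "f (x ^ n) = f x ^ n"
  by (induction n) (simp_all add: unital_ring_hom_one unital_ring_hom_mult)

lemmas unital_ring_hom_simps =
  unital_ring_hom_one unital_ring_hom_add unital_ring_hom_mult unital_ring_hom_zero
  unital_ring_hom_minus unital_ring_hom_diff unital_ring_hom_sum unital_ring_hom_power

end

lemma unital_ring_hom_eq_0_iff:
  fixes f :: "'a::field \<Rightarrow> 'b::field"
  assumes "unital_ring_hom f"
  shows "f x = 0 \<longleftrightarrow> x = 0"
  using unital_ring_hom_mult[OF assms, of x "inverse x"] unital_ring_hom_simps[OF assms]
  by (cases "x = 0") auto

lemma unital_ring_hom_eq_iff:
  fixes f :: "'a::field \<Rightarrow> 'b::field"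
  assumes "unital_ring_hom f"
  shows "f x = f y \<longleftrightarrow> x = y"
  using unital_ring_hom_eq_0_iff[OF assms, of "x - y"] by (simp add: unital_ring_hom_simps[OF assms])

lemma unital_ring_hom_inverse:
  fixes f :: "'a::field \<Rightarrow> 'b::field"
  assumes "unital_ring_hom f"
  shows "f (inverse x) = inverse (f x)"
proof (cases "x = 0")
  case False
  have "f x * f (inverse x) = 1"
    using False by (simp flip: unital_ring_hom_mult[OF assms] add: unital_ring_hom_one[OF assms])
  then show ?thesis by (metis inverse_unique)
qed (simp add: unital_ring_hom_zero[OF assms])

lemma unital_ring_hom_divide:
  fixes f :: "'a::field \<Rightarrow> 'b::field"
  assumes "unital_ring_hom f"
  shows "f (x / y) = f x / f y"
  by (simp add: divide_inverse unital_ring_hom_mult[OF assms] unital_ring_hom_inverse[OF assms])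

lemma unital_ring_hom_poly:
  fixes f :: "'a::comm_ring_1 \<Rightarrow> 'b::comm_ring_1"
  assumes "unital_ring_hom f"
  shows "f (poly p x) = poly (map_poly f p) (f x)"
  by (induction p) (simp_all add: unital_ring_hom_simps[OF assms] map_poly_pCons)

lemma unital_ring_hom_map_poly:
  fixes f :: "'a::comm_ring_1 \<Rightarrow> 'b::comm_ring_1"
  assumes "unital_ring_hom f"
  shows "unital_ring_hom (map_poly f)"
  unfolding unital_ring_hom_def
  by (auto simp: poly_eq_iff coeff_map_poly coeff_mult unital_ring_hom_simps[OF assms])

lemma map_poly_pderiv:
  fixes f :: "'a::{comm_ring_1,idom} \<Rightarrow> 'b::{comm_ring_1,idom}"
  assumes "unital_ring_hom f"
  shows "map_poly f (pderiv p) = pderiv (map_poly f p)"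
proof -
  have "f (of_nat n) = of_nat n" for n
    by (induction n) (simp_all add: unital_ring_hom_simps[OF assms])
  then show ?thesis
    by (simp add: poly_eq_iff coeff_map_poly coeff_pderiv unital_ring_hom_simps[OF assms]
        del: of_nat_Suc)
qed

section \<open>Principal ideals and Bezout relations for polynomials over a field\<close>

lemma poly_ideal_principal:
  fixes I :: "'a::field poly set"
  assumes "0 \<in> I" "\<And>x y. x \<in> I \<Longrightarrow> y \<in> I \<Longrightarrow> x + y \<in> I" "\<And>c x. x \<in> I \<Longrightarrow> c * x \<in> I"
  shows "\<exists>d\<in>I. \<forall>x\<in>I. d dvd x"
proof (cases "I \<subseteq> {0}")
  case False
  then obtain d where d: "d \<in> I" "d \<noteq> 0" and min: "\<And>x. x \<in> I \<Longrightarrow> x \<noteq> 0 \<Longrightarrow> degree d \<le> degree x"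
    using exists_least_iff[of "\<lambda>n. \<exists>x\<in>I. x \<noteq> 0 \<and> degree x = n"] by (metis insertCI not_less subsetI)
  have "d dvd x" if "x \<in> I" for x
  proof -
    have "x mod d = x + (- (x div d)) * d"
      by (simp add: minus_div_mult_eq_mod)
    then have "x mod d \<in> I" using assms(2,3) that d by metis
    then have "x mod d = 0"
      using min[of "x mod d"] degree_mod_less[OF d(2), of x] by force
    then show ?thesis by blast
  qed
  then show ?thesis using d by blast
qed (use assms in blast)

lemma poly_coprime_bezout:
  fixes p q :: "'a::field poly"
  assumes "coprime p q"
  obtains u v where "u * p + v * q = 1"
proof -
  obtain d where d: "d \<in> {u * p + v * q | u v. True}" "\<And>x. x \<in> {u * p + v * q | u v. True} \<Longrightarrow> d dvd x"
  proof -
    have "\<exists>d\<in>{u * p + v * q | u v. True}. \<forall>x\<in>{u * p + v * q | u v. True}. d dvd x"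
    proof (rule poly_ideal_principal)
      show "0 \<in> {u * p + v * q | u v. True}" by (auto intro!: exI[of _ 0])
    next
      fix x y assume "x \<in> {u * p + v * q | u v. True}" "y \<in> {u * p + v * q | u v. True}"
      then obtain u v u' v' where "x = u * p + v * q" "y = u' * p + v' * q" by blast
      then have "x + y = (u + u') * p + (v + v') * q" by (simp add: algebra_simps)
      then show "x + y \<in> {u * p + v * q | u v. True}" by blast
    next
      fix c x assume "x \<in> {u * p + v * q | u v. True}"
      then obtain u v where "x = u * p + v * q" by blast
      then have "c * x = (c * u) * p + (c * v) * q" by (simp add: algebra_simps)
      then show "c * x \<in> {u * p + v * q | u v. True}" by blast
    qed
    then show ?thesis using that by blast
  qed
  have "p = 1 * p + 0 * q" "q = 0 * p + 1 * q" by simp_all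
  then have "d dvd p" "d dvd q" using d(2) by blast+
  then have "is_unit d" using assms by (simp add: coprime_def)
  then obtain e where "1 = d * e" by (elim dvdE)
  moreover obtain u v where "d = u * p + v * q" using d(1) by blast
  ultimately have "(e * u) * p + (e * v) * q = 1" by (simp add: algebra_simps)
  then show ?thesis using that by blast
qed

section \<open>The ring \<open>A\<^sub>\<KK>\<close> and invertibility of its finitely generated modules\<close>

text \<open>Comparing coefficients, g_0 = - y h_0 and g_(i+1) = h_i - y h_(i+1). If \<open>y\<close>
  lies in R, the h_i are recovered downwards from the top; otherwise \<open>inverse y\<close> lies
  in R, and the products y h_i are recovered upwards from the constant term.\<close>

lemma valuation_ring_quotient_coeffs:
  fixes y :: "'K::field" and g h :: "'K poly"
  assumes R: "\<And>x y. x \<in> R \<Longrightarrow> y \<in> R \<Longrightarrow> x + y \<in> R" "\<And>x y. x \<in> R \<Longrightarrow> y \<in> R \<Longrightarrow> x - y \<in> R"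
      "\<And>x y. x \<in> R \<Longrightarrow> y \<in> R \<Longrightarrow> x * y \<in> R"
    and y: "y \<in> R \<or> inverse y \<in> R"
    and g: "g = [:- y, 1:] * h" and gR: "\<And>i. coeff g i \<in> R"
  shows "coeff h i \<in> R \<and> y * coeff h i \<in> R"
proof -
  have g0: "coeff g 0 = - (y * coeff h 0)" and gS: "coeff g (Suc i) = coeff h i - y * coeff h (Suc i)" for i
    by (simp_all add: g)
  have zero: "0 \<in> R" using R(2)[OF gR gR] by (metis cancel_comm_monoid_add_class.diff_cancel)
  show ?thesis
  proof (cases "y \<in> R")
    case True
    have "coeff h i \<in> R" for i
    proof (cases "i \<le> degree h")
      case True
      then show ?thesis
      proof (induction rule: inc_induct)
        case base
        have "coeff h (degree h) = coeff g (Suc (degree h))" by (simp add: gS coeff_eq_0)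
        then show ?case using gR by simp
      next
        case (step n)
        have "coeff h n = coeff g (Suc n) + y * coeff h (Suc n)" by (simp add: gS)
        then show ?case using R gR step \<open>y \<in> R\<close> by simp
      qed
    qed (simp add: coeff_eq_0 zero)
    then show ?thesis using True R(3) by blast
  next
    case False
    then have iy: "inverse y \<in> R" and y0: "y \<noteq> 0" using y zero by auto
    have *: "coeff h i \<in> R" if "y * coeff h i \<in> R" for i
      using R(3)[OF iy that] y0 by (simp add: field_simps)
    have "y * coeff h i \<in> R"
    proof (induction i)
      case 0
      have "y * coeff h 0 = 0 - coeff g 0" by (simp add: g0)
      then show ?case using R(2)[OF zero gR] by metis
    next
      case (Suc i)
      have "y * coeff h (Suc i) = coeff h i - coeff g (Suc i)" by (simp add: gS)
      then show ?case using R(2)[OF *[OF Suc] gR] by metis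
    qed
    then show ?thesis using * by blast
  qed
qed

section \<open>Places of K and the ring A\<close>

locale structure_map =
  fixes \<iota> :: "'k::field poly fract \<Rightarrow> 'K::field"
  assumes \<iota>_hom: "unital_ring_hom \<iota>"
begin

abbreviation A where "A \<equiv> ring_A \<iota>"
abbreviation P where "P \<equiv> poly_K \<iota>"

lemma poly_K_hom: "unital_ring_hom P"
proof -
  have "P 1 = 1" by (simp add: poly_K_def unital_ring_hom_one[OF \<iota>_hom] flip: One_fract_def)
  moreover have "P (x + y) = P x + P y" for x y
    by (simp add: poly_K_def flip: unital_ring_hom_add[OF \<iota>_hom])
  moreover have "P (x * y) = P x * P y" for x y
    by (simp add: poly_K_def flip: unital_ring_hom_mult[OF \<iota>_hom])
  ultimately show ?thesis by (simp add: unital_ring_hom_def)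
qed

lemmas poly_K_simps = unital_ring_hom_simps[OF poly_K_hom]

lemma poly_K_eq_0_iff: "P p = 0 \<longleftrightarrow> p = 0"
  by (simp add: poly_K_def unital_ring_hom_eq_0_iff[OF \<iota>_hom] Zero_fract_def eq_fract)

lemma poly_K_pCons: "P (pCons a p) = const_K \<iota> a + T_K \<iota> * P p"
proof -
  have "pCons a p = [:a:] + [:0, 1:] * p" by simp
  then show ?thesis unfolding const_K_def T_K_def by (simp only: poly_K_simps)
qed

lemma \<iota>_Fract: "g \<noteq> 0 \<Longrightarrow> \<iota> (Fract f g) = P f / P g"
  using unital_ring_hom_divide[OF \<iota>_hom, of "Fract f 1" "Fract g 1"] by (simp add: poly_K_def)

context
  fixes R assumes R: "R \<in> places \<iota>"
begin

lemma place_const: "const_K \<iota> c \<in> R"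
  and place_diff: "x \<in> R \<Longrightarrow> y \<in> R \<Longrightarrow> x - y \<in> R"
  and place_mult: "x \<in> R \<Longrightarrow> y \<in> R \<Longrightarrow> x * y \<in> R"
  and place_inverse: "x \<noteq> 0 \<Longrightarrow> x \<in> R \<or> inverse x \<in> R"
  using R unfolding places_def by (simp_all add: image_subset_iff)

lemma place_one: "1 \<in> R"
  using place_const[of 1] unfolding const_K_def one_pCons[symmetric] by (simp only: poly_K_simps)

lemma place_zero: "0 \<in> R"
  using place_diff[OF place_one place_one] by simp

lemma place_add: "x \<in> R \<Longrightarrow> y \<in> R \<Longrightarrow> x + y \<in> R"
  using place_diff[OF _ place_diff[OF place_zero], of x y] by simp

lemma place_power: "x \<in> R \<Longrightarrow> x ^ n \<in> R"
  by (induction n) (auto intro: place_one place_mult)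

text \<open>A valuation ring is local. If x/y lies in R then x + y = y (1 + x/y), so the inverse of
  y is the inverse of x + y times an element of R; the case of y/x is symmetric.\<close>

lemma place_unit_of_sum:
  assumes "x \<in> R" "y \<in> R" "x + y \<noteq> 0" "inverse (x + y) \<in> R"
  shows "(x \<noteq> 0 \<and> inverse x \<in> R) \<or> (y \<noteq> 0 \<and> inverse y \<in> R)"
proof (cases "x = 0 \<or> y = 0")
  case False
  then have nz: "x \<noteq> 0" "y \<noteq> 0" by auto
  then consider "x / y \<in> R" | "y / x \<in> R"
    using place_inverse[of "x / y"] by auto
  then show ?thesis
  proof cases
    case 1
    have "inverse (x + y) * (1 + x / y) = inverse y" using nz assms(3) by (simp add: field_simps)
    then show ?thesis using place_mult[OF assms(4) place_add[OF place_one 1]] nz by simp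
  next
    case 2
    have "inverse (x + y) * (1 + y / x) = inverse x" using nz assms(3) by (simp add: field_simps)
    then show ?thesis using place_mult[OF assms(4) place_add[OF place_one 2]] nz by simp
  qed
qed (use assms in auto)

text \<open>This is what puts F_q[T] into A. With S = 1/T in R, a polynomial of degree d is T^d
  times a polynomial in S whose constant term is the leading coefficient. That polynomial in S is a
  unit because S is a non-unit, so membership in R depends on degrees alone.\<close>

lemma over_infinity_if_T_notin:
  assumes T: "T_K \<iota> \<notin> R"
  shows "over_infinity \<iota> R"
proof -
  define S where "S = inverse (T_K \<iota>)"
  have T0: "T_K \<iota> \<noteq> 0" unfolding T_K_def by (simp add: poly_K_eq_0_iff)
  have S: "S \<in> R" "T_K \<iota> * S = 1" "S \<noteq> 0" using place_inverse[OF T0] T T0 by (auto simp: S_def)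
  \<comment> \<open>The slack in \<open>degree p \<le> d\<close> is used below, where numerator and
    denominator are multiplied by the same power of S.\<close>
  have mem: "P p * S ^ d \<in> R" if "degree p \<le> d" for p d
    using that
  proof (induction p arbitrary: d)
    case 0
    then show ?case by (simp add: poly_K_simps place_zero)
  next
    case (pCons a p)
    show ?case
    proof (cases "p = 0")
      case True
      then show ?thesis by (simp add: poly_K_pCons poly_K_simps place_mult place_const place_power S(1))
    next
      case False
      with pCons.prems obtain e where e: "d = Suc e" "degree p \<le> e" by (cases d) auto
      have "P (pCons a p) * S ^ d = const_K \<iota> a * S ^ d + (T_K \<iota> * S) * (P p * S ^ e)"
        unfolding poly_K_pCons e by (simp add: algebra_simps)
      then show ?thesis using pCons.IH[OF e(2)] S by (simp add: place_add place_mult place_const place_power)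
    qed
  qed
  have unit: "inverse (P p * S ^ degree p) \<in> R" if p: "p \<noteq> 0" for p
  proof (rule ccontr)
    assume nu: "inverse (P p * S ^ degree p) \<notin> R"
    define c where "c = lead_coeff p"
    define d where "d = degree p"
    have cinv: "inverse (const_K \<iota> c) \<in> R" "const_K \<iota> c \<noteq> 0"
    proof -
      have c: "c \<noteq> 0" using p by (simp add: c_def)
      have "const_K \<iota> c * const_K \<iota> (inverse c) = P ([:c:] * [:inverse c:])"
        unfolding const_K_def by (simp only: poly_K_simps)
      also have "[:c:] * [:inverse c:] = 1" using c by (simp add: one_pCons)
      finally have "const_K \<iota> c * const_K \<iota> (inverse c) = 1" by (simp add: poly_K_simps)
      then show "inverse (const_K \<iota> c) \<in> R" "const_K \<iota> c \<noteq> 0"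
        using place_const by (metis inverse_unique, auto)
    qed
    show False
    proof (cases "d = 0")
      case True
      then have "p = [:c:]" unfolding c_def d_def by (auto elim: degree_eq_zeroE)
      then show False using nu cinv(1) by (simp add: const_K_def)
    next
      case False
      then obtain e where e: "d = Suc e" by (cases d) auto
      \<comment> \<open>Without its leading term the polynomial has degree at most d - 1, so after
        multiplication by S^d a spare factor S remains.\<close>
      define q where "q = p - monom c d"
      have "degree q \<le> e"
      proof (rule degree_le, intro allI impI)
        fix i assume "e < i"
        then consider "i = d" | "i > d" using e by linarith
        then show "coeff q i = 0"
          by cases (simp_all add: q_def c_def d_def coeff_eq_0)
      qed
      then have w: "P q * S ^ e \<in> R" by (rule mem)
      have "monom c d = [:c:] * [:0, 1:] ^ d" by (simp add: monom_altdef)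
      then have "P (monom c d) = const_K \<iota> c * T_K \<iota> ^ d"
        unfolding const_K_def T_K_def by (simp only: poly_K_simps)
      moreover have "T_K \<iota> ^ d * S ^ d = 1" using S(2) by (simp flip: power_mult_distrib)
      ultimately have "P (monom c d) * S ^ d = const_K \<iota> c" by (simp add: mult.assoc)
      moreover have "P p = P q + P (monom c d)" by (simp add: q_def poly_K_simps)
      ultimately have "P p * S ^ d = P q * S ^ d + const_K \<iota> c" by (simp add: ring_distribs)
      then have eq: "const_K \<iota> c = P p * S ^ d + - (S * (P q * S ^ e))" by (simp add: e)
      have "(P p * S ^ d \<noteq> 0 \<and> inverse (P p * S ^ d) \<in> R) \<or>
            (- (S * (P q * S ^ e)) \<noteq> 0 \<and> inverse (- (S * (P q * S ^ e))) \<in> R)"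
      proof (rule place_unit_of_sum)
        show "- (S * (P q * S ^ e)) \<in> R"
          using place_diff[OF place_zero place_mult[OF S(1) w]] by simp
      qed (use eq cinv mem[of p d] in \<open>simp_all add: d_def\<close>)
      then have *: "S * (P q * S ^ e) \<noteq> 0" "inverse (- (S * (P q * S ^ e))) \<in> R" using nu by (auto simp: d_def)
      \<comment> \<open>Locality has forced the remainder term to be a unit, and a unit divisible by
        S would make T = 1/S a member of R.\<close>
      have "T_K \<iota> = - (P q * S ^ e) * inverse (- (S * (P q * S ^ e)))"
        using * S by (simp add: S_def field_simps)
      moreover have "- (P q * S ^ e) \<in> R" using place_diff[OF place_zero w] by simp
      ultimately show False using place_mult[OF _ *(2)] T by metis
    qed
  qed
  have "\<iota> (Fract f g) \<in> R \<longleftrightarrow> degree f \<le> degree g" if g: "g \<noteq> 0" for f g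
  proof
    assume le: "degree f \<le> degree g"
    have "\<iota> (Fract f g) = (P f * S ^ degree g) * inverse (P g * S ^ degree g)"
      using S(3) by (simp add: \<iota>_Fract[OF g] field_simps)
    then show "\<iota> (Fract f g) \<in> R" using place_mult[OF mem[OF le] unit[OF g]] by simp
  next
    assume fg: "\<iota> (Fract f g) \<in> R"
    show "degree f \<le> degree g"
    proof (rule ccontr)
      assume lt: "\<not> degree f \<le> degree g"
      then obtain e where e: "degree f = Suc e" "degree g \<le> e" by (cases "degree f") auto
      then have f: "f \<noteq> 0" by auto
      \<comment> \<open>If deg f exceeds deg g, then T is the product of f/g, the inverse of the
        unit f S^(deg f), and g S^(deg f - 1), all of them in R.\<close>
      have "T_K \<iota> = \<iota> (Fract f g) * (inverse (P f * S ^ degree f) * (P g * S ^ e))"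
        using S(3) f g poly_K_eq_0_iff[of f] poly_K_eq_0_iff[of g]
        by (simp add: \<iota>_Fract[OF g] e S_def field_simps)
      then show False using place_mult[OF fg place_mult[OF unit[OF f] mem[OF e(2)]]] T by simp
    qed
  qed
  then have "\<iota> z \<in> R \<longleftrightarrow> (\<exists>f g. z = Fract f g \<and> g \<noteq> 0 \<and> degree f \<le> degree g)" for z
    by (metis Fract_cases)
  then show ?thesis unfolding over_infinity_def by auto
qed

end

lemma A_iff: "x \<in> A \<longleftrightarrow> (\<forall>R. R \<in> places \<iota> \<longrightarrow> \<not> over_infinity \<iota> R \<longrightarrow> x \<in> R)"
  by (auto simp: ring_A_def)

lemma A_zero: "0 \<in> A" and A_one: "1 \<in> A" and A_add: "x \<in> A \<Longrightarrow> y \<in> A \<Longrightarrow> x + y \<in> A"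
  and A_diff: "x \<in> A \<Longrightarrow> y \<in> A \<Longrightarrow> x - y \<in> A" and A_mult: "x \<in> A \<Longrightarrow> y \<in> A \<Longrightarrow> x * y \<in> A"
  by (simp_all add: A_iff place_zero place_one place_add place_diff place_mult)

lemma A_minus: "x \<in> A \<Longrightarrow> - x \<in> A"
  using A_diff[OF A_zero] by simp

lemma A_sum: "(\<And>s. s \<in> S \<Longrightarrow> g s \<in> A) \<Longrightarrow> sum g S \<in> A"
  by (induction S rule: infinite_finite_induct) (auto intro: A_zero A_add)

lemma A_poly_K: "P p \<in> A"
proof (induction p)
  case 0
  then show ?case by (simp add: poly_K_simps A_zero)
next
  case (pCons a p)
  have "T_K \<iota> \<in> A" "const_K \<iota> a \<in> A"
    using over_infinity_if_T_notin place_const by (auto simp: A_iff)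
  then show ?case using pCons.IH by (simp add: poly_K_pCons A_add A_mult)
qed

text \<open>Checked at one place at a time. The quotient coefficients multiply both 1 and y into A;
  denominators and inverses of modules are both built from them.\<close>

lemma A_quotient_coeffs:
  assumes g: "map_poly P g = [:- y, 1:] * h"
  shows "coeff h i \<in> A \<and> y * coeff h i \<in> A"
proof -
  have "coeff h i \<in> R \<and> y * coeff h i \<in> R" if R: "R \<in> places \<iota>" "\<not> over_infinity \<iota> R" for R
  proof (rule valuation_ring_quotient_coeffs[OF _ _ _ _ g])
    show "y \<in> R \<or> inverse y \<in> R" using place_inverse[OF R(1)] place_zero[OF R(1)] by (cases "y = 0") auto
    show "coeff (map_poly P g) i \<in> R" for i
      using A_poly_K R by (auto simp: coeff_map_poly poly_K_simps A_iff)
  qed (use place_add place_diff place_mult R in auto)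
  then show ?thesis by (auto simp: A_iff)
qed

end

section \<open>Denominators, and inverses of modules with finitely many generators\<close>

lemma fract_poly_clear_denominators:
  fixes p :: "'a::idom fract poly"
  shows "\<exists>d g. d \<noteq> 0 \<and> smult (Fract d 1) p = map_poly (\<lambda>a. Fract a 1) g"
proof (induction p)
  case 0
  then show ?case by (intro exI[of _ 1] exI[of _ 0]) (simp add: map_poly_0)
next
  case (pCons a p)
  then obtain d g where d: "d \<noteq> 0" "smult (Fract d 1) p = map_poly (\<lambda>a. Fract a 1) g" by blast
  obtain u v where a: "a = Fract u v" "v \<noteq> 0" by (cases a) auto
  have "smult (Fract (d * v) 1) (pCons a p) = map_poly (\<lambda>a. Fract a 1) (pCons (d * u) (smult v g))"
  proof -
    have "Fract (d * v) 1 * a = Fract (d * u) 1" using a by (simp add: eq_fract)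
    moreover have "smult (Fract (d * v) 1) p = smult (Fract v 1) (smult (Fract d 1) p)"
      by (simp add: mult.commute)
    moreover have "map_poly (\<lambda>a. Fract a 1) (smult v g) = smult (Fract v 1) (map_poly (\<lambda>a. Fract a 1) g)"
      by (simp add: poly_eq_iff coeff_map_poly Zero_fract_def)
    ultimately show ?thesis using d(2) by (simp add: map_poly_pCons Zero_fract_def)
  qed
  then show ?case using d a by (metis mult_eq_0_iff)
qed

locale separable_extension = structure_map \<iota>
  for \<iota> :: "'k::field poly fract \<Rightarrow> 'K::field" +
  assumes fin_sep: "finite_separable \<iota>"
begin

lemma separable_annihilator:
  obtains p where "p \<noteq> 0" "poly (map_poly \<iota> p) x = 0" "coprime p (pderiv p)"
  using fin_sep unfolding finite_separable_def by (metis irreducible_def)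

lemma integral_annihilator:
  obtains g where "g \<noteq> 0" "poly (map_poly P g) x = 0"
proof -
  obtain p where p: "p \<noteq> 0" "poly (map_poly \<iota> p) x = 0" using separable_annihilator by metis
  obtain d g where d: "d \<noteq> 0" "smult (Fract d 1) p = map_poly (\<lambda>a. Fract a 1) g"
    using fract_poly_clear_denominators by blast
  have "map_poly P g = map_poly \<iota> (smult (Fract d 1) p)"
    unfolding d(2) by (simp add: poly_eq_iff coeff_map_poly poly_K_def Zero_fract_def[symmetric]
        unital_ring_hom_zero[OF \<iota>_hom])
  also have "\<dots> = smult (P d) (map_poly \<iota> p)"
    by (simp add: poly_eq_iff coeff_map_poly poly_K_def unital_ring_hom_simps[OF \<iota>_hom])
  finally have "poly (map_poly P g) x = 0" using p by simp
  moreover have "g \<noteq> 0"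
    using d p by (auto simp: Zero_fract_def eq_fract map_poly_0)
  ultimately show ?thesis using that by blast
qed

text \<open>Division of g by X - x keeps the leading coefficient, so the leading coefficient of an
  equation of x over F_q[T] serves as denominator.\<close>

lemma denominator:
  obtains d where "d \<noteq> 0" "P d * x \<in> A"
proof -
  obtain g where g: "g \<noteq> 0" "poly (map_poly P g) x = 0" using integral_annihilator by blast
  then obtain h where h: "map_poly P g = [:- x, 1:] * h" by (metis poly_eq_0_iff_dvd dvdE)
  have deg: "degree (map_poly P g) = degree g"
    by (rule degree_map_poly) (simp add: poly_K_eq_0_iff)
  have "P (lead_coeff g) = lead_coeff h"
  proof -
    have "lead_coeff (map_poly P g) = lead_coeff h" unfolding h lead_coeff_mult by simp
    then show ?thesis by (simp add: deg coeff_map_poly poly_K_simps)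
  qed
  then have "P (lead_coeff g) * x \<in> A" using A_quotient_coeffs[OF h, of "degree h"] by (simp add: mult.commute)
  then show ?thesis using that g(1) by (metis leading_coeff_0_iff)
qed

text \<open>Dividing by a generator of the ideal of coefficients leaves a polynomial whose
  coefficients satisfy a Bezout relation; \<open>pair_invertible\<close> feeds that relation into
  the quotient coefficients.\<close>

lemma primitive_annihilator:
  obtains g c where "poly (map_poly P g) x = 0" "(\<Sum>i\<le>degree g. c i * coeff g i) = 1"
proof -
  obtain g where g: "g \<noteq> 0" "poly (map_poly P g) x = 0" using integral_annihilator by blast
  define I where "I = {\<Sum>i\<le>degree g. c i * coeff g i | c. True}"
  have "\<exists>d\<in>I. \<forall>y\<in>I. d dvd y"
  proof (rule poly_ideal_principal)
    show "0 \<in> I" unfolding I_def by (auto intro!: exI[of _ "\<lambda>_. 0"])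
  next
    fix y z assume "y \<in> I" "z \<in> I"
    then obtain c e where "y = (\<Sum>i\<le>degree g. c i * coeff g i)" "z = (\<Sum>i\<le>degree g. e i * coeff g i)"
      unfolding I_def by blast
    then have "y + z = (\<Sum>i\<le>degree g. (c i + e i) * coeff g i)" by (simp add: sum.distrib ring_distribs)
    then show "y + z \<in> I" unfolding I_def by (intro CollectI exI[of _ "\<lambda>i. c i + e i"]) simp
  next
    fix a y assume "y \<in> I"
    then obtain c where "y = (\<Sum>i\<le>degree g. c i * coeff g i)" unfolding I_def by blast
    then have "a * y = (\<Sum>i\<le>degree g. (a * c i) * coeff g i)" by (simp add: sum_distrib_left mult.assoc)
    then show "a * y \<in> I" unfolding I_def by (intro CollectI exI[of _ "\<lambda>i. a * c i"]) simp
  qed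
  then obtain d where d: "d \<in> I" "\<And>y. y \<in> I \<Longrightarrow> d dvd y" by blast
  have "d dvd coeff g i" for i
  proof (cases "i \<le> degree g")
    case True
    have "coeff g i = (\<Sum>k\<le>degree g. (if k = i then 1 else 0) * coeff g k)"
      using True by (simp add: if_distrib[of "\<lambda>a. a * _"] sum.delta' cong: if_cong)
    then have "coeff g i \<in> I" unfolding I_def by (intro CollectI exI[of _ "\<lambda>k. if k = i then 1 else 0"]) simp
    then show ?thesis by (rule d(2))
  qed (simp add: coeff_eq_0)
  moreover define g' where "g' = map_poly (\<lambda>a. a div d) g"
  ultimately have dvd: "coeff g i = d * coeff g' i" for i by (simp add: coeff_map_poly)
  then have gg': "g = smult d g'" by (simp add: poly_eq_iff)
  have d0: "d \<noteq> 0" using g(1) gg' by auto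
  have "map_poly P g = smult (P d) (map_poly P g')"
    unfolding gg' by (simp add: poly_eq_iff coeff_map_poly poly_K_simps)
  then have "poly (map_poly P g') x = 0" using g(2) d0 by (simp add: poly_K_eq_0_iff)
  moreover obtain c where "d = (\<Sum>i\<le>degree g. c i * coeff g i)" using d(1) unfolding I_def by blast
  then have "d * 1 = d * (\<Sum>i\<le>degree g. c i * coeff g' i)"
    unfolding dvd by (simp add: sum_distrib_left mult.left_commute)
  then have "(\<Sum>i\<le>degree g'. c i * coeff g' i) = 1" using d0 gg' by simp
  ultimately show ?thesis using that by blast
qed

text \<open>
  If \<open>g = (X - y) h\<close> then every coefficient of \<open>g\<close> is a combination of \<open>1\<close> and \<open>y\<close>, with coefficients
  among those of \<open>h\<close>, which conduct both \<open>1\<close> and \<open>y\<close> into \<open>A\<close>.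
\<close>

lemma pair_invertible:
  assumes a: "a \<noteq> 0"
  shows "\<exists>x z. a * x + c * z = 1 \<and> a * x \<in> A \<and> c * x \<in> A \<and> a * z \<in> A \<and> c * z \<in> A"
proof -
  define y where "y = c / a"
  obtain g e where g: "poly (map_poly P g) y = 0" and e: "(\<Sum>i\<le>degree g. e i * coeff g i) = 1"
    using primitive_annihilator by blast
  obtain h where h: "map_poly P g = [:- y, 1:] * h" using g by (metis poly_eq_0_iff_dvd dvdE)
  note hA = A_quotient_coeffs[OF h]
  \<comment> \<open>Since g_i = h_(i-1) - y h_i with h_(-1) = 0, the shift being encoded by
    \<open>pCons 0 h\<close>, the relation 1 = sum of e_i g_i becomes 1 = u + y v. The witnesses
    sought are u / a and v / a.\<close>
  define u where "u = (\<Sum>i\<le>degree g. P (e i) * coeff (pCons 0 h) i)"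
  define v where "v = - (\<Sum>i\<le>degree g. P (e i) * coeff h i)"
  have hA': "coeff (pCons 0 h) i \<in> A \<and> y * coeff (pCons 0 h) i \<in> A" for i
    using hA A_zero by (cases i) auto
  have uA: "u \<in> A" "v \<in> A" unfolding u_def v_def
    using hA hA' by (auto intro!: A_minus A_sum A_mult[OF A_poly_K])
  have yuA: "y * u \<in> A" "y * v \<in> A" unfolding u_def v_def mult_minus_right sum_distrib_left
    mult.left_commute[of y]
    using hA hA' by (auto intro!: A_minus A_sum A_mult[OF A_poly_K])
  have "P (coeff g i) = coeff (pCons 0 h) i - y * coeff h i" for i
  proof -
    have "P (coeff g i) = coeff (map_poly P g) i" by (simp add: coeff_map_poly poly_K_simps)
    then show ?thesis unfolding h by simp
  qed
  then have "P (\<Sum>i\<le>degree g. e i * coeff g i) = u + y * v"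
    unfolding u_def v_def poly_K_simps
    by (simp add: right_diff_distrib sum_subtractf sum_distrib_left mult.left_commute)
  then have "u + y * v = 1" by (simp add: e poly_K_simps)
  moreover have "a * (u / a) = u" "c * (u / a) = y * u" "a * (v / a) = v" "c * (v / a) = y * v"
    using a by (simp_all add: y_def)
  ultimately show ?thesis using uA yuA by metis
qed

text \<open>The passage from two generators to finitely many known from Pruefer domains: the inverse
  found for \<open>S\<close> is combined with the inverses of the pairs (s, c) when \<open>c\<close>
  is added.\<close>

lemma finite_set_invertible:
  assumes "finite S" "\<exists>s\<in>S. s \<noteq> 0"
  shows "\<exists>b. (\<Sum>s\<in>S. s * b s) = 1 \<and> (\<forall>s\<in>S. \<forall>t\<in>S. t * b s \<in> A)"
  using assms
proof (induction S)
  case (insert c S)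
  show ?case
  proof (cases "\<exists>s\<in>S. s \<noteq> 0")
    case False
    then have c: "c \<noteq> 0" using insert.prems by blast
    define b where "b = (\<lambda>s. if s = c then 1 / c else 0)"
    have "(\<Sum>s\<in>insert c S. s * b s) = 1"
      using insert.hyps c by (auto simp: b_def intro!: sum.neutral)
    moreover have "t * b s \<in> A" if "s \<in> insert c S" "t \<in> insert c S" for s t
      using that False c A_zero A_one by (auto simp: b_def)
    ultimately show ?thesis by blast
  next
    case True
    then obtain b where b: "(\<Sum>s\<in>S. s * b s) = 1" "\<And>s t. s \<in> S \<Longrightarrow> t \<in> S \<Longrightarrow> t * b s \<in> A"
      using insert.IH by blast
    \<comment> \<open>For a = 0 the pair may fail to be invertible; zero values serve instead, since
      the identity 1 = a x + c z is only used with the weight \<open>a * b a\<close>.\<close>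
    have "\<exists>x z. (a = 0 \<or> a * x + c * z = 1) \<and> a * x \<in> A \<and> c * x \<in> A \<and> a * z \<in> A \<and> c * z \<in> A" for a
    proof (cases "a = 0")
      case True
      then show ?thesis by (intro exI[of _ 0]) (simp add: A_zero)
    qed (use pair_invertible in blast)
    then obtain x z where xz: "\<And>a. a = 0 \<or> a * x a + c * z a = 1"
        "\<And>a. a * x a \<in> A" "\<And>a. c * x a \<in> A" "\<And>a. a * z a \<in> A" "\<And>a. c * z a \<in> A"
      by metis
    \<comment> \<open>Obtained by inserting 1 = s x_s + c z_s into each term of 1 = sum of s b_s;
      the terms carrying c are collected in the coefficient of c.\<close>
    define b' where "b' = (\<lambda>s. if s = c then \<Sum>a\<in>S. a * b a * z a else s * b s * x s)"
    have b'S: "b' s = s * b s * x s" if "s \<in> S" for s using that insert.hyps by (auto simp: b'_def)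
    have b'c: "b' c = (\<Sum>a\<in>S. a * b a * z a)" by (simp add: b'_def)
    have "(\<Sum>s\<in>insert c S. s * b' s) = (\<Sum>s\<in>S. s * (s * b s * x s)) + c * (\<Sum>a\<in>S. a * b a * z a)"
      using insert.hyps b'S b'c by simp
    also have "\<dots> = (\<Sum>s\<in>S. s * b s * (s * x s + c * z s))"
      by (simp add: sum_distrib_left sum.distrib algebra_simps)
    also have "\<dots> = (\<Sum>s\<in>S. s * b s)"
      by (rule sum.cong[OF HOL.refl]) (use xz(1) in force)
    finally have "(\<Sum>s\<in>insert c S. s * b' s) = 1" using b(1) by simp
    moreover have "t * b' s \<in> A" if s: "s \<in> insert c S" and t: "t \<in> insert c S" for s t
    proof -
      have 1: "t * b' s \<in> A" if "s \<in> S" "t \<in> S" for s t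
      proof -
        have "t * b' s = (t * b s) * (s * x s)" using b'S[OF that(1)] by (simp add: algebra_simps)
        then show ?thesis using A_mult[OF b(2)[OF that] xz(2)] by (simp only:)
      qed
      have 2: "c * b' s \<in> A" if "s \<in> S" for s
      proof -
        have "c * b' s = (s * b s) * (c * x s)" using b'S[OF that] by (simp add: algebra_simps)
        then show ?thesis using A_mult[OF b(2)[OF that that] xz(3)] by (simp only:)
      qed
      have 3: "t * b' c \<in> A" if "t \<in> S" for t
      proof -
        have "t * b' c = (\<Sum>a\<in>S. (t * b a) * (a * z a))" unfolding b'c by (simp add: sum_distrib_left algebra_simps)
        then show ?thesis using A_sum[of S, OF A_mult[OF b(2)[OF _ that] xz(4)]] by (simp only:)
      qed
      have 4: "c * b' c \<in> A"
      proof -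
        have "c * b' c = (\<Sum>a\<in>S. (a * b a) * (c * z a))" unfolding b'c by (simp add: sum_distrib_left algebra_simps)
        then show ?thesis using A_sum[of S, OF A_mult[OF b(2) xz(5)]] by (simp only:)
      qed
      show ?thesis using s t 1 2 3 4 by blast
    qed
    ultimately show ?thesis by blast
  qed
qed simp

end

section \<open>Ideal classes\<close>

lemma ideal_mult_zero: "0 \<in> ideal_mult I J"
  unfolding ideal_mult_def by (auto intro!: exI[of _ "0::nat"])

lemma ideal_mult_add_product:
  assumes "z \<in> ideal_mult I J" "x \<in> I" "y \<in> J"
  shows "z + x * y \<in> ideal_mult I J"
proof -
  obtain n :: nat and a b where z: "z = (\<Sum>i<n. a i * b i)" "\<forall>i<n. a i \<in> I \<and> b i \<in> J"
    using assms(1) unfolding ideal_mult_def by blast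
  have "z + x * y = (\<Sum>i<Suc n. (a(n := x)) i * (b(n := y)) i)" by (simp add: z)
  moreover have "\<forall>i<Suc n. (a(n := x)) i \<in> I \<and> (b(n := y)) i \<in> J" using z assms by auto
  ultimately show ?thesis unfolding ideal_mult_def by blast
qed

lemma ideal_mult_product: "x \<in> I \<Longrightarrow> y \<in> J \<Longrightarrow> x * y \<in> ideal_mult I J"
  using ideal_mult_add_product[OF ideal_mult_zero] by fastforce

lemma ideal_mult_induct [consumes 1, case_names zero add]:
  assumes "z \<in> ideal_mult I J" "Q 0" "\<And>z x y. Q z \<Longrightarrow> x \<in> I \<Longrightarrow> y \<in> J \<Longrightarrow> Q (z + x * y)"
  shows "Q z"
proof -
  obtain n :: nat and a b where z: "z = (\<Sum>i<n. a i * b i)" "\<forall>i<n. a i \<in> I \<and> b i \<in> J"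
    using assms(1) unfolding ideal_mult_def by blast
  have "Q (\<Sum>i<k. a i * b i)" if "k \<le> n" for k
    using that z(2) by (induction k) (auto intro: assms(2,3))
  then show ?thesis using z by blast
qed

lemma ideal_mult_add:
  assumes "w \<in> ideal_mult I J" "z \<in> ideal_mult I J"
  shows "w + z \<in> ideal_mult I J"
  using assms(2)
proof (induction rule: ideal_mult_induct)
  case (add z x y)
  then show ?case using ideal_mult_add_product[of "w + z"] by (simp add: add.assoc)
qed (simp add: assms)

lemma ideal_mult_sum:
  "(\<And>s. s \<in> S \<Longrightarrow> g s \<in> ideal_mult I J) \<Longrightarrow> sum g S \<in> ideal_mult I J"
  by (induction S rule: infinite_finite_induct) (auto intro: ideal_mult_zero ideal_mult_add)

lemma ideal_mult_subset:
  assumes "0 \<in> Q" "\<And>w z. w \<in> Q \<Longrightarrow> z \<in> Q \<Longrightarrow> w + z \<in> Q" "\<And>x y. x \<in> I \<Longrightarrow> y \<in> J \<Longrightarrow> x * y \<in> Q"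
  shows "ideal_mult I J \<subseteq> Q"
proof
  fix z assume "z \<in> ideal_mult I J"
  then show "z \<in> Q" by (induction rule: ideal_mult_induct) (auto intro: assms)
qed

lemma ideal_mult_commute: "ideal_mult I J = ideal_mult J I"
proof -
  have "ideal_mult I J \<subseteq> ideal_mult J I" for I J :: "'a set"
    by (intro ideal_mult_subset ideal_mult_zero ideal_mult_add) (metis ideal_mult_product mult.commute)+
  then show ?thesis by blast
qed

lemma ideal_mult_mult_left:
  assumes "\<And>x. x \<in> I \<Longrightarrow> a * x \<in> I'" "z \<in> ideal_mult I J"
  shows "a * z \<in> ideal_mult I' J"
  using assms(2)
proof (induction rule: ideal_mult_induct)
  case (add z x y)
  then show ?case using ideal_mult_add_product[of "a * z" I' J "a * x" y] assms(1)
    by (simp add: algebra_simps)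
qed (simp add: ideal_mult_zero)

lemma ideal_mult_assoc: "ideal_mult (ideal_mult I J) K = ideal_mult I (ideal_mult J K)"
proof -
  have 1: "ideal_mult (ideal_mult I J) K \<subseteq> ideal_mult I (ideal_mult J K)" for I J K :: "'a set"
  proof (intro ideal_mult_subset ideal_mult_zero ideal_mult_add)
    fix x z assume "x \<in> ideal_mult I J" and z: "z \<in> K"
    then show "x * z \<in> ideal_mult I (ideal_mult J K)"
    proof (induction rule: ideal_mult_induct)
      case (add w x y)
      then show ?case
        using ideal_mult_add_product[of "w * z" I "ideal_mult J K" x "y * z"] ideal_mult_product[of y J z K]
        by (simp add: algebra_simps)
    qed (simp add: ideal_mult_zero)
  qed
  have "ideal_mult I (ideal_mult J K) = ideal_mult (ideal_mult K J) I"
    by (simp add: ideal_mult_commute)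
  also have "\<dots> \<subseteq> ideal_mult K (ideal_mult J I)" by (rule 1)
  also have "\<dots> = ideal_mult (ideal_mult I J) K" by (simp add: ideal_mult_commute)
  finally show ?thesis using 1[of I J K] by blast
qed

lemma ideal_mult_scale: "ideal_mult ((*) x ` I) J = (*) x ` ideal_mult I J"
proof
  show "ideal_mult ((*) x ` I) J \<subseteq> (*) x ` ideal_mult I J"
  proof (intro ideal_mult_subset)
    show "0 \<in> (*) x ` ideal_mult I J" using ideal_mult_zero by (metis imageI mult_zero_right)
  next
    fix w z assume "w \<in> (*) x ` ideal_mult I J" "z \<in> (*) x ` ideal_mult I J"
    then show "w + z \<in> (*) x ` ideal_mult I J"
      by (auto simp flip: distrib_left intro: ideal_mult_add)
  qed (auto simp: mult.assoc intro: ideal_mult_product)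
  show "(*) x ` ideal_mult I J \<subseteq> ideal_mult ((*) x ` I) J"
    using ideal_mult_mult_left[of I x "(*) x ` I"] by blast
qed

text \<open>Neither finite generation nor a common denominator is demanded, so that products, colon
  modules and the codifferent are all covered; \<open>fractional_ideal\<close> is recovered from
  invertibility.\<close>

definition submodule_of :: "'K::field set \<Rightarrow> 'K set \<Rightarrow> bool" where
  "submodule_of A I \<longleftrightarrow> 0 \<in> I \<and> (\<forall>x\<in>I. \<forall>y\<in>I. x + y \<in> I) \<and> (\<forall>a\<in>A. \<forall>x\<in>I. a * x \<in> I)"

text \<open>The colon module (A : I). The different is this module formed for the
  codifferent.\<close>

definition ideal_inverse :: "'K::field set \<Rightarrow> 'K set \<Rightarrow> 'K set" where
  "ideal_inverse A I = {y. \<forall>x\<in>I. y * x \<in> A}"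

locale fraction_subring =
  fixes A :: "'K::field set"
  assumes zero_closed: "0 \<in> A" and one_closed: "1 \<in> A"
    and add_closed: "x \<in> A \<Longrightarrow> y \<in> A \<Longrightarrow> x + y \<in> A"
    and mult_closed: "x \<in> A \<Longrightarrow> y \<in> A \<Longrightarrow> x * y \<in> A"
    and denominator_exists: "\<exists>d\<in>A. d \<noteq> 0 \<and> d * x \<in> A"
begin

lemma submodule_self: "submodule_of A A"
  by (simp add: submodule_of_def zero_closed add_closed mult_closed)

lemma submodule_ideal_inverse: "submodule_of A (ideal_inverse A I)"
  by (auto simp: submodule_of_def ideal_inverse_def zero_closed distrib_right add_closed mult.assoc mult_closed)

lemma submodule_ideal_mult:
  assumes "submodule_of A I"
  shows "submodule_of A (ideal_mult I J)"
  using assms ideal_mult_mult_left[of I _ I _ J] unfolding submodule_of_def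
  by (auto intro: ideal_mult_zero ideal_mult_add)

lemma ideal_mult_one:
  assumes "submodule_of A I"
  shows "ideal_mult A I = I"
proof
  show "ideal_mult A I \<subseteq> I" using assms by (intro ideal_mult_subset) (auto simp: submodule_of_def)
  show "I \<subseteq> ideal_mult A I" using ideal_mult_product[OF one_closed] by fastforce
qed

lemma fractional_ideal_submodule:
  assumes "fractional_ideal A I"
  shows "submodule_of A I"
proof -
  obtain d where "d \<noteq> 0" and d: "ideal_of A ((*) d ` I)"
    using assms unfolding fractional_ideal_def by blast
  then have mem: "x \<in> I \<longleftrightarrow> d * x \<in> (*) d ` I" for x by auto
  have "x + y \<in> I" if "x \<in> I" "y \<in> I" for x y
    using d that unfolding mem[of "x + y"] mem[of x] mem[of y] ideal_of_def distrib_left by blast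
  moreover have "a * x \<in> I" if "a \<in> A" "x \<in> I" for a x
    using d that unfolding mem[of "a * x"] mem[of x] ideal_of_def mult.left_commute[of d] by blast
  moreover have "0 \<in> I" using d unfolding mem[of 0] ideal_of_def by simp
  ultimately show ?thesis by (simp add: submodule_of_def)
qed

lemma ideal_of_scale:
  assumes "submodule_of A I" "\<And>x. x \<in> I \<Longrightarrow> d * x \<in> A"
  shows "ideal_of A ((*) d ` I)"
  unfolding ideal_of_def
proof (intro conjI ballI)
  show "0 \<in> (*) d ` I" using assms(1) unfolding submodule_of_def by (metis imageI mult_zero_right)
next
  fix x y assume "x \<in> (*) d ` I" "y \<in> (*) d ` I"
  then show "x + y \<in> (*) d ` I" using assms(1) unfolding submodule_of_def
    by (auto simp flip: distrib_left)
next
  fix a x assume "a \<in> A" "x \<in> (*) d ` I"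
  then show "a * x \<in> (*) d ` I" using assms(1) unfolding submodule_of_def
    by (auto simp: mult.left_commute[of a])
qed (use assms in auto)

lemma common_denominator: "\<exists>d\<in>A. d \<noteq> 0 \<and> (\<forall>i<(n::nat). d * x i \<in> A)"
proof (induction n)
  case (Suc n)
  then obtain d where d: "d \<in> A" "d \<noteq> 0" "\<forall>i<n. d * x i \<in> A" by blast
  obtain e where e: "e \<in> A" "e \<noteq> 0" "e * x n \<in> A" using denominator_exists by blast
  have "e * d * x i \<in> A" if "i < Suc n" for i
  proof (cases "i = n")
    case True
    then have "e * d * x i = d * (e * x n)" by (simp add: algebra_simps)
    then show ?thesis using mult_closed[OF d(1) e(3)] by (simp only:)
  next
    case False
    then show ?thesis using that d(3) mult_closed[OF e(1), of "d * x i"] by (simp add: mult.assoc)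
  qed
  then show ?case using d e mult_closed by (intro bexI[of _ "e * d"]) auto
qed (use one_closed in \<open>auto intro!: bexI[of _ 1]\<close>)

text \<open>A relation 1 = sum of x_i y_i writes any z in I as the sum of x_i (z y_i) with z y_i in
  A, so a common denominator of the finitely many x_i works for all of I.\<close>

lemma fractional_ideal_if_invertible:
  assumes I: "submodule_of A I" and J: "ideal_mult I J = A"
  shows "fractional_ideal A I"
proof -
  obtain n :: nat and x y where xy: "1 = (\<Sum>i<n. x i * y i)" "\<forall>i<n. x i \<in> I \<and> y i \<in> J"
    using one_closed unfolding J[symmetric] ideal_mult_def by blast
  obtain d where d: "d \<in> A" "d \<noteq> 0" "\<forall>i<n. d * x i \<in> A" using common_denominator by blast
  have "d * z \<in> A" if z: "z \<in> I" for z
  proof -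
    have "d * z = (d * z) * (\<Sum>i<n. x i * y i)" using xy(1) by simp
    also have "\<dots> = (\<Sum>i<n. (d * x i) * (z * y i))" by (simp add: sum_distrib_left algebra_simps)
    also have "\<dots> \<in> ideal_mult A A"
      using d(3) xy(2) ideal_mult_product[OF z, of _ J] unfolding J
      by (intro ideal_mult_sum ideal_mult_product) auto
    finally show ?thesis by (simp add: ideal_mult_one[OF submodule_self])
  qed
  then have "ideal_of A ((*) d ` I)" by (rule ideal_of_scale[OF I])
  moreover have "I \<noteq> {0}"
  proof
    assume "I = {0}"
    then have "A \<subseteq> {0}" unfolding J[symmetric] by (intro ideal_mult_subset) auto
    then show False using one_closed by auto
  qed
  ultimately show ?thesis using d unfolding fractional_ideal_def by blast
qed

text \<open>Multiplying z by 1 = sum of x_i y_i exhibits it as a sum of (z x_i) y_i, an element of A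
  J = J.\<close>

lemma ideal_inverse_unique:
  assumes "submodule_of A J" and J: "ideal_mult I J = A"
  shows "ideal_inverse A I = J"
proof
  show "ideal_inverse A I \<subseteq> J"
  proof
    fix z assume z: "z \<in> ideal_inverse A I"
    obtain n :: nat and x y where xy: "1 = (\<Sum>i<n. x i * y i)" "\<forall>i<n. x i \<in> I \<and> y i \<in> J"
      using one_closed unfolding J[symmetric] ideal_mult_def by blast
    have "z = z * (\<Sum>i<n. x i * y i)" using xy(1) by simp
    also have "\<dots> = (\<Sum>i<n. (z * x i) * y i)" by (simp add: sum_distrib_left algebra_simps)
    also have "\<dots> \<in> ideal_mult A J"
      using z xy(2) by (intro ideal_mult_sum ideal_mult_product) (auto simp: ideal_inverse_def)
    finally show "z \<in> J" by (simp add: ideal_mult_one assms)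
  qed
  show "J \<subseteq> ideal_inverse A I"
    unfolding ideal_inverse_def
  proof (intro subsetI CollectI ballI)
    fix y x assume "y \<in> J" "x \<in> I"
    then have "x * y \<in> A" using J ideal_mult_product by blast
    then show "y * x \<in> A" by (simp only: mult.commute)
  qed
qed

section \<open>Computations in the class group\<close>

lemma ideal_class_eq:
  assumes "submodule_of A I"
  shows "ideal_class A I = {(*) x ` I | x. x \<noteq> 0}"
proof -
  have "ideal_class A I = (\<lambda>H. ideal_mult H I) ` {(*) x ` A | x. x \<noteq> 0}"
    unfolding ideal_class_def r_coset_def principal_ideals_def ideal_group_def by auto
  also have "\<dots> = {ideal_mult ((*) x ` A) I | x. x \<noteq> 0}" by blast
  finally show ?thesis unfolding ideal_mult_scale ideal_mult_one[OF assms] .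
qed

lemma ideal_class_self:
  assumes "submodule_of A I"
  shows "I \<in> ideal_class A I"
  unfolding ideal_class_eq[OF assms] by (auto intro!: exI[of _ 1])

lemma ideal_class_scale:
  assumes I: "submodule_of A I" and c: "c \<noteq> 0"
  shows "submodule_of A ((*) c ` I)" "ideal_class A ((*) c ` I) = ideal_class A I"
proof -
  show cI: "submodule_of A ((*) c ` I)"
    unfolding submodule_of_def
  proof (intro conjI ballI)
    show "0 \<in> (*) c ` I" using I unfolding submodule_of_def by (metis imageI mult_zero_right)
  next
    fix x y assume "x \<in> (*) c ` I" "y \<in> (*) c ` I"
    then show "x + y \<in> (*) c ` I" using I unfolding submodule_of_def
      by (auto simp flip: distrib_left)
  next
    fix a x assume "a \<in> A" "x \<in> (*) c ` I"
    then show "a * x \<in> (*) c ` I" using I unfolding submodule_of_def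
      by (auto simp: mult.left_commute[of a])
  qed
  have 1: "(*) x ` (*) c ` I = (*) (x * c) ` I" for x by (simp add: image_image mult.assoc)
  have 2: "(*) x ` I = (*) (x / c) ` (*) c ` I" for x using c by (simp add: image_image)
  show "ideal_class A ((*) c ` I) = ideal_class A I"
    unfolding ideal_class_eq[OF I] ideal_class_eq[OF cI]
  proof (intro subset_antisym subsetI)
    fix I' assume "I' \<in> {(*) x ` (*) c ` I | x. x \<noteq> 0}"
    then obtain x where "x * c \<noteq> 0" "I' = (*) (x * c) ` I" using c 1 by auto
    then show "I' \<in> {(*) x ` I | x. x \<noteq> 0}" by blast
  next
    fix I' assume "I' \<in> {(*) x ` I | x. x \<noteq> 0}"
    then obtain x where "x \<noteq> 0" "I' = (*) x ` I" by blast
    then have "x / c \<noteq> 0" "I' = (*) (x / c) ` (*) c ` I" using c 2[of x] by (simp, simp only:)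
    then show "I' \<in> {(*) x ` (*) c ` I | x. x \<noteq> 0}" by blast
  qed
qed

text \<open>The product of two cosets is the set of all products of their members, and (x I)(y J) =
  x y (I J); conversely the whole scalar can be put on the first factor.\<close>

lemma class_group_mult:
  assumes I: "submodule_of A I" and J: "submodule_of A J"
  shows "ideal_class A I \<otimes>\<^bsub>class_group A\<^esub> ideal_class A J = ideal_class A (ideal_mult I J)"
proof -
  have scale: "ideal_mult ((*) x ` I) ((*) y ` J) = (*) (x * y) ` ideal_mult I J" for x y
  proof -
    have "ideal_mult I ((*) y ` J) = (*) y ` ideal_mult I J"
      using ideal_mult_scale[of y J I] by (simp only: ideal_mult_commute)
    then show ?thesis by (simp add: ideal_mult_scale image_image mult.assoc)
  qed
  have IJ: "submodule_of A (ideal_mult I J)" by (rule submodule_ideal_mult[OF I])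
  have mem: "H \<in> ideal_class A I \<otimes>\<^bsub>class_group A\<^esub> ideal_class A J \<longleftrightarrow>
      (\<exists>I'\<in>ideal_class A I. \<exists>J'\<in>ideal_class A J. H = ideal_mult I' J')" for H
    unfolding class_group_def FactGroup_def set_mult_def ideal_group_def by simp
  show ?thesis
  proof (intro subset_antisym subsetI)
    fix H assume "H \<in> ideal_class A I \<otimes>\<^bsub>class_group A\<^esub> ideal_class A J"
    then obtain I' J' where IJ': "I' \<in> ideal_class A I" "J' \<in> ideal_class A J" "H = ideal_mult I' J'"
      unfolding mem by blast
    obtain x where x: "x \<noteq> 0" "I' = (*) x ` I" using IJ'(1) unfolding ideal_class_eq[OF I] by blast
    obtain y where y: "y \<noteq> 0" "J' = (*) y ` J" using IJ'(2) unfolding ideal_class_eq[OF J] by blast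
    have "H = (*) (x * y) ` ideal_mult I J" "x * y \<noteq> 0" using x y IJ'(3) scale by simp_all
    then show "H \<in> ideal_class A (ideal_mult I J)" unfolding ideal_class_eq[OF IJ] by blast
  next
    fix H assume "H \<in> ideal_class A (ideal_mult I J)"
    then obtain x where x: "x \<noteq> 0" "H = (*) x ` ideal_mult I J" unfolding ideal_class_eq[OF IJ] by blast
    have "(*) x ` I \<in> ideal_class A I" unfolding ideal_class_eq[OF I] using x by blast
    moreover have "H = ideal_mult ((*) x ` I) J" by (simp add: x ideal_mult_scale)
    ultimately show "H \<in> ideal_class A I \<otimes>\<^bsub>class_group A\<^esub> ideal_class A J"
      unfolding mem using ideal_class_self[OF J] by blast
  qed
qed

text \<open>\<open>m_inv\<close> is a definite description, so uniqueness in the carrier is shown by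
  hand: if I H = c A, multiplication by J gives H = c J, which has the class of J.\<close>

lemma class_group_inv:
  assumes I: "submodule_of A I" and J: "submodule_of A J" and IJ: "ideal_mult I J = A"
  shows "inv\<^bsub>class_group A\<^esub> (ideal_class A I) = ideal_class A J"
proof -
  have JI: "ideal_mult J I = A" using IJ by (simp add: ideal_mult_commute)
  have carrier: "carrier (class_group A) = {ideal_class A I | I. fractional_ideal A I}"
    unfolding class_group_def FactGroup_def RCOSETS_def ideal_class_def by (auto simp: ideal_group_def)
  have one: "\<one>\<^bsub>class_group A\<^esub> = ideal_class A A"
    unfolding class_group_def FactGroup_def ideal_class_eq[OF submodule_self] principal_ideals_def by simp
  show ?thesis unfolding m_inv_def
  proof (rule the_equality)
    show "ideal_class A J \<in> carrier (class_group A) \<and>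
      ideal_class A I \<otimes>\<^bsub>class_group A\<^esub> ideal_class A J = \<one>\<^bsub>class_group A\<^esub> \<and>
      ideal_class A J \<otimes>\<^bsub>class_group A\<^esub> ideal_class A I = \<one>\<^bsub>class_group A\<^esub>"
      unfolding class_group_mult[OF I J] class_group_mult[OF J I] IJ JI one carrier
      using fractional_ideal_if_invertible[OF J JI] by blast
  next
    fix C assume C: "C \<in> carrier (class_group A) \<and>
      ideal_class A I \<otimes>\<^bsub>class_group A\<^esub> C = \<one>\<^bsub>class_group A\<^esub> \<and> C \<otimes>\<^bsub>class_group A\<^esub> ideal_class A I = \<one>\<^bsub>class_group A\<^esub>"
    then obtain H where H: "C = ideal_class A H" "submodule_of A H"
      unfolding carrier using fractional_ideal_submodule by blast
    then have "ideal_mult I H \<in> ideal_class A A"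
      using C unfolding one H class_group_mult[OF I H(2)]
      using ideal_class_self[OF submodule_ideal_mult[OF I], of H] by simp
    then obtain c where c: "c \<noteq> 0" "ideal_mult I H = (*) c ` A"
      unfolding ideal_class_eq[OF submodule_self] by blast
    have "H = ideal_mult (ideal_mult J I) H" using JI ideal_mult_one[OF H(2)] by simp
    also have "\<dots> = ideal_mult ((*) c ` A) J"
      unfolding ideal_mult_assoc c(2) by (rule ideal_mult_commute)
    also have "\<dots> = (*) c ` J" unfolding ideal_mult_scale ideal_mult_one[OF J] ..
    finally show "C = ideal_class A J" using ideal_class_scale(2)[OF J c(1)] H by simp
  qed
qed

text \<open>The definite description ranges over all ideals isomorphic to L. They share one class
  because two A-linear injections of L into A differ by a scalar of K.\<close>

lemma module_class_eq:
  assumes iso: "module_iso A act L I f" and I: "fractional_ideal A I"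
    and act: "\<And>a l. a \<in> A \<Longrightarrow> l \<in> L \<Longrightarrow> act a l \<in> L"
  shows "module_class A act L = ideal_class A I"
proof -
  have sub: "submodule_of A I" by (rule fractional_ideal_submodule[OF I])
  obtain d where d: "d \<noteq> 0" "ideal_of A ((*) d ` I)" and I0: "I \<noteq> {0}"
    using I unfolding fractional_ideal_def by blast
  \<comment> \<open>\<open>module_class\<close> asks for an ideal inside A, so the denominator of
    the fractional ideal is cleared first.\<close>
  define f1 where "f1 = (\<lambda>x. d * f x)"
  have iso1: "module_iso A act L ((*) d ` I) f1"
    unfolding module_iso_def
  proof (intro conjI ballI)
    have "bij_betw f L I" using iso by (simp add: module_iso_def)
    moreover have "bij_betw ((*) d) I ((*) d ` I)" using d(1) by (auto intro!: inj_on_imp_bij_betw inj_onI)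
    ultimately show "bij_betw f1 L ((*) d ` I)" using bij_betw_trans[of f L I "(*) d"]
      by (simp add: f1_def comp_def)
  qed (use iso in \<open>auto simp: module_iso_def f1_def distrib_left mult.left_commute\<close>)
  have "\<exists>x\<in>I. x \<noteq> 0" using I0 sub unfolding submodule_of_def by blast
  then have dI0: "(*) d ` I \<noteq> {0}" using d(1) by (metis imageI mult_eq_0_iff singletonD)
  have cls: "ideal_class A ((*) d ` I) = ideal_class A I" by (rule ideal_class_scale[OF sub d(1)])
  show ?thesis unfolding module_class_def
  proof (rule the_equality)
    show "\<exists>I' f. ideal_of A I' \<and> I' \<noteq> {0} \<and> module_iso A act L I' f \<and> ideal_class A I = ideal_class A I'"
      by (intro exI[of _ "(*) d ` I"] exI[of _ f1] conjI d dI0 iso1 cls[symmetric])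
  next
    fix C assume "\<exists>I f. ideal_of A I \<and> I \<noteq> {0} \<and> module_iso A act L I f \<and> C = ideal_class A I"
    then obtain I2 f2 where I2: "ideal_of A I2" "I2 \<noteq> {0}" and iso2: "module_iso A act L I2 f2"
      and C: "C = ideal_class A I2" by blast
    have inj1: "inj_on f1 L" and im1: "f1 ` L = (*) d ` I" and im2: "f2 ` L = I2"
      using iso1 iso2 by (auto simp: module_iso_def bij_betw_def)
    have lin: "f1 (act a l) = a * f1 l" "f2 (act a l) = a * f2 l" if "a \<in> A" "l \<in> L" for a l
      using iso1 iso2 that by (auto simp: module_iso_def)
    have f1A: "f1 l \<in> A" if "l \<in> L" for l using d(2) im1 that unfolding ideal_of_def by blast
    \<comment> \<open>Values of \<open>f1\<close> lie in A and so act on L: f1 l acting on l' and f1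
      l' acting on l have the same image under the injective \<open>f1\<close>, hence agree.
      Applying \<open>f2\<close> to this equality gives the proportionality.\<close>
    have cross: "f1 l * f2 l' = f1 l' * f2 l" if l: "l \<in> L" "l' \<in> L" for l l'
    proof -
      have "f1 (act (f1 l) l') = f1 (act (f1 l') l)" using lin f1A l by (simp add: mult.commute)
      then have "act (f1 l) l' = act (f1 l') l"
        by (rule inj_onD[OF inj1 _ act act]) (use f1A l in auto)
      then have "f2 (act (f1 l) l') = f2 (act (f1 l') l)" by simp
      then show ?thesis using lin(2) f1A l by simp
    qed
    have "0 \<in> I2" using I2(1) by (simp add: ideal_of_def)
    then obtain y where "y \<in> I2" "y \<noteq> 0" using I2(2) by blast
    then obtain l where l: "l \<in> L" "f2 l \<noteq> 0" unfolding im2[symmetric] by blast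
    obtain l' where l': "l' \<in> L" "f1 l' \<noteq> 0"
    proof -
      have "0 \<in> (*) d ` I" using d(2) by (simp add: ideal_of_def)
      then obtain y where "y \<in> f1 ` L" "y \<noteq> 0" unfolding im1 using dI0 by blast
      then show ?thesis using that by blast
    qed
    have l1: "f1 l \<noteq> 0" using cross[OF l(1) l'(1)] l(2) l'(2) by (metis mult_eq_0_iff)
    define c where "c = f2 l / f1 l"
    have c0: "c \<noteq> 0" using l l1 by (simp add: c_def)
    have "f2 x = c * f1 x" if "x \<in> L" for x
    proof -
      have "f1 l * f2 x = f1 l * (c * f1 x)"
        unfolding cross[OF l(1) that] using l1 by (simp add: c_def)
      then show ?thesis using l1 by simp
    qed
    then have "f2 ` L = (*) c ` f1 ` L" by (simp add: image_image)
    then have "I2 = (*) c ` (*) d ` I" using im1 im2 by simp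
    then show "C = ideal_class A I"
      unfolding C using ideal_class_scale[OF ideal_class_scale(1)[OF sub d(1)] c0] cls by simp
  qed
qed

text \<open>Let U and U' be the inverses of J and J'. From D U = J' follows D U U' = A, so D is
  invertible with colon module U U', and the inverse class of that colon module is the class of D.
  The claim then reads: class of J' = class of D times class of U.\<close>

lemma class_of_dual_module:
  assumes J: "submodule_of A J" "ideal_mult J (ideal_inverse A J) = A"
    and J': "submodule_of A J'" "ideal_mult J' (ideal_inverse A J') = A"
    and D: "submodule_of A D" and dual: "J' = {y. \<forall>x\<in>J. y * x \<in> D}"
  shows "ideal_class A J' =
    inv\<^bsub>class_group A\<^esub> (ideal_class A (ideal_inverse A D)) \<otimes>\<^bsub>class_group A\<^esub> inv\<^bsub>class_group A\<^esub> (ideal_class A J)"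
proof -
  define U where "U = ideal_inverse A J"
  define U' where "U' = ideal_inverse A J'"
  have U: "submodule_of A U" "ideal_mult J U = A" and U': "submodule_of A U'" "ideal_mult J' U' = A"
    using J J' by (auto simp: U_def U'_def submodule_ideal_inverse)
  have D_eq: "ideal_mult J' J = D"
  proof
    show "ideal_mult J' J \<subseteq> D" using D dual by (intro ideal_mult_subset) (auto simp: submodule_of_def)
    \<comment> \<open>The product of x u with z in J is (z u) x, and z u lies in A; so x u belongs
      to the dual module. Multiplying this inclusion by J gives D inside J' J.\<close>
    have "ideal_mult D U \<subseteq> J'"
    proof (intro ideal_mult_subset)
      fix x u assume x: "x \<in> D" and u: "u \<in> U"
      have "x * u * z \<in> D" if z: "z \<in> J" for z
      proof -
        have "z * u \<in> A" using ideal_mult_product[OF z u] U by simp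
        then have "(z * u) * x \<in> D" using x D by (simp add: submodule_of_def)
        then show ?thesis by (simp add: algebra_simps)
      qed
      then show "x * u \<in> J'" using dual by blast
    qed (use J'(1) in \<open>auto simp: submodule_of_def\<close>)
    moreover have "ideal_mult I K \<subseteq> ideal_mult I' K" if "I \<subseteq> I'" for I I' K :: "'K set"
      using that by (intro ideal_mult_subset ideal_mult_zero ideal_mult_add) (auto intro: ideal_mult_product)
    ultimately have "ideal_mult (ideal_mult D U) J \<subseteq> ideal_mult J' J" by blast
    moreover have "ideal_mult (ideal_mult D U) J = ideal_mult A D"
      unfolding ideal_mult_assoc ideal_mult_commute[of U J] U(2) by (rule ideal_mult_commute)
    ultimately show "D \<subseteq> ideal_mult J' J" using ideal_mult_one[OF D] by simp
  qed
  have DU: "ideal_mult D U = J'"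
    unfolding D_eq[symmetric] ideal_mult_assoc U(2) ideal_mult_commute[of J' A]
    by (rule ideal_mult_one[OF J'(1)])
  have UU': "submodule_of A (ideal_mult U U')" by (rule submodule_ideal_mult[OF U(1)])
  have inv: "ideal_mult D (ideal_mult U U') = A" unfolding ideal_mult_assoc[symmetric] DU by (rule U'(2))
  then have "ideal_inverse A D = ideal_mult U U'" by (rule ideal_inverse_unique[OF UU'])
  then have "inv\<^bsub>class_group A\<^esub> (ideal_class A (ideal_inverse A D)) = ideal_class A D"
    using class_group_inv[OF UU' D] inv ideal_mult_commute[of D "ideal_mult U U'"] by metis
  moreover have "inv\<^bsub>class_group A\<^esub> (ideal_class A J) = ideal_class A U"
    by (rule class_group_inv[OF J(1) U])
  ultimately show ?thesis using class_group_mult[OF D U(1)] DU by simp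
qed

end

context separable_extension
begin

sublocale ring: fraction_subring A
proof
  fix x
  obtain d where "d \<noteq> 0" "P d * x \<in> A" using denominator by blast
  then show "\<exists>d\<in>A. d \<noteq> 0 \<and> d * x \<in> A" using A_poly_K poly_K_eq_0_iff by blast
qed (auto intro: A_zero A_one A_add A_mult)

text \<open>The elements \<open>b s\<close> bring every generator, hence all of I, into A, so they
  lie in the colon module; the relation sum of s b_s = 1 then puts 1 into the product.\<close>

lemma finitely_generated_invertible:
  assumes S: "finite S" "\<exists>s\<in>S. s \<noteq> 0" "S \<subseteq> I" and gen: "\<And>x. x \<in> I \<Longrightarrow> \<exists>a. (\<forall>s\<in>S. a s \<in> A) \<and> x = (\<Sum>s\<in>S. a s * s)"
  shows "ideal_mult I (ideal_inverse A I) = A"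
proof
  show "ideal_mult I (ideal_inverse A I) \<subseteq> A"
    by (intro ideal_mult_subset A_zero A_add) (auto simp: ideal_inverse_def mult.commute)
  obtain b where b: "(\<Sum>s\<in>S. s * b s) = 1" "\<And>s t. s \<in> S \<Longrightarrow> t \<in> S \<Longrightarrow> t * b s \<in> A"
    using finite_set_invertible[OF S(1,2)] by blast
  have inv: "b s \<in> ideal_inverse A I" if s: "s \<in> S" for s
    unfolding ideal_inverse_def
  proof (intro CollectI ballI)
    fix x assume "x \<in> I"
    then obtain a where a: "\<And>t. t \<in> S \<Longrightarrow> a t \<in> A" "x = (\<Sum>t\<in>S. a t * t)" using gen by blast
    have "b s * x = (\<Sum>t\<in>S. a t * (t * b s))" unfolding a(2) by (simp add: sum_distrib_left algebra_simps)
    then show "b s * x \<in> A" using A_sum[of S, OF A_mult[OF a(1) b(2)[OF s]]] by (simp only:)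
  qed
  show "A \<subseteq> ideal_mult I (ideal_inverse A I)"
  proof
    fix x assume x: "x \<in> A"
    have "x = (\<Sum>s\<in>S. s * (x * b s))"
      using b(1) by (simp add: mult.left_commute[of _ x] flip: sum_distrib_left)
    also have "\<dots> \<in> ideal_mult I (ideal_inverse A I)"
      using S(3) inv x ring.submodule_ideal_inverse[of I] unfolding submodule_of_def
      by (intro ideal_mult_sum ideal_mult_product) auto
    finally show "x \<in> ideal_mult I (ideal_inverse A I)" .
  qed
qed

end

section \<open>Elements algebraic over a subfield\<close>

lemma vector_space_hom:
  fixes f :: "'a::field \<Rightarrow> 'b::field"
  assumes "unital_ring_hom f"
  shows "vector_space (\<lambda>c x. f c * x)"
  by unfold_locales (simp_all add: unital_ring_hom_simps[OF assms] algebra_simps)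

context
  fixes f :: "'a::field \<Rightarrow> 'b::field"
  assumes f_hom: "unital_ring_hom f"
begin

interpretation vs: vector_space "\<lambda>c x. f c * x"
  by (rule vector_space_hom[OF f_hom])

text \<open>All powers of z lie in the span, so among the first card S + 1 of them there is a linear
  relation over the subfield, which is read as a polynomial.\<close>

lemma algebraic_over_if_finite_span:
  assumes S: "finite S" "1 \<in> vs.span S" "\<And>x. x \<in> vs.span S \<Longrightarrow> z * x \<in> vs.span S"
  shows "algebraic_over f z"
proof -
  have pow: "z ^ i \<in> vs.span S" for i by (induction i) (use S in auto)
  let ?n = "card S"
  show ?thesis
  \<comment> \<open>Dependence is a property of sets, so repeated powers are treated apart; they
    yield the equation X^i - X^k.\<close>
  proof (cases "inj_on (\<lambda>i. z ^ i) {..?n}")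
    case False
    then obtain i k where ik: "i \<noteq> k" "z ^ i = z ^ k" by (auto simp: inj_on_def)
    have "map_poly f (monom 1 i - monom 1 k) = monom 1 i - monom 1 k"
      by (simp add: poly_eq_iff coeff_map_poly unital_ring_hom_simps[OF f_hom])
    then have "poly (map_poly f (monom 1 i - monom 1 k)) z = 0" using ik by (simp add: poly_monom)
    moreover have "monom 1 i - monom 1 k \<noteq> (0 :: 'a poly)" using ik(1) by (simp add: monom_eq_iff')
    ultimately show ?thesis unfolding algebraic_over_def by blast
  next
    case True
    have "\<not> card ((\<lambda>i. z ^ i) ` {..?n}) \<le> card S" using True by (simp add: card_image)
    then have "vs.dependent ((\<lambda>i. z ^ i) ` {..?n})"
      using vs.independent_span_bound[OF S(1), of "(\<lambda>i. z ^ i) ` {..?n}"] pow by blast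
    then obtain u where u: "\<exists>v\<in>(\<lambda>i. z ^ i) ` {..?n}. u v \<noteq> 0" "(\<Sum>v\<in>(\<lambda>i. z ^ i) ` {..?n}. f (u v) * v) = 0"
      unfolding vs.dependent_finite[OF finite_imageI[OF finite_atMost]] by blast
    define p where "p = (\<Sum>i\<le>?n. monom (u (z ^ i)) i)"
    have cp: "coeff p k = (if k \<le> ?n then u (z ^ k) else 0)" for k
      by (simp add: p_def coeff_sum)
    have "map_poly f p = (\<Sum>i\<le>?n. monom (f (u (z ^ i))) i)"
      by (simp add: poly_eq_iff coeff_map_poly cp coeff_sum unital_ring_hom_simps[OF f_hom])
    then have "poly (map_poly f p) z = (\<Sum>i\<le>?n. f (u (z ^ i)) * z ^ i)" by (simp add: poly_sum poly_monom)
    also have "\<dots> = 0" using u(2) True by (simp add: sum.reindex)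
    finally have "poly (map_poly f p) z = 0" .
    moreover have "p \<noteq> 0" using u(1) cp by (metis (mono_tags, lifting) atMost_iff coeff_0 imageE)
    ultimately show ?thesis unfolding algebraic_over_def by blast
  qed
qed

lemma algebraic_over_power:
  assumes "algebraic_over f z"
  obtains n c where "n > 0" "z ^ n = (\<Sum>i<n. f (c i) * z ^ i)"
proof -
  obtain p where p: "p \<noteq> 0" "poly (map_poly f p) z = 0" using assms unfolding algebraic_over_def by blast
  define n where "n = degree p"
  define c where "c = (\<lambda>i. - (coeff p i / lead_coeff p))"
  have deg: "degree (map_poly f p) = n"
    unfolding n_def by (rule degree_map_poly) (simp add: unital_ring_hom_eq_0_iff[OF f_hom])
  have l0: "f (coeff p n) \<noteq> 0" using p(1) by (simp add: n_def unital_ring_hom_eq_0_iff[OF f_hom])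
  have "0 = (\<Sum>i\<le>n. f (coeff p i) * z ^ i)"
    using p(2) by (simp add: poly_altdef deg coeff_map_poly unital_ring_hom_zero[OF f_hom])
  also have "{..n} = insert n {..<n}" by auto
  finally have *: "f (coeff p n) * z ^ n = - (\<Sum>i<n. f (coeff p i) * z ^ i)"
    by (simp add: eq_neg_iff_add_eq_0)
  have "(\<Sum>i<n. f (c i) * z ^ i) = - (\<Sum>i<n. f (coeff p i) * z ^ i) / f (coeff p n)"
    by (simp add: c_def unital_ring_hom_minus[OF f_hom] unital_ring_hom_divide[OF f_hom] n_def
        sum_divide_distrib flip: sum_negf)
  also have "\<dots> = z ^ n" unfolding *[symmetric] using l0 by simp
  finally have "z ^ n = (\<Sum>i<n. f (c i) * z ^ i)" by simp
  moreover have "n > 0"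
  proof (rule ccontr)
    assume "\<not> n > 0"
    then show False using * l0 by simp
  qed
  ultimately show ?thesis using that by blast
qed

text \<open>The monomials z^i w^k with i < n and k < m span a space that contains 1 and is stable
  under multiplication by z and by w, hence by their sum and product.\<close>

lemma algebraic_over_add_mult:
  assumes z: "algebraic_over f z" and w: "algebraic_over f w"
  shows "algebraic_over f (z + w)" "algebraic_over f (z * w)"
proof -
  obtain n c where n: "n > 0" "z ^ n = (\<Sum>i<n. f (c i) * z ^ i)" using algebraic_over_power[OF z] .
  obtain m d where m: "m > 0" "w ^ m = (\<Sum>i<m. f (d i) * w ^ i)" using algebraic_over_power[OF w] .
  define S where "S = (\<lambda>(i, k). z ^ i * w ^ k) ` ({..<n} \<times> {..<m})"
  have S: "finite S" by (simp add: S_def)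
  have mem: "z ^ i * w ^ k \<in> vs.span S" if "i < n" "k < m" for i k
    using that by (intro vs.span_base) (auto simp: S_def)
  have closed: "a * x \<in> vs.span S" if gen: "\<And>i k. i < n \<Longrightarrow> k < m \<Longrightarrow> a * (z ^ i * w ^ k) \<in> vs.span S"
    and x: "x \<in> vs.span S" for a x
    using x
  proof (induction rule: vs.span_induct_alt)
    case base
    then show ?case using vs.span_zero by simp
  next
    case (step e x y)
    then obtain i k where "i < n" "k < m" "x = z ^ i * w ^ k" by (auto simp: S_def)
    then have "f e * (a * x) + a * y \<in> vs.span S"
      using gen step by (intro vs.span_add vs.span_scale) auto
    then show ?case by (simp add: algebra_simps)
  qed
  have z_closed: "z * x \<in> vs.span S" if "x \<in> vs.span S" for x
  proof (rule closed[OF _ that])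
    fix i k assume ik: "i < n" "k < m"
    show "z * (z ^ i * w ^ k) \<in> vs.span S"
    proof (cases "Suc i = n")
      case True
      have "z * (z ^ i * w ^ k) = z ^ n * w ^ k" by (simp flip: True)
      also have "\<dots> = (\<Sum>i<n. f (c i) * (z ^ i * w ^ k))" unfolding n(2) by (simp add: sum_distrib_right mult.assoc)
      also have "\<dots> \<in> vs.span S" using mem ik by (intro vs.span_sum vs.span_scale) auto
      finally show ?thesis .
    next
      case False
      then show ?thesis using mem[of "Suc i" k] ik by (simp add: mult.assoc)
    qed
  qed
  have w_closed: "w * x \<in> vs.span S" if "x \<in> vs.span S" for x
  proof (rule closed[OF _ that])
    fix i k assume ik: "i < n" "k < m"
    show "w * (z ^ i * w ^ k) \<in> vs.span S"
    proof (cases "Suc k = m")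
      case True
      have "w * (z ^ i * w ^ k) = z ^ i * w ^ m" by (simp add: algebra_simps flip: True)
      also have "\<dots> = (\<Sum>k<m. f (d k) * (z ^ i * w ^ k))" unfolding m(2) by (simp add: sum_distrib_left algebra_simps)
      also have "\<dots> \<in> vs.span S" using mem ik by (intro vs.span_sum vs.span_scale) auto
      finally show ?thesis .
    next
      case False
      then show ?thesis using mem[of i "Suc k"] ik by (simp add: algebra_simps)
    qed
  qed
  have one: "1 \<in> vs.span S" using mem[of 0 0] n m by simp
  show "algebraic_over f (z + w)"
    by (rule algebraic_over_if_finite_span[OF S one])
      (simp add: distrib_right vs.span_add z_closed w_closed)
  show "algebraic_over f (z * w)"
    by (rule algebraic_over_if_finite_span[OF S one]) (simp add: mult.assoc z_closed w_closed)
qed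

lemma algebraic_over_hom: "algebraic_over f (f c)"
  unfolding algebraic_over_def
  by (intro exI[of _ "[:- c, 1:]"]) (simp add: map_poly_pCons unital_ring_hom_simps[OF f_hom])

text \<open>After one linear factor is split off, \<open>alg_closed\<close> must still apply to the
  quotient. Its coefficients are obtained from the top down by additions and multiplications of
  algebraic elements.\<close>

lemma algebraic_over_quotient_coeffs:
  assumes "Q = [:- z, 1:] * R" "\<And>i. algebraic_over f (coeff Q i)" "algebraic_over f z"
  shows "algebraic_over f (coeff R i)"
proof (cases "i \<le> degree R")
  case True
  have Q: "coeff Q (Suc i) = coeff R i - z * coeff R (Suc i)" for i by (simp add: assms(1))
  show ?thesis using True
  proof (induction rule: inc_induct)
    case base
    then show ?case using assms(2)[of "Suc (degree R)"] unfolding Q by (simp add: coeff_eq_0)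
  next
    case (step n)
    have "coeff R n = coeff Q (Suc n) + z * coeff R (Suc n)" by (simp add: Q)
    then show ?case using assms(2,3) step.IH algebraic_over_add_mult by (metis (no_types))
  qed
next
  case False
  then show ?thesis using algebraic_over_hom[of 0] by (simp add: coeff_eq_0 unital_ring_hom_simps[OF f_hom])
qed

end

section \<open>Embeddings and the trace\<close>

context structure_map
begin

sublocale K: vector_space "scale_K \<iota>"
  by unfold_locales (simp_all add: scale_K_def unital_ring_hom_simps[OF \<iota>_hom] algebra_simps)

end

context separable_extension
begin

lemma K_finite_span: "\<exists>B. finite B \<and> K.span B = UNIV"
  using fin_sep unfolding finite_separable_def by blast

lemma K_finite_basis:
  assumes "\<not> K.dependent B"
  shows "finite B"
  using K_finite_span K.independent_span_bound[OF _ assms] by (metis top_greatest)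

lemma K_basis_exists: "\<exists>B. finite B \<and> \<not> K.dependent B \<and> K.span B = UNIV"
  using K.basis_exists[of UNIV] K_finite_basis by (metis top.extremum_unique)

lemma degree_K_eq_card:
  assumes "\<not> K.dependent B" "K.span B = UNIV"
  shows "degree_K \<iota> = card B"
  unfolding degree_K_def using K.dim_eq_card[of B UNIV] assms by simp

end

text \<open>This is Q(m_s) applied to the form, where m_s precomposes a function on K with
  multiplication by s. An algebraic equation of s thus becomes an operator equation on
  forms.\<close>

definition poly_act :: "'K::field \<Rightarrow> 'c::field poly \<Rightarrow> ('K \<Rightarrow> 'c) \<Rightarrow> 'K \<Rightarrow> 'c" where
  "poly_act s Q \<psi> y = (\<Sum>i\<le>degree Q. coeff Q i * \<psi> (s ^ i * y))"

lemma poly_act_bound: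
  "degree Q \<le> n \<Longrightarrow> poly_act s Q \<psi> y = (\<Sum>i\<le>n. coeff Q i * \<psi> (s ^ i * y))"
  unfolding poly_act_def by (rule sum.mono_neutral_left) (auto simp: coeff_eq_0)

lemma poly_act_pCons: "poly_act s (pCons a Q) \<psi> y = a * \<psi> y + poly_act s Q \<psi> (s * y)"
proof -
  have "poly_act s (pCons a Q) \<psi> y = (\<Sum>i\<le>Suc (degree Q). coeff (pCons a Q) i * \<psi> (s ^ i * y))"
    by (rule poly_act_bound) (simp add: degree_pCons_le)
  also have "\<dots> = a * \<psi> y + (\<Sum>i\<le>degree Q. coeff Q i * \<psi> (s ^ Suc i * y))"
    by (simp add: sum.atMost_Suc_shift del: sum.atMost_Suc power_Suc)
  finally show ?thesis by (simp add: poly_act_def mult_ac)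
qed

lemma poly_act_0: "poly_act s 0 \<psi> y = 0"
  by (simp add: poly_act_def)

lemma poly_act_linear_factor:
  "poly_act s ([:- z, 1:] * R) \<psi> y = poly_act s R \<psi> (s * y) - z * poly_act s R \<psi> y"
proof -
  let ?n = "Suc (degree R)"
  have "[:- z, 1:] * R = pCons 0 R - smult z R" by simp
  moreover have "degree (pCons 0 R - smult z R) \<le> ?n"
    using degree_diff_le[of "pCons 0 R" ?n "smult z R"] degree_pCons_le[of 0 R] degree_smult_le[of z R] by simp
  ultimately have "poly_act s ([:- z, 1:] * R) \<psi> y =
      (\<Sum>i\<le>?n. (coeff (pCons 0 R) i - z * coeff R i) * \<psi> (s ^ i * y))"
    using poly_act_bound[of "pCons 0 R - smult z R" ?n] by simp
  also have "\<dots> = (\<Sum>i\<le>?n. coeff (pCons 0 R) i * \<psi> (s ^ i * y)) - z * (\<Sum>i\<le>?n. coeff R i * \<psi> (s ^ i * y))"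
    by (simp add: left_diff_distrib sum_subtractf sum_distrib_left mult.assoc del: sum.atMost_Suc)
  also have "(\<Sum>i\<le>?n. coeff (pCons 0 R) i * \<psi> (s ^ i * y)) = poly_act s (pCons 0 R) \<psi> y"
    by (rule poly_act_bound[symmetric]) (simp add: degree_pCons_le)
  also have "(\<Sum>i\<le>?n. coeff R i * \<psi> (s ^ i * y)) = poly_act s R \<psi> y"
    by (rule poly_act_bound[symmetric]) simp
  finally show ?thesis by (simp add: poly_act_pCons)
qed

lemma poly_act_eigenvector:
  assumes "\<And>y. \<psi> (s * y) = z * \<psi> y"
  shows "poly_act s Q \<psi> y = poly Q z * \<psi> y"
  by (induction Q arbitrary: y) (simp_all add: poly_act_0 poly_act_pCons assms distrib_right mult.assoc mult.left_commute)

text \<open>The zero function is included, so the components produced below need no check of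
  nonvanishing.\<close>

definition common_eigenvector :: "'K::field set \<Rightarrow> ('K \<Rightarrow> 'c::field) \<Rightarrow> bool" where
  "common_eigenvector S \<psi> \<longleftrightarrow> (\<forall>t\<in>S. \<exists>l. \<forall>y. \<psi> (t * y) = l * \<psi> y)"

lemma poly_act_common_eigenvector:
  assumes "common_eigenvector S \<psi>"
  shows "common_eigenvector S (poly_act s Q \<psi>)"
  unfolding common_eigenvector_def
proof
  fix t assume "t \<in> S"
  then obtain l where l: "\<And>y. \<psi> (t * y) = l * \<psi> y" using assms unfolding common_eigenvector_def by blast
  have "poly_act s Q \<psi> (t * y) = l * poly_act s Q \<psi> y" for y
    unfolding poly_act_def sum_distrib_left
    by (rule sum.cong[OF HOL.refl]) (metis l mult.left_commute)
  then show "\<exists>l. \<forall>y. poly_act s Q \<psi> (t * y) = l * poly_act s Q \<psi> y" by blast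
qed

section \<open>F_q(T)-linear forms as combinations of embeddings\<close>

locale embedded_extension = separable_extension \<iota> + C_infinity emb cabs
  for \<iota> :: "'k::{field,finite} poly fract \<Rightarrow> 'K::field"
    and emb :: "'k fls \<Rightarrow> 'c::field" and cabs :: "'c \<Rightarrow> real" +
  fixes \<alpha>\<^sub>0 :: "'K \<Rightarrow> 'c"
  assumes \<alpha>\<^sub>0: "\<alpha>\<^sub>0 \<in> embeddings emb \<iota>"
begin

abbreviation E where "E \<equiv> embeddings emb \<iota>"

text \<open>The map T -> \<theta> on F_q(T). It is written through the fixed embedding, but every
  embedding restricts to it by \<open>embedding_\<iota>\<close>.\<close>

definition j where "j c = \<alpha>\<^sub>0 (\<iota> c)"

lemma embedding_hom: "\<alpha> \<in> E \<Longrightarrow> unital_ring_hom \<alpha>"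
  by (simp add: embeddings_def)

lemma j_hom: "unital_ring_hom j"
  using unital_ring_hom_simps[OF \<iota>_hom] unital_ring_hom_simps[OF embedding_hom[OF \<alpha>\<^sub>0]]
  unfolding unital_ring_hom_def j_def by simp

lemmas j_simps = unital_ring_hom_simps[OF j_hom]

lemma eval_theta_pCons: "eval_theta emb (pCons a p) = const_C emb a + theta emb * eval_theta emb p"
  and eval_theta_0: "eval_theta emb 0 = 0"
  using unital_ring_hom_zero[OF emb_hom]
  by (simp_all add: eval_theta_def map_poly_pCons const_C_def)

lemma embedding_poly_K: "\<alpha> \<in> E \<Longrightarrow> \<alpha> (P p) = eval_theta emb p"
proof (induction p)
  case 0
  then show ?case by (simp add: poly_K_simps eval_theta_0 unital_ring_hom_zero[OF embedding_hom])
next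
  case (pCons a p)
  then show ?case using unital_ring_hom_simps[OF embedding_hom[OF pCons.prems]]
    by (simp add: poly_K_pCons eval_theta_pCons embeddings_def)
qed

lemma j_poly: "j (Fract p 1) = eval_theta emb p"
  using embedding_poly_K[OF \<alpha>\<^sub>0] by (simp add: j_def poly_K_def)

lemma embedding_\<iota>: "\<alpha> \<in> E \<Longrightarrow> \<alpha> (\<iota> c) = j c"
proof (cases c)
  case (Fract a b)
  assume \<alpha>: "\<alpha> \<in> E"
  show ?thesis unfolding Fract j_def \<iota>_Fract[OF Fract(2)]
    using embedding_poly_K[OF \<alpha>] embedding_poly_K[OF \<alpha>\<^sub>0]
    by (simp add: unital_ring_hom_divide[OF embedding_hom[OF \<alpha>]] unital_ring_hom_divide[OF embedding_hom[OF \<alpha>\<^sub>0]])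
qed

text \<open>Numerator and denominator can be evaluated inside F_q((1/\<theta>)), so the image of
  F_q(T) lies in that of the Laurent series. This qualifies polynomials transported by
  \<open>j\<close> for \<open>alg_closed\<close>.\<close>

lemma algebraic_j: "algebraic_over emb (j c)"
proof (cases c)
  case (Fract a b)
  have "\<exists>x. eval_theta emb p = emb x" for p
  proof (induction p)
    case 0
    then show ?case by (metis eval_theta_0 unital_ring_hom_zero[OF emb_hom])
  next
    case (pCons a p)
    then obtain x where "eval_theta emb p = emb x" by blast
    then have "eval_theta emb (pCons a p) = emb (fls_const a + fls_X_inv * x)"
      by (simp add: eval_theta_pCons const_C_def theta_def unital_ring_hom_simps[OF emb_hom])
    then show ?case by blast
  qed
  then obtain x y where "eval_theta emb a = emb x" "eval_theta emb b = emb y" by metis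
  moreover have "Fract a b = Fract a 1 / Fract b 1" by simp
  ultimately have "j c = emb (x / y)"
    unfolding Fract(1) by (simp only: unital_ring_hom_divide[OF j_hom] unital_ring_hom_divide[OF emb_hom] j_poly)
  then show ?thesis using algebraic_over_hom[OF emb_hom] by simp
qed

definition base_linear :: "('K \<Rightarrow> 'c) \<Rightarrow> bool" where
  "base_linear \<phi> \<longleftrightarrow> (\<forall>x y. \<phi> (x + y) = \<phi> x + \<phi> y) \<and> (\<forall>c x. \<phi> (\<iota> c * x) = j c * \<phi> x)"

lemma poly_act_base_linear:
  assumes "base_linear \<psi>"
  shows "base_linear (poly_act s Q \<psi>)"
  unfolding base_linear_def poly_act_def
proof (intro conjI allI)
  have add: "\<psi> (x + y) = \<psi> x + \<psi> y" and scale: "\<psi> (\<iota> c * x) = j c * \<psi> x" for c x y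
    using assms by (auto simp: base_linear_def)
  show "(\<Sum>i\<le>degree Q. coeff Q i * \<psi> (s ^ i * (x + y))) =
      (\<Sum>i\<le>degree Q. coeff Q i * \<psi> (s ^ i * x)) + (\<Sum>i\<le>degree Q. coeff Q i * \<psi> (s ^ i * y))" for x y
    by (simp add: distrib_left add sum.distrib)
  show "(\<Sum>i\<le>degree Q. coeff Q i * \<psi> (s ^ i * (\<iota> c * x))) =
      j c * (\<Sum>i\<le>degree Q. coeff Q i * \<psi> (s ^ i * x))" for c x
    by (simp add: mult.left_commute[of _ "\<iota> c"] scale sum_distrib_left mult.left_commute[of _ "j c"])
qed

text \<open>When p(s) = 0, this makes the transported polynomial annihilate every F_q(T)-linear
  form, which is the input of the eigenvector decomposition.\<close>

lemma poly_act_annihilator: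
  assumes "base_linear \<psi>"
  shows "poly_act s (map_poly j p) \<psi> y = \<psi> (poly (map_poly \<iota> p) s * y)"
proof (induction p arbitrary: y)
  case 0
  have "\<psi> 0 = 0" using assms unfolding base_linear_def by (metis add_cancel_right_right)
  then show ?case by (simp add: poly_act_0)
next
  case (pCons a p)
  have "\<psi> ((\<iota> a + s * poly (map_poly \<iota> p) s) * y) = \<psi> (\<iota> a * y + poly (map_poly \<iota> p) s * (s * y))"
    by (simp add: algebra_simps)
  also have "\<dots> = j a * \<psi> y + \<psi> (poly (map_poly \<iota> p) s * (s * y))"
    using assms unfolding base_linear_def by simp
  finally show ?case using pCons.IH
    by (simp add: map_poly_pCons j_simps unital_ring_hom_simps[OF \<iota>_hom] poly_act_pCons)
qed

text \<open>
  If \<open>Q = (X - z) R\<close> annihilates \<open>\<psi>\<close> and \<open>R z \<noteq> 0\<close>, then \<open>R \<psi>\<close> is an eigenvector and \<open>R\<close> annihilates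
  \<open>\<psi> - R \<psi> / R z\<close>.
\<close>

lemma eigenvector_decomposition:
  assumes zero: "X (\<lambda>_. 0)" and add: "\<And>\<phi> \<psi>. X \<phi> \<Longrightarrow> X \<psi> \<Longrightarrow> X (\<lambda>y. \<phi> y + \<psi> y)"
    and eig: "\<And>\<psi>. base_linear \<psi> \<Longrightarrow> common_eigenvector (insert s S) \<psi> \<Longrightarrow> X \<psi>"
    and "Q \<noteq> 0" "\<And>i. algebraic_over emb (coeff Q i)" "\<And>z. poly Q z = 0 \<Longrightarrow> poly (pderiv Q) z \<noteq> 0"
    and "base_linear \<psi>" "common_eigenvector S \<psi>" "\<And>y. poly_act s Q \<psi> y = 0"
  shows "X \<psi>"
  using assms(4-)
proof (induction "degree Q" arbitrary: Q \<psi>)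
  case 0
  then obtain c where "Q = [:c:]" "c \<noteq> 0" by (metis degree_eq_zeroE pCons_0_0)
  then have "\<psi> = (\<lambda>_. 0)" using "0.prems"(6) by (auto simp: poly_act_pCons poly_act_0)
  then show ?case using zero by simp
next
  case (Suc n)
  obtain z where z: "algebraic_over emb z" "poly Q z = 0"
    using alg_closed[of Q] Suc.hyps(2) Suc.prems(2) by auto
  then obtain R where R: "Q = [:- z, 1:] * R" by (metis poly_eq_0_iff_dvd dvdE)
  have R0: "R \<noteq> 0" using R Suc.prems(1) by auto
  have dR: "degree R = n" using Suc.hyps(2) R0 unfolding R by (subst (asm) degree_mult_eq) auto
  \<comment> \<open>At w = z this gives R(z) = Q'(z), nonzero because z is a simple root; at a root
    w of R it gives Q'(w) = (w - z) R'(w), so simplicity of the roots passes on to R.\<close>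
  have dQ: "poly (pderiv Q) w = poly R w + (w - z) * poly (pderiv R) w" for w
    unfolding R pderiv_mult by (simp add: pderiv_pCons algebra_simps)
  define c where "c = poly R z"
  have c0: "c \<noteq> 0" using Suc.prems(3)[OF z(2)] unfolding dQ c_def by simp
  define \<psi>1 where "\<psi>1 = poly_act s R \<psi>"
  have eig1: "\<psi>1 (s * y) = z * \<psi>1 y" for y
    using Suc.prems(6)[of y] unfolding R poly_act_linear_factor \<psi>1_def by simp
  define \<psi>2 where "\<psi>2 = (\<lambda>y. \<psi> y - \<psi>1 y / c)"
  have bl1: "base_linear \<psi>1" unfolding \<psi>1_def by (rule poly_act_base_linear[OF Suc.prems(4)])
  have ce1: "common_eigenvector S \<psi>1" unfolding \<psi>1_def by (rule poly_act_common_eigenvector[OF Suc.prems(5)])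
  have "X \<psi>2"
  proof (rule Suc.hyps(1)[OF dR[symmetric] R0])
    show "algebraic_over emb (coeff R i)" for i
      by (rule algebraic_over_quotient_coeffs[OF emb_hom R Suc.prems(2) z(1)])
    show "poly (pderiv R) w \<noteq> 0" if "poly R w = 0" for w
    proof -
      have "poly Q w = 0" using that unfolding R by simp
      then show ?thesis using Suc.prems(3) dQ that by fastforce
    qed
    show "base_linear \<psi>2" using Suc.prems(4) bl1 unfolding base_linear_def \<psi>2_def
      by (simp add: add_divide_distrib right_diff_distrib)
    show "common_eigenvector S \<psi>2" unfolding common_eigenvector_def
    proof
      fix t assume t: "t \<in> S"
      obtain l where l: "\<And>y. \<psi> (t * y) = l * \<psi> y"
        using Suc.prems(5) t unfolding common_eigenvector_def by blast
      \<comment> \<open>Multiplications by s and t commute, so the eigenvalue for t is kept.\<close>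
      have "\<psi>1 (t * y) = l * \<psi>1 y" for y
        unfolding \<psi>1_def poly_act_def sum_distrib_left
        by (rule sum.cong[OF HOL.refl]) (metis l mult.left_commute)
      then have "\<psi>2 (t * y) = l * \<psi>2 y" for y by (simp add: \<psi>2_def l right_diff_distrib)
      then show "\<exists>l. \<forall>y. \<psi>2 (t * y) = l * \<psi>2 y" by blast
    qed
    show "poly_act s R \<psi>2 y = 0" for y
    proof -
      have "poly_act s R \<psi>2 y = poly_act s R \<psi> y - poly_act s R \<psi>1 y / c"
        unfolding poly_act_def \<psi>2_def by (simp add: right_diff_distrib sum_subtractf sum_divide_distrib)
      also have "poly_act s R \<psi>1 y = c * \<psi>1 y" unfolding c_def by (rule poly_act_eigenvector, rule eig1)
      finally show ?thesis using c0 by (simp add: \<psi>1_def)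
    qed
  qed
  moreover have "X (\<lambda>y. \<psi>1 y / c)"
  proof (rule eig)
    show "base_linear (\<lambda>y. \<psi>1 y / c)" using bl1 unfolding base_linear_def by (simp add: add_divide_distrib)
    have "\<exists>l. \<forall>y. \<psi>1 (t * y) / c = l * (\<psi>1 y / c)" if "t \<in> insert s S" for t
      using that eig1 ce1 unfolding common_eigenvector_def by (metis insertE times_divide_eq_right)
    then show "common_eigenvector (insert s S) (\<lambda>y. \<psi>1 y / c)"
      unfolding common_eigenvector_def by blast
  qed
  ultimately have "X (\<lambda>y. \<psi>2 y + \<psi>1 y / c)" by (rule add)
  then show ?case by (simp add: \<psi>2_def)
qed

text \<open>The Bezout relation between \<open>p\<close> and its derivative survives transport along
  \<open>j\<close>, so a root of Q in C is never a root of the derivative.\<close>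

lemma separable_over_C:
  obtains Q where "Q \<noteq> 0" "\<And>i. algebraic_over emb (coeff Q i)" "\<And>z. poly Q z = 0 \<Longrightarrow> poly (pderiv Q) z \<noteq> 0"
    "\<And>\<psi> y. base_linear \<psi> \<Longrightarrow> poly_act s Q \<psi> y = 0" "\<And>\<alpha>. \<alpha> \<in> E \<Longrightarrow> poly Q (\<alpha> s) = 0"
proof -
  obtain p where p: "p \<noteq> 0" "poly (map_poly \<iota> p) s = 0" "coprime p (pderiv p)" by (rule separable_annihilator)
  obtain u v where uv: "u * p + v * pderiv p = 1" using poly_coprime_bezout[OF p(3)] by blast
  define Q where "Q = map_poly j p"
  note map_simps = unital_ring_hom_simps[OF unital_ring_hom_map_poly[OF j_hom]]
  have "map_poly j u * Q + map_poly j v * pderiv Q = 1"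
    using arg_cong[OF uv, of "map_poly j"] by (simp add: map_simps map_poly_pderiv[OF j_hom] Q_def)
  then have bez: "poly (map_poly j u) z * poly Q z + poly (map_poly j v) z * poly (pderiv Q) z = 1" for z
    by (metis poly_1 poly_add poly_mult)
  have sep: "poly (pderiv Q) z \<noteq> 0" if "poly Q z = 0" for z using bez[of z] that by auto
  show ?thesis
  proof (rule that[OF _ _ sep])
    show "Q \<noteq> 0" using p(1) by (simp add: Q_def poly_eq_iff coeff_map_poly j_simps unital_ring_hom_eq_0_iff[OF j_hom])
    show "algebraic_over emb (coeff Q i)" for i
      using algebraic_j by (simp add: Q_def coeff_map_poly j_simps)
    show "poly_act s Q \<psi> y = 0" if "base_linear \<psi>" for \<psi> y
    proof -
      have "\<psi> 0 = 0" using that unfolding base_linear_def by (metis add_cancel_right_right)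
      then show ?thesis unfolding Q_def poly_act_annihilator[OF that] p(2) by simp
    qed
    show "poly Q (\<alpha> s) = 0" if \<alpha>: "\<alpha> \<in> E" for \<alpha>
    proof -
      have "map_poly \<alpha> (map_poly \<iota> p) = Q"
        by (simp add: Q_def poly_eq_iff coeff_map_poly embedding_\<iota>[OF \<alpha>] j_simps
            unital_ring_hom_zero[OF \<iota>_hom] unital_ring_hom_zero[OF embedding_hom[OF \<alpha>]])
      then show ?thesis using unital_ring_hom_poly[OF embedding_hom[OF \<alpha>], of "map_poly \<iota> p" s] p(2)
        by (simp add: unital_ring_hom_zero[OF embedding_hom[OF \<alpha>]])
    qed
  qed
qed

text \<open>Simultaneous diagonalisation of the commuting multiplications: each new s splits an
  eigenvector for S into eigenvectors for \<open>insert s S\<close>. Keeping X abstract lets the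
  resulting sums be absorbed at every stage.\<close>

lemma base_linear_induct:
  assumes S: "finite S" and zero: "X (\<lambda>_. 0)" and add: "\<And>\<phi> \<psi>. X \<phi> \<Longrightarrow> X \<psi> \<Longrightarrow> X (\<lambda>y. \<phi> y + \<psi> y)"
    and eig: "\<And>\<psi>. base_linear \<psi> \<Longrightarrow> common_eigenvector S \<psi> \<Longrightarrow> X \<psi>"
    and \<phi>: "base_linear \<phi>"
  shows "X \<phi>"
  using S eig
proof (induction S)
  case empty
  then show ?case using \<phi> by (simp add: common_eigenvector_def)
next
  case (insert s S)
  show ?case
  proof (rule insert.IH)
    fix \<psi> assume \<psi>: "base_linear \<psi>" "common_eigenvector S \<psi>"
    obtain Q where Q: "Q \<noteq> 0" "\<And>i. algebraic_over emb (coeff Q i)" "\<And>z. poly Q z = 0 \<Longrightarrow> poly (pderiv Q) z \<noteq> 0"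
      "\<And>\<psi> y. base_linear \<psi> \<Longrightarrow> poly_act s Q \<psi> y = 0"
      using separable_over_C[of s] by metis
    show "X \<psi>"
      by (rule eigenvector_decomposition[OF zero add insert.prems Q(1-3) \<psi> Q(4)[OF \<psi>(1)]])
  qed
qed

lemma embedding_eqI:
  assumes "\<alpha> \<in> E" "\<beta> \<in> E" "K.span B = UNIV" "\<And>b. b \<in> B \<Longrightarrow> \<alpha> b = \<beta> b"
  shows "\<alpha> = \<beta>"
proof
  fix x
  have "x \<in> K.span B" using assms(3) by simp
  then show "\<alpha> x = \<beta> x"
  proof (induction rule: K.span_induct_alt)
    case (step c x y)
    then show ?case using assms(4)
      by (simp add: scale_K_def unital_ring_hom_simps[OF embedding_hom[OF assms(1)]]
          unital_ring_hom_simps[OF embedding_hom[OF assms(2)]] embedding_\<iota>[OF assms(1)] embedding_\<iota>[OF assms(2)])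
  qed (simp add: unital_ring_hom_zero[OF embedding_hom] assms)
qed

text \<open>An embedding is determined by its values on a finite spanning set, and each value is a
  root of a fixed nonzero polynomial.\<close>

lemma finite_embeddings: "finite E"
proof -
  obtain B where B: "finite B" "K.span B = UNIV" using K_finite_span by blast
  have "\<exists>Q. Q \<noteq> 0 \<and> (\<forall>\<alpha>\<in>E. poly Q (\<alpha> b) = 0)" for b using separable_over_C[of b] by metis
  then obtain Q where Q: "\<And>b. Q b \<noteq> 0" "\<And>b \<alpha>. \<alpha> \<in> E \<Longrightarrow> poly (Q b) (\<alpha> b) = 0" by metis
  have "(\<lambda>\<alpha>. restrict \<alpha> B) ` E \<subseteq> PiE B (\<lambda>b. {z. poly (Q b) z = 0})" using Q(2) by auto
  moreover have "finite (PiE B (\<lambda>b. {z. poly (Q b) z = 0}))"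
    using B(1) Q(1) by (intro finite_PiE) (auto simp: poly_roots_finite)
  ultimately have "finite ((\<lambda>\<alpha>. restrict \<alpha> B) ` E)" by (rule finite_subset)
  moreover have "inj_on (\<lambda>\<alpha>. restrict \<alpha> B) E"
    by (rule inj_onI) (rule embedding_eqI[OF _ _ B(2)], auto dest: fun_cong simp: restrict_def, metis)
  ultimately show ?thesis by (rule finite_imageD)
qed

text \<open>A common eigenvector for a spanning set is an eigenvector for every element of K. If its
  value at 1 is nonzero, division by that value makes it multiplicative, hence an embedding.\<close>

lemma base_linear_in_span:
  assumes "base_linear \<phi>"
  shows "\<exists>c. \<forall>x. \<phi> x = (\<Sum>\<alpha>\<in>E. c \<alpha> * \<alpha> x)"
proof -
  obtain B where B: "finite B" "K.span B = UNIV" using K_finite_span by blast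
  show ?thesis
  proof (rule base_linear_induct[OF B(1) _ _ _ assms, where X = "\<lambda>\<phi>. \<exists>c. \<forall>x. \<phi> x = (\<Sum>\<alpha>\<in>E. c \<alpha> * \<alpha> x)"])
    show "\<exists>c. \<forall>x. 0 = (\<Sum>\<alpha>\<in>E. c \<alpha> * \<alpha> x)" by (intro exI[of _ "\<lambda>_. 0"]) simp
  next
    fix \<phi> \<psi> :: "'K \<Rightarrow> 'c"
    assume "\<exists>c. \<forall>x. \<phi> x = (\<Sum>\<alpha>\<in>E. c \<alpha> * \<alpha> x)" "\<exists>c. \<forall>x. \<psi> x = (\<Sum>\<alpha>\<in>E. c \<alpha> * \<alpha> x)"
    then obtain c d where "\<And>x. \<phi> x = (\<Sum>\<alpha>\<in>E. c \<alpha> * \<alpha> x)" "\<And>x. \<psi> x = (\<Sum>\<alpha>\<in>E. d \<alpha> * \<alpha> x)" by blast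
    then show "\<exists>c. \<forall>x. \<phi> x + \<psi> x = (\<Sum>\<alpha>\<in>E. c \<alpha> * \<alpha> x)"
      by (intro exI[of _ "\<lambda>\<alpha>. c \<alpha> + d \<alpha>"]) (simp add: distrib_right sum.distrib)
  next
    fix \<psi> assume \<psi>: "base_linear \<psi>" "common_eigenvector B \<psi>"
    have add: "\<psi> (x + y) = \<psi> x + \<psi> y" and scale: "\<psi> (\<iota> c * x) = j c * \<psi> x" for c x y
      using \<psi>(1) by (auto simp: base_linear_def)
    have \<psi>0: "\<psi> 0 = 0" using add[of 0 0] by (metis add_cancel_right_right)
    have eig: "\<exists>l. \<forall>y. \<psi> (x * y) = l * \<psi> y" for x
    proof -
      have "x \<in> K.span B" using B(2) by simp
      then show ?thesis
      proof (induction rule: K.span_induct_alt)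
        case base
        then show ?case by (intro exI[of _ 0]) (simp add: \<psi>0)
      next
        case (step c b x)
        obtain l where l: "\<And>y. \<psi> (b * y) = l * \<psi> y" using \<psi>(2) step(1) unfolding common_eigenvector_def by blast
        obtain k where k: "\<And>y. \<psi> (x * y) = k * \<psi> y" using step(2) by blast
        have "\<psi> ((scale_K \<iota> c b + x) * y) = (j c * l + k) * \<psi> y" for y
        proof -
          have "(scale_K \<iota> c b + x) * y = \<iota> c * (b * y) + x * y" by (simp add: scale_K_def algebra_simps)
          then have "\<psi> ((scale_K \<iota> c b + x) * y) = j c * (l * \<psi> y) + k * \<psi> y"
            by (simp only: add scale l k)
          then show ?thesis by (simp only: distrib_right mult.assoc)
        qed
        then show ?case by blast
      qed
    qed
    have mult: "\<psi> (x * y) * \<psi> 1 = \<psi> x * \<psi> y" for x y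
    proof -
      obtain l where l: "\<And>y. \<psi> (x * y) = l * \<psi> y" using eig by blast
      show ?thesis using l[of 1] l[of y] by simp
    qed
    show "\<exists>c. \<forall>x. \<psi> x = (\<Sum>\<alpha>\<in>E. c \<alpha> * \<alpha> x)"
    proof (cases "\<psi> 1 = 0")
      case True
      \<comment> \<open>With \<psi> 1 = 0 the relation \<open>mult\<close> says that the square of
        \<psi> x vanishes.\<close>
      have "\<psi> x = 0" for x using eig[of x] True mult[of x x] by simp
      then show ?thesis by (intro exI[of _ "\<lambda>_. 0"]) simp
    next
      case False
      define \<alpha> where "\<alpha> = (\<lambda>x. \<psi> x / \<psi> 1)"
      have \<alpha>\<iota>: "\<alpha> (\<iota> c) = j c" for c using scale[of c 1] False by (simp add: \<alpha>_def)
      have "\<alpha> (x * y) = \<alpha> x * \<alpha> y" for x y using mult[of x y] False by (simp add: \<alpha>_def field_simps)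
      then have "unital_ring_hom \<alpha>" unfolding unital_ring_hom_def using False
        by (simp add: \<alpha>_def add add_divide_distrib)
      then have \<alpha>E: "\<alpha> \<in> E"
        using \<alpha>\<^sub>0 \<alpha>\<iota> unfolding embeddings_def const_K_def T_K_def poly_K_def by (simp add: j_def)
      have "\<psi> x = (\<Sum>\<gamma>\<in>E. (if \<gamma> = \<alpha> then \<psi> 1 else 0) * \<gamma> x)" for x
        using \<alpha>E False finite_embeddings by (simp add: if_distrib[of "\<lambda>a. a * _"] \<alpha>_def cong: if_cong)
      then show ?thesis by (intro exI[of _ "\<lambda>\<gamma>. if \<gamma> = \<alpha> then \<psi> 1 else 0"]) simp
    qed
  qed
qed

text \<open>Dedekind's argument: the relation at x y minus \<beta>(y) times the relation at x loses
  \<beta> and multiplies the coefficient of \<alpha> by \<alpha>(y) - \<beta>(y), which is nonzero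
  for a suitable y.\<close>

lemma embeddings_independent:
  assumes "finite S" "S \<subseteq> E" "\<And>x. (\<Sum>\<alpha>\<in>S. c \<alpha> * \<alpha> x) = 0" "\<alpha> \<in> S"
  shows "c \<alpha> = 0"
  using assms
proof (induction S arbitrary: c \<alpha>)
  case (insert \<beta> S)
  have \<beta>E: "\<beta> \<in> E" using insert.prems by simp
  have hom: "\<alpha> (x * y) = \<alpha> x * \<alpha> y" if "\<alpha> \<in> E" for \<alpha> x y
    using unital_ring_hom_mult[OF embedding_hom[OF that]] .
  have S0: "c \<alpha> = 0" if \<alpha>: "\<alpha> \<in> S" for \<alpha>
  proof -
    obtain y where y: "\<alpha> y \<noteq> \<beta> y" using insert.hyps \<alpha> by (metis ext)
    have "(\<Sum>\<alpha>\<in>S. c \<alpha> * (\<alpha> y - \<beta> y) * \<alpha> x) = 0" for x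
    proof -
      have "(\<Sum>\<alpha>\<in>S. c \<alpha> * (\<alpha> y - \<beta> y) * \<alpha> x) = (\<Sum>\<alpha>\<in>insert \<beta> S. c \<alpha> * (\<alpha> y - \<beta> y) * \<alpha> x)"
        using insert.hyps by simp
      also have "\<dots> = (\<Sum>\<alpha>\<in>insert \<beta> S. c \<alpha> * \<alpha> (x * y) - \<beta> y * (c \<alpha> * \<alpha> x))"
        by (rule sum.cong[OF HOL.refl]) (use insert.prems(1) hom in \<open>auto simp: algebra_simps\<close>)
      also have "\<dots> = (\<Sum>\<alpha>\<in>insert \<beta> S. c \<alpha> * \<alpha> (x * y)) - \<beta> y * (\<Sum>\<alpha>\<in>insert \<beta> S. c \<alpha> * \<alpha> x)"
        unfolding sum_subtractf sum_distrib_left ..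
      finally show ?thesis unfolding insert.prems(2) by simp
    qed
    then have "c \<alpha> * (\<alpha> y - \<beta> y) = 0"
      using insert.IH[of "\<lambda>\<alpha>. c \<alpha> * (\<alpha> y - \<beta> y)" \<alpha>] insert.prems(1) \<alpha> by simp
    then show ?thesis using y by simp
  qed
  have "c \<beta> * \<beta> 1 = 0" using insert.prems(2)[of 1] insert.hyps S0 by simp
  then have "c \<beta> = 0" using unital_ring_hom_one[OF embedding_hom[OF \<beta>E]] by simp
  then show ?case using S0 insert.prems(3) by blast
qed simp

end

section \<open>The trace form\<close>

context embedded_extension
begin

context
  fixes B assumes B: "\<not> K.dependent B" "K.span B = UNIV"
begin

lemma K_sum_representation: "(\<Sum>b\<in>B. \<iota> (K.representation B x b) * b) = x"
  using K.sum_representation_eq[OF B(1) _ K_finite_basis[OF B(1)], of x] B(2) by (simp add: scale_K_def)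

lemma embedding_representation:
  assumes "\<alpha> \<in> E"
  shows "\<alpha> x = (\<Sum>b\<in>B. j (K.representation B x b) * \<alpha> b)"
proof -
  have "\<alpha> x = \<alpha> (\<Sum>b\<in>B. \<iota> (K.representation B x b) * b)" by (simp only: K_sum_representation)
  then show ?thesis using embedding_\<iota>[OF assms]
    by (simp add: unital_ring_hom_simps[OF embedding_hom[OF assms]])
qed

lemma base_linear_coordinate: "base_linear (\<lambda>x. j (K.representation B x b))"
  unfolding base_linear_def
  using K.representation_add[OF B(1)] K.representation_scale[OF B(1)] B(2)
  by (simp add: j_simps scale_K_def)

text \<open>
  The coordinate functionals are combinations of the embeddings, with a coefficient matrix inverse to
  \<open>(\<alpha> b)\<close> by independence of the embeddings.
\<close>

lemma sum_embeddings_eq_trace_basis: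
  "j (\<Sum>b\<in>B. K.representation B (x * b) b) = (\<Sum>\<alpha>\<in>E. \<alpha> x)"
proof -
  have "\<forall>b. \<exists>c. \<forall>x. j (K.representation B x b) = (\<Sum>\<alpha>\<in>E. c \<alpha> * \<alpha> x)"
    using base_linear_in_span[OF base_linear_coordinate] by blast
  then obtain c where c: "\<And>b x. j (K.representation B x b) = (\<Sum>\<alpha>\<in>E. c b \<alpha> * \<alpha> x)" by metis
  have diag: "(\<Sum>b\<in>B. c b \<beta> * \<beta> b) = 1" if \<beta>: "\<beta> \<in> E" for \<beta>
  proof -
    \<comment> \<open>The coefficient of \<alpha> in the expansion of \<beta>, minus its expected
      value; the case \<alpha> = \<beta> is the one extracted.\<close>
    let ?d = "\<lambda>\<alpha>. (\<Sum>b\<in>B. c b \<alpha> * \<beta> b) - (if \<alpha> = \<beta> then 1 else 0)"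
    have "(\<Sum>\<alpha>\<in>E. ?d \<alpha> * \<alpha> x) = 0" for x
    proof -
      have "\<beta> x = (\<Sum>b\<in>B. \<Sum>\<alpha>\<in>E. c b \<alpha> * \<beta> b * \<alpha> x)"
        unfolding embedding_representation[OF \<beta>, of x] c sum_distrib_right
        by (intro sum.cong HOL.refl) (simp only: mult_ac)
      also have "\<dots> = (\<Sum>\<alpha>\<in>E. (\<Sum>b\<in>B. c b \<alpha> * \<beta> b) * \<alpha> x)"
        by (subst sum.swap) (simp add: sum_distrib_right)
      finally have "(\<Sum>\<alpha>\<in>E. (\<Sum>b\<in>B. c b \<alpha> * \<beta> b) * \<alpha> x) = \<beta> x" by simp
      moreover have "(\<Sum>\<alpha>\<in>E. (if \<alpha> = \<beta> then 1 else 0) * \<alpha> x) = \<beta> x"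
        using \<beta> finite_embeddings by (simp add: if_distrib[of "\<lambda>a. a * _"] cong: if_cong)
      ultimately show ?thesis by (simp only: left_diff_distrib sum_subtractf diff_self)
    qed
    from embeddings_independent[OF finite_embeddings order.refl this \<beta>] show ?thesis by simp
  qed
  have "j (\<Sum>b\<in>B. K.representation B (x * b) b) = (\<Sum>b\<in>B. \<Sum>\<alpha>\<in>E. c b \<alpha> * \<alpha> (x * b))"
    by (simp add: j_simps c)
  also have "\<dots> = (\<Sum>b\<in>B. \<Sum>\<alpha>\<in>E. \<alpha> x * (c b \<alpha> * \<alpha> b))"
    by (intro sum.cong HOL.refl) (simp add: unital_ring_hom_mult[OF embedding_hom] mult_ac)
  also have "\<dots> = (\<Sum>\<alpha>\<in>E. \<alpha> x * (\<Sum>b\<in>B. c b \<alpha> * \<alpha> b))"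
    by (subst sum.swap) (simp add: sum_distrib_left)
  also have "\<dots> = (\<Sum>\<alpha>\<in>E. \<alpha> x)" by (simp add: diag)
  finally show ?thesis .
qed

end

text \<open>The preceding formula holds for every basis, in particular for the one picked by
  \<open>SOME\<close> in \<open>trace_K\<close>. Linearity of the trace then follows from the
  embeddings, as \<open>j\<close> is injective.\<close>

lemma j_trace: "j (trace_K \<iota> x) = (\<Sum>\<alpha>\<in>E. \<alpha> x)"
proof -
  have "\<exists>B. \<not> K.dependent B \<and> K.span B = UNIV" using K_basis_exists by blast
  from someI_ex[OF this] show ?thesis
    unfolding trace_K_def Let_def by (intro sum_embeddings_eq_trace_basis) auto
qed

lemma trace_add: "trace_K \<iota> (x + y) = trace_K \<iota> x + trace_K \<iota> y"
proof -
  have "j (trace_K \<iota> (x + y)) = j (trace_K \<iota> x + trace_K \<iota> y)"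
    by (simp add: j_trace j_simps unital_ring_hom_add[OF embedding_hom] sum.distrib)
  then show ?thesis by (simp only: unital_ring_hom_eq_iff[OF j_hom])
qed

lemma trace_scale: "trace_K \<iota> (\<iota> c * x) = c * trace_K \<iota> x"
proof -
  have "j (trace_K \<iota> (\<iota> c * x)) = j (c * trace_K \<iota> x)"
    by (simp add: j_trace j_simps unital_ring_hom_mult[OF embedding_hom] embedding_\<iota> sum_distrib_left)
  then show ?thesis by (simp only: unital_ring_hom_eq_iff[OF j_hom])
qed

lemma trace_sum: "trace_K \<iota> (\<Sum>s\<in>S. g s) = (\<Sum>s\<in>S. trace_K \<iota> (g s))"
proof (induction S rule: infinite_finite_induct)
  case (insert s S)
  then show ?case by (simp add: trace_add)
qed (use trace_scale[of 0 0] in \<open>simp_all add: unital_ring_hom_zero[OF \<iota>_hom]\<close>)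

text \<open>If y is orthogonal to all of K, the numbers \<alpha>(y) are the coefficients of a
  vanishing combination of the embeddings.\<close>

lemma trace_nondegenerate:
  assumes "\<And>x. trace_K \<iota> (y * x) = 0"
  shows "y = 0"
proof -
  have "(\<Sum>\<alpha>\<in>E. \<alpha> y * \<alpha> x) = 0" for x
    using j_trace[of "y * x"] by (simp add: assms j_simps unital_ring_hom_mult[OF embedding_hom])
  from embeddings_independent[OF finite_embeddings order.refl this \<alpha>\<^sub>0]
  show ?thesis by (simp add: unital_ring_hom_eq_0_iff[OF embedding_hom[OF \<alpha>\<^sub>0]])
qed

lemma trace_nondegenerate_basis:
  assumes B: "K.span B = UNIV" and tr: "\<And>b. b \<in> B \<Longrightarrow> trace_K \<iota> (y * b) = 0"
  shows "y = 0"
proof (rule trace_nondegenerate)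
  fix x
  have "x \<in> K.span B" using B by simp
  then show "trace_K \<iota> (y * x) = 0"
  proof (induction rule: K.span_induct_alt)
    case base
    then show ?case using trace_scale[of 0 0] by (simp add: unital_ring_hom_zero[OF \<iota>_hom])
  next
    case (step c b x)
    have "y * (scale_K \<iota> c b + x) = \<iota> c * (y * b) + y * x" by (simp add: scale_K_def algebra_simps)
    then show ?case using step tr by (simp add: trace_add trace_scale)
  qed
qed

text \<open>The endomorphism \<open>T\<close> records the traces against B as coordinates in B;
  nondegeneracy makes it injective, and finite dimension makes it surjective.\<close>

lemma trace_dual_element:
  assumes B: "\<not> K.dependent B" "K.span B = UNIV"
  shows "\<exists>y. \<forall>b\<in>B. trace_K \<iota> (y * b) = \<phi> b"
proof -
  note fin = K_finite_basis[OF B(1)]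
  interpret K: finite_dimensional_vector_space "scale_K \<iota>" B
    by unfold_locales (use B fin in auto)
  define T where "T = (\<lambda>y. \<Sum>b\<in>B. scale_K \<iota> (trace_K \<iota> (y * b)) b)"
  have coeff: "u b = v b" if "(\<Sum>b\<in>B. scale_K \<iota> (u b) b) = (\<Sum>b\<in>B. scale_K \<iota> (v b) b)" "b \<in> B" for u v b
  proof -
    have "(\<Sum>b\<in>B. scale_K \<iota> (u b - v b) b) = 0"
      using that(1) by (simp add: K.scale_left_diff_distrib sum_subtractf)
    then have "u b - v b = 0" by (rule K.independentD[OF B(1) fin order.refl _ that(2)])
    then show ?thesis by simp
  qed
  have "Vector_Spaces.linear (scale_K \<iota>) (scale_K \<iota>) T"
    unfolding Vector_Spaces.linear_iff
  proof (intro conjI allI K.vector_space_axioms)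
    show "T (x + y) = T x + T y" for x y
      by (simp add: T_def distrib_right trace_add K.scale_left_distrib sum.distrib)
    have "trace_K \<iota> (scale_K \<iota> c x * b) = c * trace_K \<iota> (x * b)" for c x b
      unfolding scale_K_def mult.assoc by (rule trace_scale)
    then show "T (scale_K \<iota> c x) = scale_K \<iota> c (T x)" for c x
      by (simp add: T_def K.scale_sum_right)
  qed
  moreover have "inj T"
  proof (rule injI)
    fix x y assume eq: "T x = T y"
    have "trace_K \<iota> ((x - y) * b) = 0" if "b \<in> B" for b
    proof -
      have "trace_K \<iota> (x * b) = trace_K \<iota> (y * b)" using coeff[OF eq[unfolded T_def] that] .
      moreover have "trace_K \<iota> (x * b) = trace_K \<iota> ((x - y) * b) + trace_K \<iota> (y * b)"
        by (simp flip: trace_add add: left_diff_distrib)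
      ultimately show ?thesis by simp
    qed
    then have "x - y = 0" by (rule trace_nondegenerate_basis[OF B(2)])
    then show "x = y" by simp
  qed
  ultimately have "surj T" by (rule K.linear_inj_imp_surj)
  then obtain y where "T y = (\<Sum>b\<in>B. scale_K \<iota> (\<phi> b) b)" by (metis surjD)
  from coeff[OF this[unfolded T_def]] show ?thesis by blast
qed

text \<open>The embeddings are independent and lie in the span of the coordinate forms of a basis.
  This bound closes the dimension count for the dual space.\<close>

lemma card_embeddings_le: "card E \<le> degree_K \<iota>"
proof -
  interpret V: vector_space "\<lambda>(c::'c) (f::'K \<Rightarrow> 'c) x. c * f x"
    by unfold_locales (simp_all add: fun_eq_iff algebra_simps)
  have sum_apply: "(\<Sum>s\<in>S. g s) x = (\<Sum>s\<in>S. g s x)" for g :: "'i \<Rightarrow> 'K \<Rightarrow> 'c" and S x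
    by (induction S rule: infinite_finite_induct) simp_all
  obtain B where B: "finite B" "\<not> K.dependent B" "K.span B = UNIV" using K_basis_exists by blast
  have "\<not> V.dependent E"
  proof
    assume "V.dependent E"
    then obtain u where u: "\<exists>\<alpha>\<in>E. u \<alpha> \<noteq> 0" "(\<Sum>\<alpha>\<in>E. (\<lambda>x. u \<alpha> * \<alpha> x)) = 0"
      unfolding V.dependent_finite[OF finite_embeddings] by blast
    have "(\<Sum>\<alpha>\<in>E. u \<alpha> * \<alpha> x) = 0" for x using fun_cong[OF u(2), of x] by (simp add: sum_apply)
    then show False using embeddings_independent[OF finite_embeddings order.refl] u(1) by blast
  qed
  moreover have "E \<subseteq> V.span ((\<lambda>b x. j (K.representation B x b)) ` B)"
  proof
    fix \<alpha> assume \<alpha>: "\<alpha> \<in> E"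
    have "\<alpha> = (\<Sum>b\<in>B. (\<lambda>x. \<alpha> b * j (K.representation B x b)))"
    proof
      fix x
      show "\<alpha> x = (\<Sum>b\<in>B. (\<lambda>x. \<alpha> b * j (K.representation B x b))) x"
        unfolding sum_apply by (subst embedding_representation[OF B(2,3) \<alpha>]) (simp only: mult.commute)
    qed
    also have "\<dots> \<in> V.span ((\<lambda>b x. j (K.representation B x b)) ` B)"
      by (intro V.span_sum V.span_scale V.span_base imageI)
    finally show "\<alpha> \<in> V.span ((\<lambda>b x. j (K.representation B x b)) ` B)" .
  qed
  ultimately have "card E \<le> card ((\<lambda>b x. j (K.representation B x b)) ` B)"
    using V.independent_span_bound[OF finite_imageI[OF B(1)]] by blast
  also have "\<dots> \<le> card B" by (rule card_image_le[OF B(1)])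
  finally show ?thesis using degree_K_eq_card[OF B(2,3)] by simp
qed

end

section \<open>The lattice as an ideal\<close>

context embedded_extension
begin

lemma eval_theta_hom: "unital_ring_hom (eval_theta emb)"
  using poly_K_simps(1-3) unital_ring_hom_simps(1-3)[OF embedding_hom[OF \<alpha>\<^sub>0]]
  unfolding unital_ring_hom_def embedding_poly_K[OF \<alpha>\<^sub>0, symmetric] by simp

lemmas eval_theta_simps = unital_ring_hom_simps[OF eval_theta_hom]

lemma eval_theta_eq_0_iff: "eval_theta emb p = 0 \<longleftrightarrow> p = 0"
  unfolding embedding_poly_K[OF \<alpha>\<^sub>0, symmetric]
  by (simp add: unital_ring_hom_eq_0_iff[OF embedding_hom[OF \<alpha>\<^sub>0]] poly_K_eq_0_iff)

lemma module_poly_scale: "module (poly_scale emb)"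
  by unfold_locales (simp_all add: poly_scale_def eval_theta_simps algebra_simps)

lemma vector_space_base: "vector_space (\<lambda>c (v::'c ^ 'n). j c *s v)"
  by unfold_locales (simp_all add: j_simps algebra_simps)

end

locale cm_lattice = embedded_extension \<iota> emb cabs \<alpha>\<^sub>0
  for \<iota> :: "'k::{field,finite} poly fract \<Rightarrow> 'K::field"
    and emb :: "'k fls \<Rightarrow> 'c::field" and cabs \<alpha>\<^sub>0 +
  fixes L :: "('c ^ 'n) set" and m M :: "'K \<Rightarrow> 'c ^ 'n \<Rightarrow> 'c ^ 'n"
  assumes lattice: "lattice_of_rank emb (degree_K \<iota>) L"
    and m_L: "a \<in> A \<Longrightarrow> l \<in> L \<Longrightarrow> m a l \<in> L"
    and m_poly: "m (P p) v = poly_scale emb p v"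
    and M_m: "a \<in> A \<Longrightarrow> M a = m a"
    and M_linear: "Vector_Spaces.linear (*s) (*s) (M x)"
    and M_one: "M 1 = id"
    and M_add: "M (x + y) v = M x v + M y v"
    and M_mult: "M (x * y) = M x \<circ> M y"
begin

sublocale L: module "poly_scale emb :: 'k poly \<Rightarrow> 'c ^ 'n \<Rightarrow> 'c ^ 'n"
  by (rule module_poly_scale)

sublocale VF: vector_space "\<lambda>c (v::'c ^ 'n). j c *s v"
  by (rule vector_space_base)

lemma M_zero: "M x 0 = 0"
  and M_scale: "M x (c *s v) = c *s M x v"
  and M_add_right: "M x (v + w) = M x v + M x w"
proof -
  have lin: "M x (v + w) = M x v + M x w" "M x (c *s v) = c *s M x v" for c v w
    using M_linear[of x] unfolding Vector_Spaces.linear_iff by simp_all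
  then show "M x (c *s v) = c *s M x v" "M x (v + w) = M x v + M x w" by simp_all
  show "M x 0 = 0" using lin(2)[of 0 0] by simp
qed

lemma M_poly_K: "M (P p) v = eval_theta emb p *s v"
  using M_m[OF A_poly_K] m_poly by (simp add: poly_scale_def)

lemma M_\<iota>: "M (\<iota> c) v = j c *s v"
proof (cases c)
  case (Fract a b)
  have b0: "eval_theta emb b \<noteq> 0" using Fract(2) by (simp add: eval_theta_eq_0_iff)
  have "P b * \<iota> c = P a" unfolding Fract(1) \<iota>_Fract[OF Fract(2)] using Fract(2) by (simp add: poly_K_eq_0_iff)
  then have "M (P b) (M (\<iota> c) v) = M (P a) v" using M_mult[of "P b" "\<iota> c"] by (simp only: comp_apply)
  then have eq: "eval_theta emb b *s M (\<iota> c) v = eval_theta emb a *s v" by (simp add: M_poly_K)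
  have "M (\<iota> c) v = inverse (eval_theta emb b) *s (eval_theta emb b *s M (\<iota> c) v)" using b0 by simp
  also have "\<dots> = (eval_theta emb a / eval_theta emb b) *s v" unfolding eq by (simp add: divide_inverse mult.commute)
  also have "eval_theta emb a / eval_theta emb b = j c"
    unfolding Fract(1) using unital_ring_hom_divide[OF j_hom, of "Fract a 1" "Fract b 1"] by (simp add: j_poly)
  finally show ?thesis .
qed

definition B where
  "B = (SOME B. finite B \<and> card B = degree_K \<iota> \<and> L.independent B \<and> L = L.span B)"

lemma B: "finite B" "card B = degree_K \<iota>" "L.independent B" "L = L.span B"
proof -
  have "\<exists>B. finite B \<and> card B = degree_K \<iota> \<and> L.independent B \<and> L = L.span B"
    using lattice unfolding lattice_of_rank_def by blast
  from someI_ex[OF this] show "finite B" "card B = degree_K \<iota>" "L.independent B" "L = L.span B"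
    unfolding B_def by auto
qed

lemma L_add: "l \<in> L \<Longrightarrow> l' \<in> L \<Longrightarrow> l + l' \<in> L"
  and L_scale: "l \<in> L \<Longrightarrow> poly_scale emb p l \<in> L"
  and L_zero: "0 \<in> L"
  and B_L: "b \<in> B \<Longrightarrow> b \<in> L"
  using B(4) L.span_add[of l B l'] L.span_scale[of l B p] L.span_zero[of B] L.span_base[of b B] by simp_all

lemma L_span_UNIV: "vec.span L = UNIV"
  using lattice unfolding lattice_of_rank_def by blast

definition coord :: "'c ^ 'n \<Rightarrow> 'c ^ 'n \<Rightarrow> 'k poly" where
  "coord l b = L.representation B l b"

lemma sum_coord: "l \<in> L \<Longrightarrow> l = (\<Sum>b\<in>B. poly_scale emb (coord l b) b)"
  unfolding coord_def using L.sum_representation_eq[OF B(3) _ B(1) order.refl, of l] B(4) by simp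

lemma coord_add: "l \<in> L \<Longrightarrow> l' \<in> L \<Longrightarrow> coord (l + l') b = coord l b + coord l' b"
  and coord_scale: "l \<in> L \<Longrightarrow> coord (poly_scale emb p l) b = p * coord l b"
  unfolding coord_def
  using L.representation_add[OF B(3), of l' l] L.representation_scale[OF B(3), of l p] B(4) by simp_all

lemma L_nonzero: "\<exists>l\<in>L. l \<noteq> 0"
proof (rule ccontr)
  assume "\<not> (\<exists>l\<in>L. l \<noteq> 0)"
  then have "L \<subseteq> {0}" by blast
  then have "vec.span L \<subseteq> vec.span {0}" by (rule vec.span_mono)
  then have "(UNIV :: ('c ^ 'n) set) \<subseteq> {0}" unfolding L_span_UNIV by simp
  then have "(1 :: 'c ^ 'n) = 0" by blast
  then show False by simp
qed

definition l0 where "l0 = (SOME l. l \<in> L \<and> l \<noteq> 0)"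

lemma l0: "l0 \<in> L" "l0 \<noteq> 0"
proof -
  have "\<exists>l. l \<in> L \<and> l \<noteq> 0" using L_nonzero by blast
  from someI_ex[OF this] show "l0 \<in> L" "l0 \<noteq> 0" unfolding l0_def by auto
qed

definition ev :: "'K \<Rightarrow> 'c ^ 'n" where "ev x = M x l0"

lemma ev_add: "ev (x + y) = ev x + ev y"
  by (simp add: ev_def M_add)

lemma ev_mult: "ev (x * y) = M x (ev y)"
  by (simp add: ev_def M_mult)

lemma ev_\<iota>: "ev (\<iota> c * x) = j c *s ev x"
  by (simp add: ev_mult M_\<iota>)

lemma ev_eq_0: "ev x = 0 \<Longrightarrow> x = 0"
proof (rule ccontr)
  assume "ev x = 0" "x \<noteq> 0"
  then have "M (inverse x * x) l0 = 0" using ev_mult[of "inverse x" x] by (simp only: ev_def M_zero)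
  then show False using l0 \<open>x \<noteq> 0\<close> by (simp add: M_one)
qed

lemma ev_zero: "ev 0 = 0"
  using ev_add[of 0 0] by (metis add_cancel_right_right)

lemma inj_ev: "inj ev"
proof (rule injI)
  fix x y assume "ev x = ev y"
  moreover have "ev x = ev (x - y) + ev y" by (simp flip: ev_add)
  ultimately have "x - y = 0" by (intro ev_eq_0) simp
  then show "x = y" by simp
qed

lemma L_subset_VF: "L \<subseteq> VF.span B"
proof
  fix l assume "l \<in> L"
  then have "l = (\<Sum>b\<in>B. j (Fract (coord l b) 1) *s b)"
    using sum_coord by (simp add: poly_scale_def j_poly)
  also have "\<dots> \<in> VF.span B" by (intro VF.span_sum VF.span_scale VF.span_base)
  finally show "l \<in> VF.span B" .
qed

text \<open>A denominator d in F_q[T] brings x into A, whose action preserves L; dividing by d again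
  stays in the F_q(T)-span.\<close>

lemma ev_in_span: "ev x \<in> VF.span B"
proof -
  obtain d where d: "d \<noteq> 0" "P d * x \<in> A" using denominator by blast
  have "P d \<noteq> 0" using d by (simp add: poly_K_eq_0_iff)
  then have "\<iota> (inverse (Fract d 1)) * (P d * x) = x"
    by (simp add: unital_ring_hom_inverse[OF \<iota>_hom] poly_K_def del: inverse_fract)
  then have "ev x = j (inverse (Fract d 1)) *s ev (P d * x)" using ev_\<iota>[of "inverse (Fract d 1)" "P d * x"] by (simp only:)
  moreover have "ev (P d * x) \<in> L" unfolding ev_def using M_m[OF d(2)] m_L[OF d(2) l0(1)] by simp
  then have "j (inverse (Fract d 1)) *s ev (P d * x) \<in> VF.span B"
    using L_subset_VF by (intro VF.span_scale) blast
  ultimately show ?thesis by (simp only:)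
qed

text \<open>Both \<open>\<KK> l0\<close> and the \<open>F\<^sub>q(T)\<close>-span of \<open>L\<close> have dimension \<open>r\<close>, so they coincide.\<close>

lemma span_subset_range_ev: "VF.span B \<subseteq> range ev"
proof -
  obtain C where C: "finite C" "\<not> K.dependent C" "K.span C = UNIV" using K_basis_exists by blast
  interpret pair: vector_space_pair "scale_K \<iota>" "\<lambda>c (v::'c ^ 'n). j c *s v" ..
  have lin: "Vector_Spaces.linear (scale_K \<iota>) (\<lambda>c v. j c *s v) ev"
    unfolding Vector_Spaces.linear_iff
    by (intro conjI allI K.vector_space_axioms VF.vector_space_axioms ev_add)
      (simp add: scale_K_def ev_\<iota>)
  have indep: "\<not> VF.dependent (ev ` C)"
    using pair.linear_independent_injective_image[OF lin C(2)] inj_ev by (simp add: inj_on_subset)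
  have card: "card (ev ` C) = card B"
    using card_image[OF inj_on_subset[OF inj_ev subset_UNIV], of C] degree_K_eq_card[OF C(2,3)] B(2) by simp
  have "B \<subseteq> VF.span (ev ` C)"
  \<comment> \<open>Otherwise the r independent vectors in the image of C could be enlarged to r + 1
    independent vectors inside the span of the r-element set B.\<close>
  proof (rule subsetI, rule ccontr)
    fix b assume b: "b \<in> B" "b \<notin> VF.span (ev ` C)"
    then have "\<not> VF.dependent (insert b (ev ` C))" using indep by (simp add: VF.independent_insertI)
    moreover have "insert b (ev ` C) \<subseteq> VF.span B" using b(1) ev_in_span VF.span_base by blast
    ultimately have "card (insert b (ev ` C)) \<le> card B" using VF.independent_span_bound[OF B(1)] by blast
    moreover have "b \<notin> ev ` C" using b(2) VF.span_base by blast
    ultimately show False using C(1) card by simp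
  qed
  then have "VF.span B \<subseteq> VF.span (ev ` C)" by (rule VF.span_minimal) (rule VF.subspace_span)
  also have "\<dots> \<subseteq> range ev"
  proof (rule VF.span_minimal)
    show "VF.subspace (range ev)" unfolding VF.subspace_def
    proof (intro conjI ballI allI)
      show "0 \<in> range ev" using ev_zero by (rule range_eqI[OF HOL.sym])
    next
      fix x y assume "x \<in> range ev" "y \<in> range ev"
      then show "x + y \<in> range ev" by (auto simp flip: ev_add)
    next
      fix c x assume "x \<in> range ev"
      then show "j c *s x \<in> range ev" by (auto simp flip: ev_\<iota>)
    qed
  qed blast
  finally show ?thesis .
qed

text \<open>The coordinate in K of a vector relative to \<open>l0\<close>. It is meaningful only on
  the range of \<open>ev\<close>, which contains L.\<close>

definition f :: "'c ^ 'n \<Rightarrow> 'K" where "f = inv_into UNIV ev"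

lemma f_ev: "f (ev x) = x"
  unfolding f_def by (rule inv_f_f[OF inj_ev])

lemma ev_f: "l \<in> L \<Longrightarrow> ev (f l) = l"
  unfolding f_def using L_subset_VF span_subset_range_ev by (meson f_inv_into_f subset_iff)

lemma f_add: "l \<in> L \<Longrightarrow> l' \<in> L \<Longrightarrow> f (l + l') = f l + f l'"
  using f_ev[of "f l + f l'"] by (simp add: ev_add ev_f)

lemma f_act: "a \<in> A \<Longrightarrow> l \<in> L \<Longrightarrow> f (m a l) = a * f l"
  using f_ev[of "a * f l"] by (simp add: ev_mult ev_f M_m)

lemma f_scale: "l \<in> L \<Longrightarrow> f (poly_scale emb p l) = P p * f l"
  using f_act[OF A_poly_K] by (simp add: m_poly)

lemma f_zero: "f 0 = 0"
  using f_ev[of 0] by (simp add: ev_zero)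

lemma inj_f: "inj_on f L"
  by (rule inj_onI) (metis ev_f)

lemma f_sum: "(\<And>b. b \<in> S \<Longrightarrow> x b \<in> L) \<Longrightarrow>
    (\<Sum>b\<in>S. poly_scale emb (c b) (x b)) \<in> L \<and> f (\<Sum>b\<in>S. poly_scale emb (c b) (x b)) = (\<Sum>b\<in>S. P (c b) * f (x b))"
  by (induction S rule: infinite_finite_induct) (simp_all add: L_zero f_zero L_add L_scale f_add f_scale)

lemma f_eq_sum: "l \<in> L \<Longrightarrow> f l = (\<Sum>b\<in>B. P (coord l b) * f b)"
  using f_sum[of B id "coord l"] sum_coord[of l] B_L by simp

text \<open>Pulling expansions in B back along the injective \<open>ev\<close> shows that the images
  of B span K; a spanning set of at most r = dim K elements is independent.\<close>

lemma fB_basis: "\<not> K.dependent (f ` B)" "K.span (f ` B) = UNIV"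
proof -
  have span: "x \<in> K.span (f ` B)" for x
  proof -
    obtain u where "ev x = (\<Sum>b\<in>B. j (u b) *s b)"
      using ev_in_span[of x] unfolding VF.span_finite[OF B(1)] by blast
    also have "\<dots> = ev (\<Sum>b\<in>B. \<iota> (u b) * f b)"
    proof -
      have "ev (\<Sum>b\<in>S. \<iota> (u b) * f b) = (\<Sum>b\<in>S. j (u b) *s b)" if "S \<subseteq> B" for S
        using that B_L by (induction S rule: infinite_finite_induct) (simp_all add: ev_zero ev_add ev_\<iota> ev_f)
      then show ?thesis by simp
    qed
    finally have "x = (\<Sum>b\<in>B. scale_K \<iota> (u b) (f b))" using inj_ev by (simp add: scale_K_def inj_eq)
    also have "\<dots> \<in> K.span (f ` B)" by (intro K.span_sum K.span_scale K.span_base imageI)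
    finally show ?thesis .
  qed
  then show "K.span (f ` B) = UNIV" by blast
  obtain C where C: "finite C" "\<not> K.dependent C" "K.span C = UNIV" using K_basis_exists by blast
  interpret K: finite_dimensional_vector_space "scale_K \<iota>" C
    by unfold_locales (use C in auto)
  have "card (f ` B) \<le> K.dim UNIV"
    using card_image_le[OF B(1), of f] B(2) by (simp add: degree_K_def)
  then show "\<not> K.dependent (f ` B)"
    using K.card_le_dim_spanning[of "f ` B" UNIV] span B(1) by blast
qed

definition J where "J = f ` L"

lemma submodule_J: "submodule_of A J"
  unfolding submodule_of_def J_def
proof (intro conjI ballI)
  show "0 \<in> f ` L" using L_zero f_zero by (intro image_eqI[of _ _ 0]) simp_all
next
  fix x y assume "x \<in> f ` L" "y \<in> f ` L"
  then obtain l l' where "l \<in> L" "l' \<in> L" "x = f l" "y = f l'" by blast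
  then show "x + y \<in> f ` L" using L_add by (intro image_eqI[of _ _ "l + l'"]) (simp_all add: f_add)
next
  fix a x assume "a \<in> A" "x \<in> f ` L"
  then obtain l where "l \<in> L" "x = f l" by blast
  then show "a * x \<in> f ` L" using m_L \<open>a \<in> A\<close> by (intro image_eqI[of _ _ "m a l"]) (simp_all add: f_act)
qed

text \<open>The F_q[T]-basis of L goes to generators of J over F_q[T], a fortiori over A.\<close>

lemma J_invertible: "ideal_mult J (ideal_inverse A J) = A"
proof (rule finitely_generated_invertible[of "f ` B"])
  show "finite (f ` B)" using B(1) by simp
  show "f ` B \<subseteq> J" using B_L by (auto simp: J_def)
  have injB: "inj_on f B" using inj_f B_L by (meson inj_on_subset subsetI)
  show gen: "\<exists>a. (\<forall>s\<in>f ` B. a s \<in> A) \<and> x = (\<Sum>s\<in>f ` B. a s * s)" if "x \<in> J" for x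
  proof -
    obtain l where l: "l \<in> L" "x = f l" using \<open>x \<in> J\<close> by (auto simp: J_def)
    have "x = (\<Sum>s\<in>f ` B. P (coord l (ev s)) * s)"
      unfolding l(2) f_eq_sum[OF l(1)] sum.reindex[OF injB] using B_L ev_f by simp
    then show ?thesis using A_poly_K by (intro exI[of _ "\<lambda>s. P (coord l (ev s))"]) simp
  qed
  show "\<exists>s\<in>f ` B. s \<noteq> 0"
  proof (rule ccontr)
    assume *: "\<not> (\<exists>s\<in>f ` B. s \<noteq> 0)"
    have "f l0 = 0" unfolding f_eq_sum[OF l0(1)] using * by (intro sum.neutral) auto
    then have "l0 = 0" using ev_f[OF l0(1)] ev_zero by simp
    then show False using l0(2) by blast
  qed
qed

lemma module_class_L: "module_class A m L = ideal_class A J"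
proof (rule ring.module_class_eq)
  show "module_iso A m L J f"
    using inj_f f_add f_act unfolding module_iso_def J_def bij_betw_def by simp
  show "fractional_ideal A J" by (rule ring.fractional_ideal_if_invertible[OF submodule_J J_invertible])
qed (rule m_L)

end

section \<open>The dual lattice as an ideal\<close>

locale cm_dual_pair = cm_lattice \<iota> emb cabs \<alpha>\<^sub>0 L m M
  for \<iota> :: "'k::{field,finite} poly fract \<Rightarrow> 'K::field"
    and emb :: "'k fls \<Rightarrow> 'c::field" and cabs \<alpha>\<^sub>0
    and L :: "('c ^ 'n) set" and m M :: "'K \<Rightarrow> 'c ^ 'n \<Rightarrow> 'c ^ 'n" +
  fixes L' :: "('c ^ 'm) set" and \<beta> :: "'c ^ 'n \<Rightarrow> 'c ^ 'm \<Rightarrow> 'k poly"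
  assumes dual: "dual_pair emb (degree_K \<iota>) L L' \<beta>"
begin

sublocale L': module "poly_scale emb :: 'k poly \<Rightarrow> 'c ^ 'm \<Rightarrow> 'c ^ 'm"
  by (rule module_poly_scale)

abbreviation D where "D \<equiv> codifferent \<iota>"

lemma L'_lattice: "lattice_of_rank emb (degree_K \<iota>) L'"
  and card_sum: "CARD('n) + CARD('m) = degree_K \<iota>"
  and perfect: "perfect_pairing emb L L' \<beta>"
  using dual unfolding dual_pair_def by simp_all

lemma L'_span_UNIV: "vec.span L' = UNIV"
  using L'_lattice unfolding lattice_of_rank_def by blast

lemma L'_add: "x \<in> L' \<Longrightarrow> y \<in> L' \<Longrightarrow> x + y \<in> L'"
  and L'_scale: "x \<in> L' \<Longrightarrow> poly_scale emb p x \<in> L'"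
  and L'_zero: "0 \<in> L'"
proof -
  obtain B' where B': "L' = L'.span B'" using L'_lattice unfolding lattice_of_rank_def by blast
  show "x \<in> L' \<Longrightarrow> y \<in> L' \<Longrightarrow> x + y \<in> L'" "x \<in> L' \<Longrightarrow> poly_scale emb p x \<in> L'" "0 \<in> L'"
    unfolding B' by (simp_all add: L'.span_add L'.span_scale L'.span_zero)
qed

lemma \<beta>_add_left: "l \<in> L \<Longrightarrow> l2 \<in> L \<Longrightarrow> l' \<in> L' \<Longrightarrow> \<beta> (l + l2) l' = \<beta> l l' + \<beta> l2 l'"
  and \<beta>_scale_left: "l \<in> L \<Longrightarrow> l' \<in> L' \<Longrightarrow> \<beta> (poly_scale emb p l) l' = p * \<beta> l l'"
  and \<beta>_add_right: "l \<in> L \<Longrightarrow> l' \<in> L' \<Longrightarrow> l2' \<in> L' \<Longrightarrow> \<beta> l (l' + l2') = \<beta> l l' + \<beta> l l2'"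
  and \<beta>_scale_right: "l \<in> L \<Longrightarrow> l' \<in> L' \<Longrightarrow> \<beta> l (poly_scale emb p l') = p * \<beta> l l'"
  using perfect unfolding perfect_pairing_def poly_linear_on_def by simp_all

lemma \<beta>_represents:
  assumes "poly_linear_on emb L h"
  shows "\<exists>!l'. l' \<in> L' \<and> (\<forall>l\<in>L. h l = \<beta> l l')"
  using perfect assms unfolding perfect_pairing_def by blast

lemma poly_linear_\<beta>: "l' \<in> L' \<Longrightarrow> poly_linear_on emb L (\<lambda>l. \<beta> l l')"
  using perfect unfolding perfect_pairing_def by blast

lemma \<beta>_eqI:
  assumes "x \<in> L'" "y \<in> L'" "\<And>l. l \<in> L \<Longrightarrow> \<beta> l x = \<beta> l y"
  shows "x = y"
  using \<beta>_represents[OF poly_linear_\<beta>[OF assms(1)]] assms by blast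

lemma poly_linear_on_sum:
  assumes h: "poly_linear_on emb L h"
  shows "(\<And>b. b \<in> S \<Longrightarrow> x b \<in> L) \<Longrightarrow> h (\<Sum>b\<in>S. poly_scale emb (c b) (x b)) = (\<Sum>b\<in>S. c b * h (x b))"
proof (induction S rule: infinite_finite_induct)
  case (insert b S)
  then show ?case using h f_sum[of S x c] unfolding poly_linear_on_def by (simp add: L_scale)
next
  case (infinite S)
  have "h (poly_scale emb 0 0) = 0 * h 0" using h L_zero unfolding poly_linear_on_def by blast
  then show ?case using infinite by simp
next
  case empty
  have "h (poly_scale emb 0 0) = 0 * h 0" using h L_zero unfolding poly_linear_on_def by blast
  then show ?case by simp
qed

lemma \<beta>_coord: "l \<in> L \<Longrightarrow> l' \<in> L' \<Longrightarrow> \<beta> l l' = (\<Sum>b\<in>B. coord l b * \<beta> b l')"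
  using poly_linear_on_sum[OF poly_linear_\<beta>[of l'], of B id "coord l"] sum_coord[of l] B_L by simp

definition ldual :: "'c ^ 'n \<Rightarrow> 'c ^ 'm" where
  "ldual b = (SOME l'. l' \<in> L' \<and> (\<forall>l\<in>L. coord l b = \<beta> l l'))"

lemma ldual: "ldual b \<in> L'" "l \<in> L \<Longrightarrow> \<beta> l (ldual b) = coord l b"
proof -
  have "poly_linear_on emb L (\<lambda>l. coord l b)"
    unfolding poly_linear_on_def by (simp add: coord_add coord_scale)
  then have "\<exists>l'. l' \<in> L' \<and> (\<forall>l\<in>L. coord l b = \<beta> l l')" using \<beta>_represents by blast
  note ex = someI_ex[OF this, folded ldual_def]
  show "ldual b \<in> L'" "l \<in> L \<Longrightarrow> \<beta> l (ldual b) = coord l b" using ex by simp_all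
qed

lemma L'_sum:
  assumes "\<And>b. b \<in> S \<Longrightarrow> x b \<in> L'"
  shows "(\<Sum>b\<in>S. poly_scale emb (c b) (x b)) \<in> L'"
    and "l \<in> L \<Longrightarrow> \<beta> l (\<Sum>b\<in>S. poly_scale emb (c b) (x b)) = (\<Sum>b\<in>S. c b * \<beta> l (x b))"
proof -
  have \<beta>0: "\<beta> l 0 = 0" if "l \<in> L" using \<beta>_scale_right[OF that L'_zero, of 0] by simp
  have "(\<Sum>b\<in>S. poly_scale emb (c b) (x b)) \<in> L' \<and>
      (l \<in> L \<longrightarrow> \<beta> l (\<Sum>b\<in>S. poly_scale emb (c b) (x b)) = (\<Sum>b\<in>S. c b * \<beta> l (x b)))"
    using assms
    by (induction S rule: infinite_finite_induct)
      (simp_all add: L'_zero \<beta>0 L'_add L'_scale \<beta>_add_right \<beta>_scale_right)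
  then show "(\<Sum>b\<in>S. poly_scale emb (c b) (x b)) \<in> L'"
    and "l \<in> L \<Longrightarrow> \<beta> l (\<Sum>b\<in>S. poly_scale emb (c b) (x b)) = (\<Sum>b\<in>S. c b * \<beta> l (x b))" by simp_all
qed

lemma L'_eq_sum:
  assumes l': "l' \<in> L'"
  shows "l' = (\<Sum>b\<in>B. poly_scale emb (\<beta> b l') (ldual b))"
proof (rule \<beta>_eqI[OF l' L'_sum(1)[OF ldual(1)]])
  fix l assume l: "l \<in> L"
  show "\<beta> l l' = \<beta> l (\<Sum>b\<in>B. poly_scale emb (\<beta> b l') (ldual b))"
    unfolding L'_sum(2)[OF ldual(1) l] \<beta>_coord[OF l l'] ldual(2)[OF l] by (simp only: mult.commute)
qed

text \<open>The element of K that represents pairing with l' through the trace form. Prescribing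
  traces on a basis gives existence by \<open>trace_dual_element\<close>, and uniqueness is
  \<open>trace_eqI\<close>.\<close>

definition f' :: "'c ^ 'm \<Rightarrow> 'K" where
  "f' l' = (SOME y. \<forall>b\<in>B. trace_K \<iota> (y * f b) = Fract (\<beta> b l') 1)"

lemma trace_f'_basis: "b \<in> B \<Longrightarrow> trace_K \<iota> (f' l' * f b) = Fract (\<beta> b l') 1"
proof -
  obtain y where y: "\<forall>x\<in>f ` B. trace_K \<iota> (y * x) = Fract (\<beta> (ev x) l') 1"
    using trace_dual_element[OF fB_basis, of "\<lambda>x. Fract (\<beta> (ev x) l') 1"] by blast
  have "\<forall>b\<in>B. trace_K \<iota> (y * f b) = Fract (\<beta> b l') 1" using y ev_f B_L by simp
  then have "\<exists>y. \<forall>b\<in>B. trace_K \<iota> (y * f b) = Fract (\<beta> b l') 1" by blast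
  from someI_ex[OF this, folded f'_def] show "b \<in> B \<Longrightarrow> trace_K \<iota> (f' l' * f b) = Fract (\<beta> b l') 1" by blast
qed

lemma Fract_sum: "(\<Sum>s\<in>S. Fract (g s) 1) = Fract (\<Sum>s\<in>S. g s) (1 :: 'k poly)"
  by (induction S rule: infinite_finite_induct) (simp_all add: Zero_fract_def)

lemma trace_f':
  assumes l: "l \<in> L" and l': "l' \<in> L'"
  shows "trace_K \<iota> (f' l' * f l) = Fract (\<beta> l l') 1"
proof -
  have "f' l' * f l = (\<Sum>b\<in>B. \<iota> (Fract (coord l b) 1) * (f' l' * f b))"
    unfolding f_eq_sum[OF l] sum_distrib_left poly_K_def by (simp only: mult.left_commute)
  then have "trace_K \<iota> (f' l' * f l) = (\<Sum>b\<in>B. Fract (coord l b) 1 * Fract (\<beta> b l') 1)"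
    by (simp only: trace_sum trace_scale trace_f'_basis cong: sum.cong)
  also have "\<dots> = Fract (\<Sum>b\<in>B. coord l b * \<beta> b l') 1" by (simp flip: Fract_sum)
  finally show ?thesis by (simp only: \<beta>_coord[OF l l'])
qed

text \<open>Since \<open>f'\<close> is known only through its traces, additivity, scaling and
  compatibility with the action are all verified by this comparison.\<close>

lemma trace_eqI:
  assumes "\<And>b. b \<in> B \<Longrightarrow> trace_K \<iota> (x * f b) = trace_K \<iota> (y * f b)"
  shows "x = y"
proof -
  have "trace_K \<iota> ((x - y) * b) = 0" if b: "b \<in> f ` B" for b
  proof -
    have "trace_K \<iota> (x * b) = trace_K \<iota> ((x - y) * b) + trace_K \<iota> (y * b)"
      by (simp flip: trace_add add: left_diff_distrib)
    moreover have "trace_K \<iota> (x * b) = trace_K \<iota> (y * b)" using assms b by blast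
    ultimately show ?thesis by simp
  qed
  then have "x - y = 0" by (rule trace_nondegenerate_basis[OF fB_basis(2)])
  then show ?thesis by simp
qed

lemma f'_add:
  assumes x: "x \<in> L'" and y: "y \<in> L'"
  shows "f' (x + y) = f' x + f' y"
proof (rule trace_eqI)
  fix b assume b: "b \<in> B"
  show "trace_K \<iota> (f' (x + y) * f b) = trace_K \<iota> ((f' x + f' y) * f b)"
    using b by (simp add: distrib_right trace_add trace_f'_basis \<beta>_add_right[OF B_L x y])
qed

lemma f'_scale:
  assumes x: "x \<in> L'"
  shows "f' (poly_scale emb p x) = P p * f' x"
proof (rule trace_eqI)
  fix b assume b: "b \<in> B"
  have "trace_K \<iota> (P p * f' x * f b) = Fract p 1 * trace_K \<iota> (f' x * f b)"
    unfolding poly_K_def mult.assoc by (rule trace_scale)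
  then show "trace_K \<iota> (f' (poly_scale emb p x) * f b) = trace_K \<iota> (P p * f' x * f b)"
    using b by (simp add: trace_f'_basis \<beta>_scale_right[OF B_L x])
qed

lemma f'_zero: "f' 0 = 0"
  using f'_scale[OF L'_zero, of 0] by (simp add: poly_K_simps)

lemma inj_f': "inj_on f' L'"
proof (rule inj_onI)
  fix x y assume xy: "x \<in> L'" "y \<in> L'" "f' x = f' y"
  show "x = y"
  proof (rule \<beta>_eqI[OF xy(1,2)])
    fix l assume l: "l \<in> L"
    have "Fract (\<beta> l x) 1 = Fract (\<beta> l y) 1"
      using trace_f'[OF l xy(1)] trace_f'[OF l xy(2)] xy(3) by simp
    then show "\<beta> l x = \<beta> l y" by (simp add: eq_fract)
  qed
qed

abbreviation dact where "dact \<equiv> dual_action \<beta> L L' m"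

lemma dual_action:
  assumes a: "a \<in> A" and l': "l' \<in> L'"
  shows "dact a l' \<in> L'" "l \<in> L \<Longrightarrow> \<beta> (m a l) l' = \<beta> l (dact a l')"
proof -
  have "m a (x + y) = m a x + m a y" "m a (poly_scale emb p x) = poly_scale emb p (m a x)" for x y p
    using M_add_right[of a] M_scale[of a] M_m[OF a] by (simp_all add: poly_scale_def)
  then have "poly_linear_on emb L (\<lambda>l. \<beta> (m a l) l')"
    unfolding poly_linear_on_def using l' by (simp add: m_L[OF a] \<beta>_add_left \<beta>_scale_left)
  note the = theI'[OF \<beta>_represents[OF this], folded dual_action_def]
  show "dact a l' \<in> L'" "l \<in> L \<Longrightarrow> \<beta> (m a l) l' = \<beta> l (dact a l')"
    using the by blast+
qed

text \<open>Multiplication by a is self-adjoint for the trace form, so the adjoint of the action on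
  L turns into plain multiplication in K.\<close>

lemma f'_dual_action:
  assumes a: "a \<in> A" and l': "l' \<in> L'"
  shows "f' (dact a l') = a * f' l'"
proof (rule trace_eqI)
  fix b assume b: "b \<in> B"
  have "trace_K \<iota> (a * f' l' * f b) = trace_K \<iota> (f' l' * f (m a b))"
    unfolding f_act[OF a B_L[OF b]] by (simp only: mult_ac)
  also have "\<dots> = Fract (\<beta> b (dact a l')) 1"
    unfolding trace_f'[OF m_L[OF a B_L[OF b]] l'] dual_action(2)[OF a l' B_L[OF b]] ..
  finally show "trace_K \<iota> (f' (dact a l') * f b) = trace_K \<iota> (a * f' l' * f b)"
    using b by (simp only: trace_f'_basis)
qed

definition J' where "J' = f' ` L'"

lemma submodule_J': "submodule_of A J'"
  unfolding submodule_of_def J'_def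
proof (intro conjI ballI)
  show "0 \<in> f' ` L'" using L'_zero f'_zero by (intro image_eqI[of _ _ 0]) simp_all
next
  fix x y assume "x \<in> f' ` L'" "y \<in> f' ` L'"
  then obtain l l' where "l \<in> L'" "l' \<in> L'" "x = f' l" "y = f' l'" by blast
  then show "x + y \<in> f' ` L'" using L'_add by (intro image_eqI[of _ _ "l + l'"]) (simp_all add: f'_add)
next
  fix a x assume "a \<in> A" "x \<in> f' ` L'"
  then obtain l where "l \<in> L'" "x = f' l" by blast
  then show "a * x \<in> f' ` L'" using dual_action(1) \<open>a \<in> A\<close>
    by (intro image_eqI[of _ _ "dact a l"]) (simp_all add: f'_dual_action)
qed

lemma f'_sum: "(\<And>b. b \<in> S \<Longrightarrow> x b \<in> L') \<Longrightarrow>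
    f' (\<Sum>b\<in>S. poly_scale emb (c b) (x b)) = (\<Sum>b\<in>S. P (c b) * f' (x b))"
  by (induction S rule: infinite_finite_induct) (simp_all add: f'_zero f'_add f'_scale L'_sum(1) L'_scale)

lemma f'_ldual: "b \<in> B \<Longrightarrow> c \<in> B \<Longrightarrow> trace_K \<iota> (f' (ldual c) * f b) = (if b = c then 1 else 0)"
  using L.representation_basis[OF B(3)]
  by (simp add: trace_f'_basis ldual(2)[OF B_L] coord_def One_fract_def Zero_fract_def)

lemma inj_ldual: "inj_on (\<lambda>b. f' (ldual b)) B"
proof (rule inj_onI)
  fix b c assume "b \<in> B" "c \<in> B" "f' (ldual b) = f' (ldual c)"
  then show "b = c" using f'_ldual[of b b] f'_ldual[of b c] by (simp split: if_splits)
qed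

lemma B_nonempty: "B \<noteq> {}"
proof
  assume "B = {}"
  then have "l0 = 0" using sum_coord[OF l0(1)] by simp
  then show False using l0(2) by blast
qed

text \<open>The generators are the basis of K that is trace-dual to the images of B under
  \<open>f\<close>; each is nonzero because one of its traces is 1.\<close>

lemma J'_invertible: "ideal_mult J' (ideal_inverse A J') = A"
proof (rule finitely_generated_invertible[of "(\<lambda>b. f' (ldual b)) ` B"])
  show "finite ((\<lambda>b. f' (ldual b)) ` B)" using B(1) by simp
  show "(\<lambda>b. f' (ldual b)) ` B \<subseteq> J'" using ldual(1) by (auto simp: J'_def)
  show "\<exists>a. (\<forall>s\<in>(\<lambda>b. f' (ldual b)) ` B. a s \<in> A) \<and> x = (\<Sum>s\<in>(\<lambda>b. f' (ldual b)) ` B. a s * s)" if "x \<in> J'" for x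
  proof -
    obtain l' where l': "l' \<in> L'" "x = f' l'" using \<open>x \<in> J'\<close> by (auto simp: J'_def)
    define h where "h = inv_into B (\<lambda>b. f' (ldual b))"
    have "x = (\<Sum>b\<in>B. P (\<beta> b l') * f' (ldual b))"
      unfolding l'(2) by (subst L'_eq_sum[OF l'(1)]) (rule f'_sum[OF ldual(1)])
    also have "\<dots> = (\<Sum>s\<in>(\<lambda>b. f' (ldual b)) ` B. P (\<beta> (h s) l') * s)"
      unfolding sum.reindex[OF inj_ldual] h_def by (rule sum.cong) (simp_all add: inv_into_f_f[OF inj_ldual])
    finally show ?thesis using A_poly_K by (intro exI[of _ "\<lambda>s. P (\<beta> (h s) l')"]) simp
  qed
  obtain b where b: "b \<in> B" using B_nonempty by blast
  have "f' (ldual b) \<noteq> 0" using f'_ldual[OF b b] trace_scale[of 0 0]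
    by (auto simp: unital_ring_hom_zero[OF \<iota>_hom])
  then show "\<exists>s\<in>(\<lambda>b. f' (ldual b)) ` B. s \<noteq> 0" using b by blast
qed

lemma trace_zero: "trace_K \<iota> 0 = 0"
  using trace_scale[of 0 0] by simp

lemma submodule_D: "submodule_of A D"
  unfolding submodule_of_def codifferent_def
proof (intro conjI ballI CollectI)
  fix a
  show "trace_K \<iota> (0 * a) \<in> range (\<lambda>p. Fract p 1)"
    using trace_zero by (intro range_eqI[of _ _ 0]) (simp flip: Zero_fract_def)
next
  fix x y a
  assume "x \<in> {x. \<forall>a\<in>A. trace_K \<iota> (x * a) \<in> range (\<lambda>p. Fract p 1)}"
    "y \<in> {x. \<forall>a\<in>A. trace_K \<iota> (x * a) \<in> range (\<lambda>p. Fract p 1)}" "a \<in> A"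
  then obtain p q where "trace_K \<iota> (x * a) = Fract p 1" "trace_K \<iota> (y * a) = Fract q 1" by blast
  then have "trace_K \<iota> ((x + y) * a) = Fract (p + q) 1" by (simp add: distrib_right trace_add)
  then show "trace_K \<iota> ((x + y) * a) \<in> range (\<lambda>p. Fract p 1)" by (rule range_eqI)
next
  fix a x c
  assume "a \<in> A" "x \<in> {x. \<forall>a\<in>A. trace_K \<iota> (x * a) \<in> range (\<lambda>p. Fract p 1)}" "c \<in> A"
  then have "trace_K \<iota> (x * (a * c)) \<in> range (\<lambda>p. Fract p 1)" using A_mult by simp
  then show "trace_K \<iota> (a * x * c) \<in> range (\<lambda>p. Fract p 1)" by (simp only: mult_ac)
qed

text \<open>For y = f' l' and x = f l, the trace of y x a is the pairing of m a l with l', hence a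
  polynomial. Conversely, a = 1 in the definition of the codifferent yields an F_q[T]-linear
  functional on L, which perfectness represents by some l'.\<close>

lemma J'_eq: "J' = {y. \<forall>x\<in>J. y * x \<in> D}"
proof (intro subset_antisym subsetI CollectI ballI)
  fix y x assume "y \<in> J'" "x \<in> J"
  then obtain l l' where l: "l \<in> L" "x = f l" and l': "l' \<in> L'" "y = f' l'" by (auto simp: J_def J'_def)
  show "y * x \<in> D" unfolding codifferent_def
  proof (intro CollectI ballI)
    fix a assume a: "a \<in> A"
    have "trace_K \<iota> (y * x * a) = trace_K \<iota> (f' l' * f (m a l))"
      unfolding f_act[OF a l(1)] l(2) l'(2) by (simp only: mult_ac)
    also have "\<dots> = Fract (\<beta> (m a l) l') 1" by (rule trace_f'[OF m_L[OF a l(1)] l'(1)])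
    finally show "trace_K \<iota> (y * x * a) \<in> range (\<lambda>p. Fract p 1)" by (rule range_eqI)
  qed
next
  fix y assume "y \<in> {y. \<forall>x\<in>J. y * x \<in> D}"
  then have y: "y * f l \<in> D" if "l \<in> L" for l using that by (simp add: J_def)
  have "\<exists>p. trace_K \<iota> (y * f l) = Fract p 1" if "l \<in> L" for l
    using y[OF that] A_one unfolding codifferent_def by (metis (mono_tags, lifting) mem_Collect_eq mult.right_neutral rangeE)
  then obtain h where h: "\<And>l. l \<in> L \<Longrightarrow> trace_K \<iota> (y * f l) = Fract (h l) 1" by metis
  have "poly_linear_on emb L h" unfolding poly_linear_on_def
  proof (intro conjI ballI allI)
    fix l l2 assume l: "l \<in> L" "l2 \<in> L"
    have "Fract (h (l + l2)) 1 = trace_K \<iota> (y * f l + y * f l2)"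
      by (simp only: h[OF L_add[OF l], symmetric] f_add[OF l] distrib_left)
    also have "\<dots> = Fract (h l + h l2) 1" using l by (simp add: trace_add h)
    finally show "h (l + l2) = h l + h l2" by (simp add: eq_fract)
  next
    fix p l assume l: "l \<in> L"
    have "Fract (h (poly_scale emb p l)) 1 = trace_K \<iota> (\<iota> (Fract p 1) * (y * f l))"
      by (simp only: h[OF L_scale[OF l], symmetric] f_scale[OF l] poly_K_def mult.left_commute)
    also have "\<dots> = Fract (p * h l) 1" using l by (simp add: trace_scale h)
    finally show "h (poly_scale emb p l) = p * h l" by (simp add: eq_fract)
  qed
  then obtain l' where l': "l' \<in> L'" "\<And>l. l \<in> L \<Longrightarrow> h l = \<beta> l l'" using \<beta>_represents by blast
  have "y = f' l'"
    by (rule trace_eqI) (simp add: trace_f'_basis h l'(2) B_L)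
  then show "y \<in> J'" using l'(1) by (simp add: J'_def)
qed

lemma module_class_L': "module_class A dact L' = ideal_class A J'"
proof (rule ring.module_class_eq)
  show "module_iso A dact L' J' f'"
    using inj_f' f'_add f'_dual_action unfolding module_iso_def J'_def bij_betw_def by simp
  show "fractional_ideal A J'" by (rule ring.fractional_ideal_if_invertible[OF submodule_J' J'_invertible])
qed (rule dual_action(1))

lemma module_class_dual:
  "module_class A dact L' =
    inv\<^bsub>class_group A\<^esub> (ideal_class A (different \<iota>)) \<otimes>\<^bsub>class_group A\<^esub> inv\<^bsub>class_group A\<^esub> (module_class A m L)"
proof -
  have "different \<iota> = ideal_inverse A D" by (simp add: different_def ideal_inverse_def)
  then show ?thesis unfolding module_class_L module_class_L'
    using ring.class_of_dual_module[OF submodule_J J_invertible submodule_J' J'_invertible submodule_D J'_eq]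
    by simp
qed

end

section \<open>The CM type of the dual\<close>

locale cm_type_dual_pair = cm_dual_pair \<iota> emb cabs \<alpha>\<^sub>0 L m M L' \<beta>
  for \<iota> :: "'k::{field,finite} poly fract \<Rightarrow> 'K::field"
    and emb :: "'k fls \<Rightarrow> 'c::field" and cabs \<alpha>\<^sub>0
    and L :: "('c ^ 'n) set" and m M :: "'K \<Rightarrow> 'c ^ 'n \<Rightarrow> 'c ^ 'n"
    and L' :: "('c ^ 'm) set" and \<beta> +
  fixes \<Phi> :: "('K \<Rightarrow> 'c) set" and g :: "'c ^ 'n \<Rightarrow> ('K \<Rightarrow> 'c) \<Rightarrow> 'c"
  assumes \<Phi>_E: "\<Phi> \<subseteq> E"
    and g_bij: "bij_betw g UNIV {f. \<forall>\<alpha>. \<alpha> \<notin> \<Phi> \<longrightarrow> f \<alpha> = 0}"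
    and g_add: "g (v + w) \<alpha> = g v \<alpha> + g w \<alpha>"
    and g_scale: "g (c *s v) \<alpha> = c * g v \<alpha>"
    and g_act: "\<alpha> \<in> \<Phi> \<Longrightarrow> g (M x v) \<alpha> = \<alpha> x * g v \<alpha>"
begin

lemma finite_\<Phi>: "finite \<Phi>"
  using \<Phi>_E finite_embeddings by (rule finite_subset)

lemma g_zero: "g 0 \<alpha> = 0"
  using g_scale[of 0 0 \<alpha>] by simp

lemma g_sum: "g (\<Sum>b\<in>S. c b *s x b) \<alpha> = (\<Sum>b\<in>S. c b * g (x b) \<alpha>)"
  by (induction S rule: infinite_finite_induct) (simp_all add: g_zero g_add g_scale)

lemma g_surj: "\<exists>v. \<forall>\<gamma>. g v \<gamma> = (if \<gamma> = \<alpha> then 1 else 0)" if "\<alpha> \<in> \<Phi>"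
proof -
  have "(\<lambda>\<gamma>. if \<gamma> = \<alpha> then 1 else 0) \<in> g ` UNIV"
    unfolding bij_betw_imp_surj_on[OF g_bij] using that by auto
  then obtain v where "(\<lambda>\<gamma>. if \<gamma> = \<alpha> then 1 else 0) = g v" by blast
  then have "g v \<gamma> = (if \<gamma> = \<alpha> then 1 else 0)" for \<gamma> by (rule fun_cong[OF HOL.sym])
  then show ?thesis by blast
qed

lemma g_outside: "\<alpha> \<notin> \<Phi> \<Longrightarrow> g v \<alpha> = 0"
  using bij_betwE[OF g_bij] by blast

text \<open>The preimages under \<open>g\<close> of the indicator families of the members of \<Phi>
  span V.\<close>

lemma card_\<Phi>_ge: "CARD('n) \<le> card \<Phi>"
proof -
  obtain e where e: "\<And>\<alpha> \<gamma>. \<alpha> \<in> \<Phi> \<Longrightarrow> g (e \<alpha>) \<gamma> = (if \<gamma> = \<alpha> then 1 else 0)" using g_surj by metis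
  have "v \<in> vec.span (e ` \<Phi>)" for v
  proof -
    have "g v = g (\<Sum>\<alpha>\<in>\<Phi>. g v \<alpha> *s e \<alpha>)"
    proof
      fix \<gamma>
      have "g (\<Sum>\<alpha>\<in>\<Phi>. g v \<alpha> *s e \<alpha>) \<gamma> = (\<Sum>\<alpha>\<in>\<Phi>. g v \<alpha> * (if \<gamma> = \<alpha> then 1 else 0))"
        by (simp add: g_sum e)
      also have "\<dots> = g v \<gamma>" using finite_\<Phi> g_outside[of \<gamma> v]
        by (auto simp: if_distrib[of "\<lambda>a. _ * a"] cong: if_cong)
      finally show "g v \<gamma> = g (\<Sum>\<alpha>\<in>\<Phi>. g v \<alpha> *s e \<alpha>) \<gamma>" by simp
    qed
    then have "v = (\<Sum>\<alpha>\<in>\<Phi>. g v \<alpha> *s e \<alpha>)" using bij_betw_imp_inj_on[OF g_bij] by (rule injD[rotated])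
    moreover have "(\<Sum>\<alpha>\<in>\<Phi>. g v \<alpha> *s e \<alpha>) \<in> vec.span (e ` \<Phi>)"
      by (intro vec.span_sum vec.span_scale vec.span_base imageI)
    ultimately show ?thesis by (simp only:)
  qed
  then have "vec.dim (UNIV :: ('c ^ 'n) set) \<le> card (e ` \<Phi>)"
    using finite_\<Phi> by (intro vec.dim_le_card) auto
  also have "\<dots> \<le> card \<Phi>" by (rule card_image_le[OF finite_\<Phi>])
  finally show ?thesis by (simp add: vec.dim_UNIV card_cart_basis)
qed

definition w :: "('K \<Rightarrow> 'c) \<Rightarrow> 'c ^ 'm" where
  "w \<alpha> = (\<Sum>b\<in>B. \<alpha> (f b) *s ldual b)"

text \<open>The \<alpha>-component of \<open>g\<close> is a linear form \<phi> on V with \<phi>(l) =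
  \<alpha>(f l) \<phi>(l0) on L, because l = M (f l) l0. Its image in V' is \<phi>(l0) w_\<alpha>,
  which vanishes by duality, and \<phi>(l0) is nonzero since L spans V.\<close>

lemma w_zero:
  assumes \<alpha>: "\<alpha> \<in> \<Phi>"
  shows "w \<alpha> = 0"
proof -
  have gl: "g l \<alpha> = \<alpha> (f l) * g l0 \<alpha>" if "l \<in> L" for l
    using g_act[OF \<alpha>, of "f l" l0] ev_f[OF that] by (simp add: ev_def)
  have nz: "g l0 \<alpha> \<noteq> 0"
  proof
    assume "g l0 \<alpha> = 0"
    then have "L \<subseteq> {v. g v \<alpha> = 0}" using gl by auto
    moreover have "vec.subspace {v. g v \<alpha> = 0}"
      unfolding vec.subspace_def by (simp add: g_zero g_add g_scale)
    ultimately have "vec.span L \<subseteq> {v. g v \<alpha> = 0}" by (rule vec.span_minimal)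
    then have all0: "g v \<alpha> = 0" for v unfolding L_span_UNIV by blast
    obtain v where "\<forall>\<gamma>. g v \<gamma> = (if \<gamma> = \<alpha> then 1 else 0)" using g_surj[OF \<alpha>] by blast
    then have "g v \<alpha> = 1" by simp
    then show False using all0 by simp
  qed
  \<comment> \<open>The formal sum over B of l'_b \<otimes> \<phi>(b), representing the image of
    \<phi> in L' \<otimes> C.\<close>
  define N where "N = image_mset (\<lambda>b. (ldual b, g b \<alpha>)) (mset_set B)"
  have sumN: "(\<Sum>(l', c)\<in>#N. F l' c) = (\<Sum>b\<in>B. F (ldual b) (g b \<alpha>))" for F :: "'c ^ 'm \<Rightarrow> 'c \<Rightarrow> 'z::comm_monoid_add"
    unfolding N_def by (simp add: sum_unfold_sum_mset image_mset.compositionality comp_def)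
  have "Vector_Spaces.linear (*s) (*) (\<lambda>v. g v \<alpha>)"
    unfolding Vector_Spaces.linear_iff
    by (intro conjI allI vec.vector_space_axioms g_add g_scale)
      (unfold_locales; simp add: algebra_simps)
  moreover have "\<forall>(l', c)\<in>#N. l' \<in> L'" using ldual(1) by (auto simp: N_def)
  moreover have "\<forall>l\<in>L. g l \<alpha> = (\<Sum>(l', c)\<in>#N. c * eval_theta emb (\<beta> l l'))"
  proof
    fix l assume l: "l \<in> L"
    have "g l \<alpha> = g (\<Sum>b\<in>B. eval_theta emb (coord l b) *s b) \<alpha>"
      using sum_coord[OF l] by (simp add: poly_scale_def)
    also have "\<dots> = (\<Sum>b\<in>B. eval_theta emb (coord l b) * g b \<alpha>)" by (rule g_sum)
    finally show "g l \<alpha> = (\<Sum>(l', c)\<in>#N. c * eval_theta emb (\<beta> l l'))"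
      unfolding sumN ldual(2)[OF l] by (simp only: mult.commute)
  qed
  ultimately have "(\<Sum>(l', c)\<in>#N. c *s l') = 0"
    using dual unfolding dual_pair_def by blast
  then have "(\<Sum>b\<in>B. g b \<alpha> *s ldual b) = 0" unfolding sumN .
  moreover have "(\<Sum>b\<in>B. g b \<alpha> *s ldual b) = g l0 \<alpha> *s w \<alpha>"
    unfolding w_def vec.scale_sum_right
    by (rule sum.cong[OF HOL.refl]) (simp add: gl B_L mult.commute)
  ultimately show ?thesis using nz by simp
qed

definition \<Phi>' where "\<Phi>' = E - \<Phi>"

lemma finite_\<Phi>': "finite \<Phi>'"
  unfolding \<Phi>'_def using finite_embeddings by blast

lemma L'_eq_sum_w:
  assumes l': "l' \<in> L'"
  shows "l' = (\<Sum>\<alpha>\<in>\<Phi>'. \<alpha> (f' l') *s w \<alpha>)"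
proof -
  have "eval_theta emb (\<beta> b l') = (\<Sum>\<alpha>\<in>E. \<alpha> (f' l') * \<alpha> (f b))" if "b \<in> B" for b
    using j_trace[of "f' l' * f b"] trace_f'_basis[OF that, of l']
    by (simp add: j_poly unital_ring_hom_mult[OF embedding_hom])
  then have "l' = (\<Sum>b\<in>B. (\<Sum>\<alpha>\<in>E. \<alpha> (f' l') * \<alpha> (f b)) *s ldual b)"
    using L'_eq_sum[OF l'] by (simp add: poly_scale_def)
  also have "\<dots> = (\<Sum>b\<in>B. \<Sum>\<alpha>\<in>E. (\<alpha> (f' l') * \<alpha> (f b)) *s ldual b)"
    by (simp only: vec.scale_sum_left)
  also have "\<dots> = (\<Sum>\<alpha>\<in>E. \<Sum>b\<in>B. (\<alpha> (f' l') * \<alpha> (f b)) *s ldual b)" by (rule sum.swap)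
  also have "\<dots> = (\<Sum>\<alpha>\<in>E. \<alpha> (f' l') *s w \<alpha>)"
    by (simp add: w_def vec.scale_sum_right)
  also have "\<dots> = (\<Sum>\<alpha>\<in>\<Phi>'. \<alpha> (f' l') *s w \<alpha>)"
    by (rule sum.mono_neutral_right) (auto simp: finite_embeddings \<Phi>'_def w_zero)
  finally show ?thesis .
qed

text \<open>The chain is r - n = dim V' \<le> card w(\<Phi>') \<le> card \<Phi>' = card E - card
  \<Phi> \<le> r - n, the first inequality because L' spans V'. Equality throughout gives
  injectivity and independence.\<close>

lemma w_basis: "vec.span (w ` \<Phi>') = UNIV" "inj_on w \<Phi>'" "vec.independent (w ` \<Phi>')" "\<Phi>' \<noteq> {}"
proof -
  have "L' \<subseteq> vec.span (w ` \<Phi>')"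
  proof
    fix l' assume "l' \<in> L'"
    from L'_eq_sum_w[OF this]
    show "l' \<in> vec.span (w ` \<Phi>')"
      by (rule ssubst[where P = "\<lambda>x. x \<in> vec.span (w ` \<Phi>')"])
        (intro vec.span_sum vec.span_scale vec.span_base imageI)
  qed
  then have "vec.span L' \<subseteq> vec.span (w ` \<Phi>')" by (rule vec.span_minimal) (rule vec.subspace_span)
  then show span: "vec.span (w ` \<Phi>') = UNIV" unfolding L'_span_UNIV by blast
  have "CARD('m) = vec.dim (UNIV :: ('c ^ 'm) set)" by (simp add: vec.dim_UNIV card_cart_basis)
  also have "\<dots> \<le> card (w ` \<Phi>')"
    using finite_\<Phi>' span by (intro vec.dim_le_card) auto
  finally have 1: "CARD('m) \<le> card (w ` \<Phi>')" .
  have 2: "card (w ` \<Phi>') \<le> card \<Phi>'" by (rule card_image_le[OF finite_\<Phi>'])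
  have "card \<Phi>' = card E - card \<Phi>" unfolding \<Phi>'_def by (rule card_Diff_subset[OF finite_\<Phi> \<Phi>_E])
  then have 3: "card \<Phi>' \<le> CARD('m)" using card_embeddings_le card_sum card_\<Phi>_ge by linarith
  show "inj_on w \<Phi>'" using 1 2 3 finite_\<Phi>' by (intro eq_card_imp_inj_on) auto
  show "vec.independent (w ` \<Phi>')"
  proof (rule vec.card_le_dim_spanning[of _ UNIV])
    show "card (w ` \<Phi>') \<le> vec.dim (UNIV :: ('c ^ 'm) set)"
      using 2 3 by (simp add: vec.dim_UNIV card_cart_basis)
  qed (use span finite_\<Phi>' in auto)
  \<comment> \<open>The index type of V' is nonempty, so the lower bound on the cardinality is
    positive.\<close>
  show "\<Phi>' \<noteq> {}" using 1 2 by auto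
qed

section \<open>The action of K on the dual space and its CM type\<close>

definition \<rho> :: "'c ^ 'm \<Rightarrow> ('K \<Rightarrow> 'c) \<Rightarrow> 'c" where
  "\<rho> v \<alpha> = vec.representation (w ` \<Phi>') v (w \<alpha>)"

lemma sum_\<rho>: "(\<Sum>\<alpha>\<in>\<Phi>'. \<rho> v \<alpha> *s w \<alpha>) = v"
  using vec.sum_representation_eq[OF w_basis(3) _ finite_imageI[OF finite_\<Phi>'] order.refl, of v]
  unfolding w_basis(1) sum.reindex[OF w_basis(2)] by (simp add: \<rho>_def)

lemma \<rho>_add: "\<rho> (u + v) \<alpha> = \<rho> u \<alpha> + \<rho> v \<alpha>"
  and \<rho>_scale: "\<rho> (c *s v) \<alpha> = c * \<rho> v \<alpha>"
  unfolding \<rho>_def using vec.representation_add[OF w_basis(3), of v u] vec.representation_scale[OF w_basis(3), of v c]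
  by (simp_all add: w_basis(1))

lemma \<rho>_w: "\<alpha> \<in> \<Phi>' \<Longrightarrow> \<gamma> \<in> \<Phi>' \<Longrightarrow> \<rho> (w \<alpha>) \<gamma> = (if \<gamma> = \<alpha> then 1 else 0)"
  unfolding \<rho>_def using vec.representation_basis[OF w_basis(3), of "w \<alpha>"] inj_onD[OF w_basis(2), of \<gamma> \<alpha>] by auto

lemma \<rho>_sum: "\<gamma> \<in> \<Phi>' \<Longrightarrow> \<rho> (\<Sum>\<alpha>\<in>\<Phi>'. d \<alpha> *s w \<alpha>) \<gamma> = d \<gamma>"
proof -
  assume \<gamma>: "\<gamma> \<in> \<Phi>'"
  have "\<rho> (\<Sum>\<alpha>\<in>S. d \<alpha> *s w \<alpha>) \<gamma> = (\<Sum>\<alpha>\<in>S. d \<alpha> * \<rho> (w \<alpha>) \<gamma>)" for S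
    using \<rho>_scale[of 0 0 \<gamma>] by (induction S rule: infinite_finite_induct) (simp_all add: \<rho>_add \<rho>_scale)
  then have "\<rho> (\<Sum>\<alpha>\<in>\<Phi>'. d \<alpha> *s w \<alpha>) \<gamma> = (\<Sum>\<alpha>\<in>\<Phi>'. d \<alpha> * (if \<gamma> = \<alpha> then 1 else 0))"
    using \<gamma> by (simp add: \<rho>_w)
  then show ?thesis using finite_\<Phi>' \<gamma> by (simp add: if_distrib[of "\<lambda>a. _ * a"] cong: if_cong)
qed

text \<open>Diagonal in the basis \<open>w\<close>, with eigenvalue \<alpha>(x) at
  \<open>w \<alpha>\<close>. It is defined on all of K at once, so it later serves as its own
  extension from A.\<close>

definition M' :: "'K \<Rightarrow> 'c ^ 'm \<Rightarrow> 'c ^ 'm" where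
  "M' x v = (\<Sum>\<alpha>\<in>\<Phi>'. (\<alpha> x * \<rho> v \<alpha>) *s w \<alpha>)"

lemma \<rho>_M': "\<alpha> \<in> \<Phi>' \<Longrightarrow> \<rho> (M' x v) \<alpha> = \<alpha> x * \<rho> v \<alpha>"
  unfolding M'_def by (rule \<rho>_sum)

lemma \<Phi>'_hom: "\<alpha> \<in> \<Phi>' \<Longrightarrow> unital_ring_hom \<alpha>"
  by (simp add: \<Phi>'_def embedding_hom)

text \<open>The coordinates of l' in the basis \<open>w\<close> are the \<alpha>(f' l'). Multiplying
  them by \<alpha>(a) replaces f' l' by a f' l', the value of \<open>f'\<close> at the dual
  action.\<close>

lemma M'_dual_action:
  assumes a: "a \<in> A" and l': "l' \<in> L'"
  shows "M' a l' = dact a l'"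
proof -
  have \<rho>: "\<rho> l' \<alpha> = \<alpha> (f' l')" if "\<alpha> \<in> \<Phi>'" for \<alpha>
    using \<rho>_sum[OF that, of "\<lambda>\<alpha>. \<alpha> (f' l')"] by (simp only: L'_eq_sum_w[OF l', symmetric])
  have "M' a l' = (\<Sum>\<alpha>\<in>\<Phi>'. \<alpha> (f' (dact a l')) *s w \<alpha>)"
    unfolding M'_def f'_dual_action[OF a l']
    by (rule sum.cong[OF HOL.refl]) (simp add: \<rho> unital_ring_hom_mult[OF \<Phi>'_hom])
  also have "\<dots> = dact a l'" by (rule L'_eq_sum_w[OF dual_action(1)[OF a l'], symmetric])
  finally show ?thesis .
qed

lemma M'_linear: "Vector_Spaces.linear (*s) (*s) (M' x)"
  unfolding Vector_Spaces.linear_iff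
  by (intro conjI allI vec.vector_space_axioms)
    (simp_all add: M'_def \<rho>_add \<rho>_scale distrib_left vec.scale_left_distrib sum.distrib vec.scale_sum_right mult.left_commute)

lemma M'_add: "M' (x + y) v = M' x v + M' y v"
proof -
  have "M' (x + y) v = (\<Sum>\<alpha>\<in>\<Phi>'. (\<alpha> x * \<rho> v \<alpha>) *s w \<alpha> + (\<alpha> y * \<rho> v \<alpha>) *s w \<alpha>)"
    unfolding M'_def by (rule sum.cong[OF HOL.refl])
      (simp add: unital_ring_hom_add[OF \<Phi>'_hom] distrib_right vec.scale_left_distrib)
  then show ?thesis by (simp add: M'_def sum.distrib)
qed

lemma M'_mult: "M' (x * y) = M' x \<circ> M' y"
proof
  fix v
  have "M' x (M' y v) = (\<Sum>\<alpha>\<in>\<Phi>'. (\<alpha> x * (\<alpha> y * \<rho> v \<alpha>)) *s w \<alpha>)"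
    unfolding M'_def[of x] by (rule sum.cong[OF HOL.refl]) (simp add: \<rho>_M')
  also have "\<dots> = M' (x * y) v"
    unfolding M'_def by (rule sum.cong[OF HOL.refl]) (simp add: unital_ring_hom_mult[OF \<Phi>'_hom] mult.assoc)
  finally show "M' (x * y) v = (M' x \<circ> M' y) v" by simp
qed

lemma M'_poly_K: "M' (P p) v = poly_scale emb p v"
proof -
  have "M' (P p) v = (\<Sum>\<alpha>\<in>\<Phi>'. eval_theta emb p *s (\<rho> v \<alpha> *s w \<alpha>))"
    unfolding M'_def by (rule sum.cong[OF HOL.refl]) (simp add: embedding_poly_K \<Phi>'_def)
  also have "\<dots> = eval_theta emb p *s (\<Sum>\<alpha>\<in>\<Phi>'. \<rho> v \<alpha> *s w \<alpha>)" by (simp only: vec.scale_sum_right)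
  finally show ?thesis by (simp add: sum_\<rho> poly_scale_def)
qed

text \<open>A single \<alpha> in the nonempty \<Phi>' already recovers x from the eigenvalue
  \<alpha>(x).\<close>

lemma inj_M': "inj M'"
proof (rule injI)
  fix x y assume eq: "M' x = M' y"
  obtain \<alpha> where \<alpha>: "\<alpha> \<in> \<Phi>'" using w_basis(4) by blast
  have "\<alpha> x = \<alpha> y" using \<rho>_M'[OF \<alpha>, of x "w \<alpha>"] \<rho>_M'[OF \<alpha>, of y "w \<alpha>"] \<rho>_w[OF \<alpha> \<alpha>] eq by simp
  then show "x = y" using unital_ring_hom_eq_iff[OF \<Phi>'_hom[OF \<alpha>]] by simp
qed

lemma M'_CM_type: "has_CM_type A M' \<Phi>'"
  unfolding has_CM_type_def
\<comment> \<open>The cut-off makes the family supported on \<Phi>'; \<open>\<rho>\<close> itself is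
  controlled only there.\<close>
proof (intro exI[of _ M'] exI[of _ "\<lambda>v \<alpha>. if \<alpha> \<in> \<Phi>' then \<rho> v \<alpha> else 0"] conjI ballI allI M'_linear M'_add M'_mult)
  show "M' 1 = id"
  proof
    fix v show "M' 1 v = id v" using M'_poly_K[of 1 v] by (simp add: poly_K_simps)
  qed
  show "bij_betw (\<lambda>v \<alpha>. if \<alpha> \<in> \<Phi>' then \<rho> v \<alpha> else 0) UNIV {f. \<forall>\<alpha>. \<alpha> \<notin> \<Phi>' \<longrightarrow> f \<alpha> = 0}"
  proof (rule bij_betw_byWitness[where f' = "\<lambda>d. \<Sum>\<alpha>\<in>\<Phi>'. d \<alpha> *s w \<alpha>"])
    show "\<forall>v\<in>UNIV. (\<Sum>\<alpha>\<in>\<Phi>'. (if \<alpha> \<in> \<Phi>' then \<rho> v \<alpha> else 0) *s w \<alpha>) = v"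
      by (simp add: sum_\<rho> cong: sum.cong)
    show "\<forall>d\<in>{f. \<forall>\<alpha>. \<alpha> \<notin> \<Phi>' \<longrightarrow> f \<alpha> = 0}.
        (\<lambda>\<alpha>. if \<alpha> \<in> \<Phi>' then \<rho> (\<Sum>\<alpha>\<in>\<Phi>'. d \<alpha> *s w \<alpha>) \<alpha> else 0) = d"
      by (auto simp: fun_eq_iff \<rho>_sum)
  qed auto
qed (simp_all add: \<rho>_add \<rho>_scale \<rho>_M')

lemma complete_multiplication_M': "complete_multiplication emb \<iota> L' M' \<Phi>'"
  unfolding complete_multiplication_def
proof (intro conjI ballI allI M'_linear M'_add M'_mult M'_poly_K M'_CM_type)
  show "\<Phi>' \<subseteq> E" by (auto simp: \<Phi>'_def)
  show "inj_on M' A" using inj_M' by (rule inj_on_subset) simp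
  show "M' a ` L' \<subseteq> L'" if "a \<in> A" for a using M'_dual_action[OF that] dual_action(1)[OF that] by auto
qed

end

theorem theorem13p1:
  fixes emb :: "'k::{field,finite} fls \<Rightarrow> 'c::field"
    and cabs :: "'c \<Rightarrow> real"
    and \<iota> :: "'k poly fract \<Rightarrow> 'K::field"
    and r :: nat
    and L :: "('c ^ 'n) set"
    and L' :: "('c ^ 'm) set"
    and m :: "'K \<Rightarrow> 'c ^ 'n \<Rightarrow> 'c ^ 'n"
    and \<Phi> \<Phi>' :: "('K \<Rightarrow> 'c) set"
    and \<beta> :: "'c ^ 'n \<Rightarrow> 'c ^ 'm \<Rightarrow> 'k poly"
  assumes "C_infinity emb cabs"
    and "finite_separable \<iota>"
    and "tensor_domain (const_K \<iota>) (const_C emb)"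
    and "\<exists>!R. R \<in> places \<iota> \<and> over_infinity \<iota> R"
    and "r = degree_K \<iota>"
    and "lattice_of_rank emb r L"
    and "complete_multiplication emb \<iota> L m \<Phi>"
    and "dual_pair emb r L L' \<beta>"
    and "\<Phi>' = embeddings emb \<iota> - \<Phi>"
  shows "(\<exists>m'. complete_multiplication emb \<iota> L' m' \<Phi>' \<and>
               (\<forall>a\<in>ring_A \<iota>. \<forall>l'\<in>L'. m' a l' = dual_action \<beta> L L' m a l')) \<and>
         module_class (ring_A \<iota>) (dual_action \<beta> L L' m) L' =
           inv\<^bsub>class_group (ring_A \<iota>)\<^esub> (ideal_class (ring_A \<iota>) (different \<iota>)) \<otimes>\<^bsub>class_group (ring_A \<iota>)\<^esub>
           inv\<^bsub>class_group (ring_A \<iota>)\<^esub> (module_class (ring_A \<iota>) m L)"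
proof -
  have \<Phi>: "\<Phi> \<subseteq> embeddings emb \<iota>"
    and mL: "\<And>a l. a \<in> ring_A \<iota> \<Longrightarrow> l \<in> L \<Longrightarrow> m a l \<in> L"
    and m_poly: "\<And>p v. m (poly_K \<iota> p) v = poly_scale emb p v"
    and cm: "has_CM_type (ring_A \<iota>) m \<Phi>"
    using assms(7) unfolding complete_multiplication_def by (blast, blast, blast, blast)
  obtain M where M: "\<forall>a\<in>ring_A \<iota>. M a = m a" "\<forall>x. Vector_Spaces.linear (*s) (*s) (M x)" "M 1 = id"
      "\<forall>x y v. M (x + y) v = M x v + M y v" "\<forall>x y. M (x * y) = M x \<circ> M y"
    and "\<exists>g :: 'c ^ 'n \<Rightarrow> ('K \<Rightarrow> 'c) \<Rightarrow> 'c.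
      bij_betw g UNIV {f. \<forall>\<alpha>. \<alpha> \<notin> \<Phi> \<longrightarrow> f \<alpha> = 0} \<and> (\<forall>v w \<alpha>. g (v + w) \<alpha> = g v \<alpha> + g w \<alpha>) \<and>
      (\<forall>c v \<alpha>. g (c *s v) \<alpha> = c * g v \<alpha>) \<and> (\<forall>x v. \<forall>\<alpha>\<in>\<Phi>. g (M x v) \<alpha> = \<alpha> x * g v \<alpha>)"
    using cm unfolding has_CM_type_def by blast
  then obtain g :: "'c ^ 'n \<Rightarrow> ('K \<Rightarrow> 'c) \<Rightarrow> 'c"
    where g: "bij_betw g UNIV {f. \<forall>\<alpha>. \<alpha> \<notin> \<Phi> \<longrightarrow> f \<alpha> = 0}" "\<forall>v w \<alpha>. g (v + w) \<alpha> = g v \<alpha> + g w \<alpha>"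
      "\<forall>c v \<alpha>. g (c *s v) \<alpha> = c * g v \<alpha>" "\<forall>x v. \<forall>\<alpha>\<in>\<Phi>. g (M x v) \<alpha> = \<alpha> x * g v \<alpha>"
    by blast
  \<comment> \<open>The locale requires some embedding, and it is taken from \<Phi>. Were \<Phi>
    empty, \<open>g\<close> would identify V with the zero space, while V has positive
    dimension.\<close>
  have "\<Phi> \<noteq> {}"
  proof
    assume "\<Phi> = {}"
    then have "g v = (\<lambda>_. 0)" for v using bij_betwE[OF g(1)] by auto
    then have "(1 :: 'c ^ 'n) = 0" using bij_betw_imp_inj_on[OF g(1)] by (intro injD[of g]) auto
    then show False by simp
  qed
  then obtain \<alpha>0 where \<alpha>0: "\<alpha>0 \<in> embeddings emb \<iota>" using \<Phi> by blast
  interpret cm_type_dual_pair \<iota> emb cabs \<alpha>0 L m M L' \<beta> \<Phi> g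
  proof (intro cm_type_dual_pair.intro cm_dual_pair.intro cm_lattice.intro embedded_extension.intro
      separable_extension.intro structure_map.intro cm_type_dual_pair_axioms.intro cm_dual_pair_axioms.intro
      cm_lattice_axioms.intro embedded_extension_axioms.intro separable_extension_axioms.intro)
    show "unital_ring_hom \<iota>" using assms(2) by (simp add: finite_separable_def)
  qed (use assms \<alpha>0 \<Phi> mL m_poly M g in simp_all)
  show ?thesis
    using complete_multiplication_M' M'_dual_action module_class_dual
    unfolding assms(9) \<Phi>'_def by blast
qed

end
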